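(* Let $G$ be a countably infinite abelian group. If $S\subseteq G$ is measure expanding, then there is a measure expanding set $S'\subseteq S$ such that no translate $S'+g$ ($g\in G$) of $S'$ is a set of strong recurrence for weak mixing systems. In particular, no translate of $S'$ is a set of strong recurrence.
   Context: Let $G$ be a countable abelian group (discrete, written additively). A $G$-system is a triple $(X,\mu,T)$ where $(X,\mu)$ is a probability measure space and $T$ is an action of $G$ on $X$ by measure preserving transformations: $\mu(T^gD)=\mu(D)$ for every measurable $D\subseteq X$ and all $g\in G$. $S\subseteq G$ is a set of recurrence if for every $G$-system $(X,\mu,T)$ and every measurable $D\subseteq X$ with $\mu(D)>0$ there is $g\in S$ with $\mu(D\cap T^gD)>0$. $S$ is measure expanding if $S+h$ is a set of recurrence for every $h\in G$. $S$ is a set of strong recurrence if for every $G$-system $(X,\mu,T)$ and every measurable $D\subseteq X$ with $\mu(D)>0$ there exist $c>0$ and infinitely many $g\in S$ with $\mu(D\cap T^gD)>c$. $S$ is a set of strong recurrence for weak mixing systems if the same holds for every weak mixing $G$-system $(X,\mu,T)$ and every measurable $D\subseteq X$ with $\mu(D)>0$. $(X,\mu,T)$ is ergodic if every measurable $D\subseteq X$ with $\mu(D\triangle T^gD)=0$ for all $g\in G$ has $\mu(D)\in\{0,1\}$; it is weak mixing if $(X\times X,\mu\times\mu,T\times T)$ is ergodic. *)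

theory Defs
  imports "HOL-Probability.Probability"
begin

definition G_system :: "'x measure \<Rightarrow> ('g::ab_group_add \<Rightarrow> 'x \<Rightarrow> 'x) \<Rightarrow> bool" where
  "G_system M T \<longleftrightarrow>
     prob_space M \<and>
     (\<forall>g. T g \<in> measurable M M) \<and>
     (\<forall>x\<in>space M. T 0 x = x) \<and>
     (\<forall>g h. \<forall>x\<in>space M. T (g + h) x = T g (T h x)) \<and>
     (\<forall>g. \<forall>D\<in>sets M. measure M (T g ` D) = measure M D)"

definition ergodic :: "'x measure \<Rightarrow> ('g::ab_group_add \<Rightarrow> 'x \<Rightarrow> 'x) \<Rightarrow> bool" where
  "ergodic M T \<longleftrightarrow>
     (\<forall>D\<in>sets M. (\<forall>g. measure M (sym_diff D (T g ` D)) = 0) \<longrightarrow> measure M D \<in> {0, 1})"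

definition weak_mixing :: "'x measure \<Rightarrow> ('g::ab_group_add \<Rightarrow> 'x \<Rightarrow> 'x) \<Rightarrow> bool" where
  "weak_mixing M T \<longleftrightarrow> ergodic (M \<Otimes>\<^sub>M M) (\<lambda>g. map_prod (T g) (T g))"

text \<open>
  HOL cannot quantify over the types carrying the systems inside a formula, so each notion of
  recurrence is first stated relative to the type of points.
\<close>

definition recurrence_on :: "'x itself \<Rightarrow> 'g::ab_group_add set \<Rightarrow> bool" where
  "recurrence_on X S \<longleftrightarrow>
     (\<forall>(M :: 'x measure) T D. G_system M T \<longrightarrow> D \<in> sets M \<longrightarrow> measure M D > 0 \<longrightarrow>
        (\<exists>g\<in>S. measure M (D \<inter> T g ` D) > 0))"

definition strong_recurrence_on :: "'x itself \<Rightarrow> 'g::ab_group_add set \<Rightarrow> bool" where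
  "strong_recurrence_on X S \<longleftrightarrow>
     (\<forall>(M :: 'x measure) T D. G_system M T \<longrightarrow> D \<in> sets M \<longrightarrow> measure M D > 0 \<longrightarrow>
        (\<exists>c>0. infinite {g\<in>S. measure M (D \<inter> T g ` D) > c}))"

definition strong_recurrence_weak_mixing_on :: "'x itself \<Rightarrow> 'g::ab_group_add set \<Rightarrow> bool" where
  "strong_recurrence_weak_mixing_on X S \<longleftrightarrow>
     (\<forall>(M :: 'x measure) T D. G_system M T \<longrightarrow> weak_mixing M T \<longrightarrow>
        D \<in> sets M \<longrightarrow> measure M D > 0 \<longrightarrow>
        (\<exists>c>0. infinite {g\<in>S. measure M (D \<inter> T g ` D) > c}))"

text \<open>
  The type \<^typ>\<open>'g \<Rightarrow> bool\<close> of points suffices: any system with a set \<open>D\<close> has the factor given by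
  \<open>x \<mapsto> (\<lambda>g. T g x \<in> D)\<close>, which carries all the measures of \<open>D \<inter> T g ` D\<close>. By
  \<open>set_of_recurrence_all_types\<close> and its two analogues below, each of the following predicates
  implies the same property for systems on an arbitrary type.
\<close>

definition set_of_recurrence :: "'g::ab_group_add set \<Rightarrow> bool" where
  "set_of_recurrence S \<longleftrightarrow> recurrence_on TYPE('g \<Rightarrow> bool) S"

definition set_of_strong_recurrence :: "'g::ab_group_add set \<Rightarrow> bool" where
  "set_of_strong_recurrence S \<longleftrightarrow> strong_recurrence_on TYPE('g \<Rightarrow> bool) S"

definition set_of_strong_recurrence_weak_mixing :: "'g::ab_group_add set \<Rightarrow> bool" where
  "set_of_strong_recurrence_weak_mixing S \<longleftrightarrow> strong_recurrence_weak_mixing_on TYPE('g \<Rightarrow> bool) S"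

definition translate :: "'g::ab_group_add set \<Rightarrow> 'g \<Rightarrow> 'g set" where
  "translate S h = (\<lambda>s. s + h) ` S"

definition measure_expanding :: "'g::ab_group_add set \<Rightarrow> bool" where
  "measure_expanding S \<longleftrightarrow> (\<forall>h. set_of_recurrence (translate S h))"


lemma G_system_image:
  assumes "G_system M T" "D \<in> sets M"
  shows "T g ` D = T (- g) -` D \<inter> space M" "T g ` D \<in> sets M"
proof -
  have D: "D \<subseteq> space M" using assms(2) by (rule sets.sets_into_space)
  have m: "T h \<in> measurable M M" for h using assms(1) by (simp add: G_system_def)
  have sp: "T h x \<in> space M" if "x \<in> space M" for h x
    using measurable_space[OF m that] .
  have inv: "T h (T (- h) x) = x" "T (- h) (T h x) = x" if "x \<in> space M" for h x
  proof -
    have z: "T 0 x = x" and a: "T (k + l) x = T k (T l x)" for k l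
      using assms(1) that by (simp_all add: G_system_def)
    show "T h (T (- h) x) = x" using a[of h "- h"] z by simp
    show "T (- h) (T h x) = x" using a[of "- h" h] z by simp
  qed
  show eq: "T g ` D = T (- g) -` D \<inter> space M"
  proof
    show "T g ` D \<subseteq> T (- g) -` D \<inter> space M"
      using D sp inv by auto
    show "T (- g) -` D \<inter> space M \<subseteq> T g ` D"
    proof
      fix x assume "x \<in> T (- g) -` D \<inter> space M"
      then have "T (- g) x \<in> D" "x = T g (T (- g) x)" by (simp_all add: inv(1))
      then show "x \<in> T g ` D" by (rule rev_image_eqI)
    qed
  qed
  show "T g ` D \<in> sets M"
    unfolding eq using m assms(2) by (rule measurable_sets)
qed

lemma G_system_distr:
  assumes "G_system M T"
  shows "distr M M (T g) = M"
proof (rule measure_eqI)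
  interpret prob_space M using assms by (simp add: G_system_def)
  fix A assume "A \<in> sets (distr M M (T g))"
  then have A: "A \<in> sets M" by simp
  have m: "T g \<in> measurable M M" using assms by (simp add: G_system_def)
  have "measure M (T (- g) ` A) = measure M A"
    using assms A by (simp add: G_system_def)
  then show "emeasure (distr M M (T g)) A = emeasure M A"
    using G_system_image[OF assms A, of "- g"] m A
    by (simp add: emeasure_distr emeasure_eq_measure)
qed simp

lemma G_systemI:
  assumes "prob_space M"
    and m: "\<And>g. T g \<in> measurable M M"
    and z: "\<And>x. x \<in> space M \<Longrightarrow> T 0 x = x"
    and a: "\<And>g h x. x \<in> space M \<Longrightarrow> T (g + h) x = T g (T h x)"
    and d: "\<And>g. distr M M (T g) = M"
  shows "G_system M T"
  unfolding G_system_def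
proof (intro conjI allI ballI)
  fix g D assume D: "D \<in> sets M"
  have Ds: "D \<subseteq> space M" using D by (rule sets.sets_into_space)
  have sp: "T h x \<in> space M" if "x \<in> space M" for h x
    using measurable_space[OF m that] .
  have inv: "T h (T (- h) x) = x" "T (- h) (T h x) = x" if "x \<in> space M" for h x
    using a[OF that, of h "- h"] a[OF that, of "- h" h] z[OF that] by simp_all
  have eq: "T g ` D = T (- g) -` D \<inter> space M"
  proof
    show "T g ` D \<subseteq> T (- g) -` D \<inter> space M"
      using Ds sp inv by auto
    show "T (- g) -` D \<inter> space M \<subseteq> T g ` D"
    proof
      fix x assume "x \<in> T (- g) -` D \<inter> space M"
      then have "T (- g) x \<in> D" "x = T g (T (- g) x)" by (simp_all add: inv(1))
      then show "x \<in> T g ` D" by (rule rev_image_eqI)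
    qed
  qed
  have "measure M D = measure (distr M M (T (- g))) D" by (simp add: d)
  also have "\<dots> = measure M (T g ` D)" unfolding eq by (rule measure_distr[OF m D])
  finally show "measure M (T g ` D) = measure M D" by simp
qed (use assms in auto)

lemma G_system_prod:
  assumes "G_system M T"
  shows "G_system (M \<Otimes>\<^sub>M M) (\<lambda>g. map_prod (T g) (T g))"
proof (rule G_systemI)
  interpret prob_space M using assms by (simp add: G_system_def)
  interpret P: pair_prob_space M M ..
  show "prob_space (M \<Otimes>\<^sub>M M)" by (rule P.prob_space_axioms)
  have [measurable]: "T g \<in> measurable M M" for g using assms by (simp add: G_system_def)
  fix g
  show "map_prod (T g) (T g) \<in> measurable (M \<Otimes>\<^sub>M M) (M \<Otimes>\<^sub>M M)"
    unfolding map_prod_def by measurable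
  have "sigma_finite_measure (distr M M (T g))"
    by (simp add: G_system_distr[OF assms] sigma_finite_measure_axioms)
  then have "distr M M (T g) \<Otimes>\<^sub>M distr M M (T g)
      = distr (M \<Otimes>\<^sub>M M) (M \<Otimes>\<^sub>M M) (\<lambda>(x, y). (T g x, T g y))"
    by (intro pair_measure_distr) auto
  then show "distr (M \<Otimes>\<^sub>M M) (M \<Otimes>\<^sub>M M) (map_prod (T g) (T g)) = M \<Otimes>\<^sub>M M"
    by (simp add: G_system_distr[OF assms] map_prod_def)
qed (use assms in \<open>auto simp: G_system_def space_pair_measure\<close>)

lemma factor_image:
  assumes M: "G_system M T" and N: "G_system N U"
    and p: "p \<in> measurable M N"
    and e: "\<And>g x. x \<in> space M \<Longrightarrow> p (T g x) = U g (p x)"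
    and A: "A \<in> sets N"
  shows "p -` (U g ` A) \<inter> space M = T g ` (p -` A \<inter> space M)"
proof -
  have pA: "p -` A \<inter> space M \<in> sets M" using p A by (rule measurable_sets)
  have m: "T h \<in> measurable M M" for h using M by (simp add: G_system_def)
  show ?thesis
    unfolding G_system_image(1)[OF M pA] G_system_image(1)[OF N A]
    using measurable_space[OF p] measurable_space[OF m] e by auto
qed

lemma factor_ergodic:
  assumes M: "G_system M T" and N: "G_system N U"
    and p: "p \<in> measurable M N" and d: "distr M N p = N"
    and e: "\<And>g x. x \<in> space M \<Longrightarrow> p (T g x) = U g (p x)"
    and erg: "ergodic M T"
  shows "ergodic N U"
  unfolding ergodic_def
proof (intro ballI impI)
  fix A assume A: "A \<in> sets N" and inv: "\<forall>g. measure N (sym_diff A (U g ` A)) = 0"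
  have md: "measure N B = measure M (p -` B \<inter> space M)" if "B \<in> sets N" for B
    using measure_distr[OF p that] d by simp
  let ?B = "p -` A \<inter> space M"
  have B: "?B \<in> sets M" using p A by (rule measurable_sets)
  have "measure M (sym_diff ?B (T g ` ?B)) = 0" for g
  proof -
    have "sym_diff ?B (T g ` ?B) = p -` (sym_diff A (U g ` A)) \<inter> space M"
    proof -
      have "p -` (U g ` A) \<inter> space M = T g ` ?B"
        using M N p e A by (rule factor_image)
      moreover have "sym_diff ?B (p -` C \<inter> space M) = p -` (sym_diff A C) \<inter> space M" for C
        by blast
      ultimately show ?thesis by (rule subst)
    qed
    moreover have "sym_diff A (U g ` A) \<in> sets N"
      using A G_system_image(2)[OF N A, of g] by (intro sets.Un sets.Diff)
    ultimately show ?thesis using inv md[of "sym_diff A (U g ` A)"] by (simp only:)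
  qed
  then have "measure M ?B \<in> {0, 1}" using erg B unfolding ergodic_def by blast
  then show "measure N A \<in> {0, 1}" using md[OF A] by simp
qed

lemma symbolic_factor:
  fixes T :: "'g::ab_group_add \<Rightarrow> 'x \<Rightarrow> 'x"
  assumes M: "G_system M T" and D: "D \<in> sets M"
  obtains N :: "('g \<Rightarrow> bool) measure" and U E
  where "G_system N U" "E \<in> sets N" "measure N E = measure M D"
    "\<forall>g. measure N (E \<inter> U g ` E) = measure M (D \<inter> T g ` D)"
    "weak_mixing M T \<longrightarrow> weak_mixing N U"
proof -
  interpret prob_space M using M by (simp add: G_system_def)
  let ?P = "Pi\<^sub>M (UNIV :: 'g set) (\<lambda>_. count_space (UNIV :: bool set))"
  define p where "p x = (\<lambda>g. T g x \<in> D)" for x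
  define U :: "'g \<Rightarrow> ('g \<Rightarrow> bool) \<Rightarrow> 'g \<Rightarrow> bool" where "U h w = (\<lambda>g. w (g + h))" for h w
  define N where "N = distr M ?P p"
  define E where "E = {w :: 'g \<Rightarrow> bool. w 0}"
  note [measurable] = D
  have [measurable]: "T g \<in> measurable M M" for g using M by (simp add: G_system_def)
  have pP [measurable]: "p \<in> measurable M ?P"
    unfolding p_def by (rule measurable_PiM_single') (auto simp: space_PiM)
  have spP: "space ?P = UNIV" by (auto simp: space_PiM)
  have setsN: "sets N = sets ?P" and spN: "space N = UNIV" by (auto simp: N_def spP)
  have pN: "p \<in> measurable M N" using pP by (simp add: N_def)
  have UP [measurable]: "U h \<in> measurable ?P ?P" for h
    unfolding U_def by (rule measurable_PiM_single') (auto simp: space_PiM)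
  have UN: "U h \<in> measurable N N" for h using UP by (simp add: N_def)
  have dN: "distr M N p = N" unfolding N_def by (rule distr_cong) auto
  have eq: "p (T g x) = U g (p x)" if "x \<in> space M" for g x
    using M that by (auto simp: p_def U_def G_system_def)
  have N: "G_system N U"
  proof (rule G_systemI)
    show "prob_space N" unfolding N_def by (rule prob_space_distr[OF pP])
    show "distr N N (U g) = N" for g
    proof -
      have "distr N N (U g) = distr (distr M N p) N (U g)" by (simp add: dN)
      also have "\<dots> = distr M N (U g \<circ> p)" by (rule distr_distr[OF UN pN])
      also have "\<dots> = distr M N (p \<circ> T g)" by (rule distr_cong) (auto simp: eq)
      also have "\<dots> = distr (distr M M (T g)) N p" by (rule distr_distr[symmetric, OF pN]) simp
      also have "\<dots> = N" by (simp add: G_system_distr[OF M] dN)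
      finally show ?thesis .
    qed
  qed (use UN in \<open>auto simp: U_def ac_simps\<close>)
  have E: "E \<in> sets N"
  proof -
    have "(\<lambda>w. w 0) -` {True} \<inter> space ?P \<in> sets ?P"
      by (rule measurable_sets[OF measurable_component_singleton]) auto
    moreover have "(\<lambda>w. w 0) -` {True} \<inter> space ?P = E" by (auto simp: E_def spP)
    ultimately show ?thesis by (simp add: setsN)
  qed
  have pE: "p -` E \<inter> space M = D"
    using M sets.sets_into_space[OF D] by (auto simp: E_def p_def G_system_def)
  have md: "measure N B = measure M (p -` B \<inter> space M)" if "B \<in> sets N" for B
    using measure_distr[OF pN that] dN by simp
  show thesis
  proof (rule that[OF N E])
    show "measure N E = measure M D" using md[OF E] pE by simp
    show "\<forall>g. measure N (E \<inter> U g ` E) = measure M (D \<inter> T g ` D)"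
    proof
      fix g
      have "E \<inter> U g ` E \<in> sets N" using E G_system_image(2)[OF N E] by auto
      moreover have "p -` (E \<inter> U g ` E) \<inter> space M = D \<inter> T g ` D"
      proof -
        have "p -` (E \<inter> U g ` E) \<inter> space M
            = (p -` E \<inter> space M) \<inter> (p -` (U g ` E) \<inter> space M)" by blast
        also have "p -` (U g ` E) \<inter> space M = T g ` (p -` E \<inter> space M)"
          using M N pN eq E by (rule factor_image)
        finally show ?thesis by (simp only: pE)
      qed
      ultimately show "measure N (E \<inter> U g ` E) = measure M (D \<inter> T g ` D)"
        using md by simp
    qed
    show "weak_mixing M T \<longrightarrow> weak_mixing N U"
      unfolding weak_mixing_def
    proof (rule impI, rule factor_ergodic[OF G_system_prod[OF M] G_system_prod[OF N]])
      assume "ergodic (M \<Otimes>\<^sub>M M) (\<lambda>g. map_prod (T g) (T g))"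
      then show "ergodic (M \<Otimes>\<^sub>M M) (\<lambda>g. map_prod (T g) (T g))" .
      show "map_prod p p \<in> measurable (M \<Otimes>\<^sub>M M) (N \<Otimes>\<^sub>M N)"
        unfolding map_prod_def using pN by measurable
      have "prob_space (distr M N p)" using N dN by (simp add: G_system_def)
      then have "sigma_finite_measure (distr M N p)"
        by (simp add: prob_space_imp_sigma_finite)
      then have "distr M N p \<Otimes>\<^sub>M distr M N p
          = distr (M \<Otimes>\<^sub>M M) (N \<Otimes>\<^sub>M N) (\<lambda>(x, y). (p x, p y))"
        by (intro pair_measure_distr pN)
      then show "distr (M \<Otimes>\<^sub>M M) (N \<Otimes>\<^sub>M N) (map_prod p p) = N \<Otimes>\<^sub>M N"
        by (simp add: dN map_prod_def)
    qed (auto simp: space_pair_measure eq)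
  qed
qed

lemma set_of_recurrence_all_types:
  fixes S :: "'g::ab_group_add set"
  assumes "set_of_recurrence S"
  shows "recurrence_on TYPE('x) S"
  unfolding recurrence_on_def
proof (intro allI impI)
  fix M :: "'x measure" and T :: "'g \<Rightarrow> 'x \<Rightarrow> 'x" and D
  assume M: "G_system M T" and D: "D \<in> sets M" and pos: "measure M D > 0"
  obtain N :: "('g \<Rightarrow> bool) measure" and U E where
    N: "G_system N U" "E \<in> sets N" "measure N E = measure M D"
      "\<forall>g. measure N (E \<inter> U g ` E) = measure M (D \<inter> T g ` D)"
      "weak_mixing M T \<longrightarrow> weak_mixing N U"
    by (rule symbolic_factor[OF M D])
  have "\<exists>g\<in>S. measure N (E \<inter> U g ` E) > 0"
    using assms N(1-3) pos unfolding set_of_recurrence_def recurrence_on_def by simp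
  then show "\<exists>g\<in>S. measure M (D \<inter> T g ` D) > 0" by (simp add: N(4))
qed

lemma set_of_strong_recurrence_all_types:
  fixes S :: "'g::ab_group_add set"
  assumes "set_of_strong_recurrence S"
  shows "strong_recurrence_on TYPE('x) S"
  unfolding strong_recurrence_on_def
proof (intro allI impI)
  fix M :: "'x measure" and T :: "'g \<Rightarrow> 'x \<Rightarrow> 'x" and D
  assume M: "G_system M T" and D: "D \<in> sets M" and pos: "measure M D > 0"
  obtain N :: "('g \<Rightarrow> bool) measure" and U E where
    N: "G_system N U" "E \<in> sets N" "measure N E = measure M D"
      "\<forall>g. measure N (E \<inter> U g ` E) = measure M (D \<inter> T g ` D)"
      "weak_mixing M T \<longrightarrow> weak_mixing N U"
    by (rule symbolic_factor[OF M D])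
  have "\<exists>c>0. infinite {g\<in>S. measure N (E \<inter> U g ` E) > c}"
    using assms N(1-3) pos unfolding set_of_strong_recurrence_def strong_recurrence_on_def by simp
  then show "\<exists>c>0. infinite {g\<in>S. measure M (D \<inter> T g ` D) > c}" by (simp add: N(4))
qed

lemma set_of_strong_recurrence_weak_mixing_all_types:
  fixes S :: "'g::ab_group_add set"
  assumes "set_of_strong_recurrence_weak_mixing S"
  shows "strong_recurrence_weak_mixing_on TYPE('x) S"
  unfolding strong_recurrence_weak_mixing_on_def
proof (intro allI impI)
  fix M :: "'x measure" and T :: "'g \<Rightarrow> 'x \<Rightarrow> 'x" and D
  assume M: "G_system M T" and wm: "weak_mixing M T"
    and D: "D \<in> sets M" and pos: "measure M D > 0"
  obtain N :: "('g \<Rightarrow> bool) measure" and U E where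
    N: "G_system N U" "E \<in> sets N" "measure N E = measure M D"
      "\<forall>g. measure N (E \<inter> U g ` E) = measure M (D \<inter> T g ` D)"
      "weak_mixing M T \<longrightarrow> weak_mixing N U"
    by (rule symbolic_factor[OF M D])
  have "\<exists>c>0. infinite {g\<in>S. measure N (E \<inter> U g ` E) > c}"
    using assms N(1-3) N(5) wm pos
    unfolding set_of_strong_recurrence_weak_mixing_def strong_recurrence_weak_mixing_on_def by simp
  then show "\<exists>c>0. infinite {g\<in>S. measure M (D \<inter> T g ` D) > c}" by (simp add: N(4))
qed

end

theory Submission
  imports Defs "HOL-Complex_Analysis.Great_Picard"
begin

text \<open>
  Rigidity obstructs strong recurrence. Let \<open>C\<close> be a positive definite function on the group with
  \<open>C 0 = 1\<close>, and let the group act by shifts on the stationary Gaussian process \<open>w\<close> in which \<open>w g\<close>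
  and \<open>w h\<close> have covariance \<open>C (g - h)\<close>. If \<open>C (e n + k)\<close> tends to \<open>0\<close> for every \<open>k\<close> along one
  sequence \<open>e\<close>, this system is weak mixing. If \<open>C s\<close> tends to \<open>1\<close> along a set \<open>R\<close>, then \<open>w (x - s)\<close>
  is close to \<open>w x\<close> in measure for \<open>s\<close> in \<open>R\<close>. Take \<open>g\<close> with \<open>C g < 1\<close>. Then for some level \<open>q\<close> the
  event \<open>D\<close> that \<open>w (- g) \<le> q < w 0\<close> has positive measure. A point of \<open>D \<inter> T (s + g) ` D\<close> has
  \<open>w (- g) \<le> q < w (- g - s)\<close>, which has small measure when \<open>C s\<close> is near \<open>1\<close>. So the translate of
  \<open>R\<close> by \<open>g\<close> is not a set of strong recurrence for weak mixing systems
  (\<open>rigid_translate_not_strongly_recurrent\<close>).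

  It remains to find such a \<open>C\<close> together with a measure expanding \<open>R \<subseteq> S\<close>
  (\<open>rigid_measure_expanding_subset\<close>). The function \<open>C\<close> is the limit of averages of real parts of
  characters from a suitable group \<open>\<Gamma>\<close> of characters. Each stage of the construction hardly changes
  the average on a finite set fixed before, and does three things: it makes the average smaller than
  \<open>1\<close> at the next group element (\<open>freeness_step\<close>), almost \<open>0\<close> on a translate \<open>e n + F\<close> of a finite
  set (\<open>mixing_step\<close>), and almost \<open>1\<close> on a finite piece of \<open>S\<close> whose translate by a given \<open>h\<close> is
  recurrent for all sets of measure at least a given \<open>\<delta>\<close> (\<open>recurrence_step\<close>). The union of these
  pieces over all \<open>h\<close> and \<open>\<delta> = 1 / (j + 1)\<close> is measure expanding.

  The last of the three requirements carries the main idea. One chooses group elements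
  \<open>e 0, \<dots>, e (M - 1)\<close> with sum \<open>h\<close> and replaces every character by many twists, each of which is
  almost \<open>1\<close> at all of these elements but one. If the vectors \<open>a\<close> and \<open>b\<close> in \<open>{0, \<dots>, L - 1}\<^sup>M\<close>
  satisfy \<open>a i = b i + 1\<close> for all but few \<open>i\<close>, then the new average is almost \<open>1\<close> at
  \<open>(\<Sum>i. a i e i) - (\<Sum>i. b i e i) - h\<close> (\<open>hamming_step\<close>). Every set of measure at least \<open>\<delta>\<close> is visited
  by some point at a proportion \<open>\<delta>\<close> of the times \<open>\<Sum>i. a i e i\<close>, and concentration of measure in the
  box provides such \<open>a\<close> and \<open>b\<close> among these visits (\<open>box_shift_almost_fixed\<close>, \<open>box_recurrence\<close>). The
  resulting return time is \<open>b + h\<close> with a \<open>b\<close> at which the average is near \<open>1\<close>, but \<open>b\<close> need not be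
  in \<open>S\<close>. As \<open>S - b\<close> is a set of recurrence, and remains one after intersection with a Bohr
  neighbourhood of \<open>0\<close>, \<open>b\<close> can be replaced by an element of \<open>S\<close> at which the characters have almost
  the same values (\<open>recurrence_near\<close>). Compactness (\<open>recurrent_at_finite_subset\<close>) then leaves a
  finite piece of \<open>S\<close>.

  One application of this construction yields \<open>C g < 1\<close> only if some character in \<open>\<Gamma>\<close> is nontrivial
  at \<open>g\<close>; for \<open>g = 0\<close> it fails of necessity. It is therefore applied twice: to \<open>S\<close>, giving \<open>S1\<close>, and
  then to the translate \<open>S1 - h\<close>, giving \<open>S2\<close>, where some character in \<open>\<Gamma>\<close> is nontrivial at \<open>h\<close>. The
  set \<open>S2 + h\<close> is rigid for the first system, and its translate by a \<open>g\<close> at which \<open>\<Gamma>\<close> is trivial is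
  the translate of \<open>S2\<close> by \<open>h + g\<close>, which the second system handles.
\<close>

section \<open>Extending homomorphisms into the nonzero complex numbers\<close>

primrec nsmul :: "nat \<Rightarrow> 'g::ab_group_add \<Rightarrow> 'g" where
  "nsmul 0 x = 0"
| "nsmul (Suc n) x = x + nsmul n x"

lemma nsmul_add: "nsmul (m + n) x = nsmul m x + nsmul n x"
  by (induction m) (simp_all add: ac_simps)

lemma nsmul_mult: "nsmul (m * n) x = nsmul m (nsmul n x)"
  by (induction m) (simp_all add: nsmul_add)

lemma nsmul_diff: "nsmul n (x - y) = nsmul n x - nsmul n y"
  by (induction n) (simp_all add: algebra_simps)

lemma nsmul_zero [simp]: "nsmul n 0 = 0"
  by (induction n) simp_all

definition subgrp :: "'g::ab_group_add set \<Rightarrow> bool" where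
  "subgrp H \<longleftrightarrow> 0 \<in> H \<and> (\<forall>x\<in>H. \<forall>y\<in>H. x - y \<in> H)"

lemma subgrpD:
  assumes "subgrp H"
  shows "0 \<in> H" "x \<in> H \<Longrightarrow> y \<in> H \<Longrightarrow> x - y \<in> H" "x \<in> H \<Longrightarrow> - x \<in> H"
    "x \<in> H \<Longrightarrow> y \<in> H \<Longrightarrow> x + y \<in> H" "x \<in> H \<Longrightarrow> nsmul n x \<in> H"
proof -
  show 0: "0 \<in> H" and d: "x \<in> H \<Longrightarrow> y \<in> H \<Longrightarrow> x - y \<in> H" for x y
    using assms by (auto simp: subgrp_def)
  show m: "x \<in> H \<Longrightarrow> - x \<in> H" for x using d[OF 0, of x] by simp
  show a: "x \<in> H \<Longrightarrow> y \<in> H \<Longrightarrow> x + y \<in> H" for x y using d[OF _ m, of x y] by simp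
  show "x \<in> H \<Longrightarrow> nsmul n x \<in> H" by (induction n) (auto simp: 0 a)
qed

definition hom_on :: "'g::ab_group_add set \<Rightarrow> ('g \<Rightarrow> complex) \<Rightarrow> bool" where
  "hom_on H f \<longleftrightarrow> (\<forall>x\<in>H. f x \<noteq> 0) \<and> (\<forall>x\<in>H. \<forall>y\<in>H. f (x + y) = f x * f y)"

lemma hom_onD:
  assumes "hom_on H f" "subgrp H"
  shows "f 0 = 1" "x \<in> H \<Longrightarrow> f (nsmul n x) = f x ^ n"
    "x \<in> H \<Longrightarrow> y \<in> H \<Longrightarrow> f (x - y) = f x / f y"
proof -
  have nz: "\<And>x. x \<in> H \<Longrightarrow> f x \<noteq> 0" and m: "\<And>x y. x \<in> H \<Longrightarrow> y \<in> H \<Longrightarrow> f (x + y) = f x * f y"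
    using assms(1) by (auto simp: hom_on_def)
  note H = subgrpD[OF assms(2)]
  show 0: "f 0 = 1" using m[of 0 0] nz[of 0] H(1) by simp
  show "x \<in> H \<Longrightarrow> f (nsmul n x) = f x ^ n"
    by (induction n) (auto simp: 0 m H)
  show "x \<in> H \<Longrightarrow> y \<in> H \<Longrightarrow> f (x - y) = f x / f y"
    using m[of "x - y" y] nz[of y] H(2)[of x y] by (simp add: field_simps)
qed

text \<open>
  The elements of the subgroup generated by \<open>H\<close> and \<open>x\<close> are \<open>h + n x - m x\<close>, with two natural
  numbers in place of an integer. In two such representations of one element the parts from \<open>H\<close>
  differ by a multiple of \<open>x\<close>, at which \<open>f\<close> is a power of \<open>z\<close>; so \<open>f h * z ^ n / z ^ m\<close> depends on
  the element only.
\<close>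

lemma hom_on_adjoin:
  assumes H: "subgrp H" and f: "hom_on H f" and z: "z \<noteq> 0"
    and comp: "\<And>n. nsmul n x \<in> H \<Longrightarrow> f (nsmul n x) = z ^ n"
  shows "\<exists>H' f'. subgrp H' \<and> hom_on H' f' \<and> H \<subseteq> H' \<and> x \<in> H' \<and> (\<forall>h\<in>H. f' h = f h) \<and> f' x = z"
proof -
  note HD = subgrpD[OF H] and fD = hom_onD[OF f H]
  have fnz: "h \<in> H \<Longrightarrow> f h \<noteq> 0" and fm: "h \<in> H \<Longrightarrow> k \<in> H \<Longrightarrow> f (h + k) = f h * f k" for h k
    using f by (auto simp: hom_on_def)
  define e where "e = (\<lambda>(h, n, m). h + nsmul n x - nsmul m x)"
  define v where "v = (\<lambda>(h, n, m). f h * z ^ n / z ^ m)"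
  define A where "A = H \<times> (UNIV :: nat set) \<times> (UNIV :: nat set)"
  have le: "f h * z ^ p = f h' * z ^ q" if "h \<in> H" "h' \<in> H" "h + nsmul p x = h' + nsmul q x" "p \<ge> q"
    for h h' p q
  proof -
    have p: "p = (p - q) + q" using that by simp
    then have "nsmul p x = nsmul (p - q) x + nsmul q x" by (metis nsmul_add)
    with that have *: "nsmul (p - q) x = h' - h" by (simp add: algebra_simps)
    then have "z ^ (p - q) = f h' / f h" using comp[of "p - q"] that HD(2) fD(3) by simp
    then have "z ^ (p - q) * f h = f h'" using fnz[OF that(1)] by simp
    moreover have "z ^ p = z ^ (p - q) * z ^ q" by (subst p) (simp only: power_add)
    ultimately show ?thesis by (metis mult.assoc mult.commute)
  qed
  have gen: "f h * z ^ p = f h' * z ^ q" if "h \<in> H" "h' \<in> H" "h + nsmul p x = h' + nsmul q x"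
    for h h' p q
    using le[OF that] le[OF that(2,1) that(3)[symmetric]] by (cases "p \<ge> q") auto
  have wd: "v a = v b" if "a \<in> A" "b \<in> A" "e a = e b" for a b
  proof -
    obtain h n m h' n' m' where a: "a = (h, n, m)" and b: "b = (h', n', m')"
      by (cases a, cases b) auto
    have "h + nsmul (n + m') x = h' + nsmul (n' + m) x"
      using that(3) by (simp add: a b e_def nsmul_add algebra_simps)
    then have "f h * z ^ (n + m') = f h' * z ^ (n' + m)"
      using that(1,2) by (intro gen) (simp_all add: a b A_def)
    then show ?thesis using z by (simp add: a b v_def power_add field_simps)
  qed
  define f' where "f' y = v (SOME a. a \<in> A \<and> e a = y)" for y
  have f'e: "f' (e a) = v a" if "a \<in> A" for a
  proof -
    have "(SOME b. b \<in> A \<and> e b = e a) \<in> A \<and> e (SOME b. b \<in> A \<and> e b = e a) = e a"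
      by (rule someI[of _ a]) (use that in simp)
    then show ?thesis unfolding f'_def using wd that by blast
  qed
  have vnz: "v a \<noteq> 0" if "a \<in> A" for a using that fnz z by (auto simp: v_def A_def)
  have add: "\<exists>c\<in>A. e c = e a + e b \<and> v c = v a * v b" if "a \<in> A" "b \<in> A" for a b
  proof -
    obtain h n m h' n' m' where a: "a = (h, n, m)" and b: "b = (h', n', m')"
      by (cases a, cases b) auto
    show ?thesis
      by (rule bexI[of _ "(h + h', n + n', m + m')"])
        (use that in \<open>auto simp: a b e_def v_def A_def nsmul_add algebra_simps power_add fm HD\<close>)
  qed
  have sub: "\<exists>c\<in>A. e c = e a - e b" if "a \<in> A" "b \<in> A" for a b
  proof -
    obtain h n m h' n' m' where a: "a = (h, n, m)" and b: "b = (h', n', m')"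
      by (cases a, cases b) auto
    show ?thesis
      by (rule bexI[of _ "(h - h', n + m', m + n')"])
        (use that in \<open>auto simp: a b e_def A_def nsmul_add algebra_simps HD\<close>)
  qed
  have h: "e (h, 0, 0) = h" "v (h, 0, 0) = f h" for h by (auto simp: e_def v_def)
  have x: "e (0, 1, 0) = x" "v (0, 1, 0) = z" by (auto simp: e_def v_def fD)
  show ?thesis
  proof (intro exI[of _ "e ` A"] exI[of _ f'] conjI)
    show "subgrp (e ` A)" unfolding subgrp_def
    proof (intro conjI ballI)
      show "0 \<in> e ` A" by (rule image_eqI[of _ _ "(0, 0, 0)"]) (auto simp: e_def A_def HD)
    qed (use sub in force)
    show "hom_on (e ` A) f'" unfolding hom_on_def
    proof (intro conjI ballI)
      fix y w assume "y \<in> e ` A" "w \<in> e ` A"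
      then obtain a b where ab: "a \<in> A" "b \<in> A" "y = e a" "w = e b" by blast
      show "f' y \<noteq> 0" using f'e[OF ab(1)] vnz[OF ab(1)] ab by simp
      obtain c where "c \<in> A" "e c = e a + e b" "v c = v a * v b" using add[OF ab(1,2)] by blast
      then show "f' (y + w) = f' y * f' w" using f'e[of c] f'e ab by simp
    qed
    show "H \<subseteq> e ` A"
    proof
      fix k assume "k \<in> H"
      then show "k \<in> e ` A" by (intro image_eqI[of _ _ "(k, 0, 0)"]) (auto simp: h A_def)
    qed
    show "x \<in> e ` A" by (rule image_eqI[of _ _ "(0, 1, 0)"]) (use x HD in \<open>auto simp: A_def\<close>)
    show "\<forall>k\<in>H. f' k = f k" using f'e[of "(_, 0, 0)"] h by (auto simp: A_def)
    show "f' x = z" using f'e[of "(0, 1, 0)"] x HD by (simp add: A_def)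
  qed
qed

text \<open>
  The \<open>n\<close> with \<open>n x \<in> H\<close> are the multiples of the least positive one, \<open>d\<close>, if there is any; then
  every \<open>d\<close>-th root of \<open>f (d x)\<close> is compatible with \<open>f\<close>.
\<close>

lemma compatible_root_exists:
  assumes H: "subgrp H" and f: "hom_on H f"
  shows "\<exists>z. z \<noteq> 0 \<and> (\<forall>n. nsmul n x \<in> H \<longrightarrow> f (nsmul n x) = z ^ n)"
proof (cases "\<exists>n>0. nsmul n x \<in> H")
  case False
  then have n0: "n = 0" if "nsmul n x \<in> H" for n using that by auto
  show ?thesis using hom_onD(1)[OF f H] n0 by (intro exI[of _ 1]) force
next
  case True
  note HD = subgrpD[OF H] and fD = hom_onD[OF f H]
  define d where "d = (LEAST n. n > 0 \<and> nsmul n x \<in> H)"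
  have d: "d > 0" "nsmul d x \<in> H" using LeastI_ex[OF True] by (auto simp: d_def)
  have dmin: "\<not> (n > 0 \<and> nsmul n x \<in> H)" if "n < d" for n
    using not_less_Least[OF that[unfolded d_def]] by simp
  have w: "f (nsmul d x) \<noteq> 0" using f d by (auto simp: hom_on_def)
  obtain z where z: "z ^ d = f (nsmul d x)"
  proof -
    have "f (nsmul d x) = exp (Ln (f (nsmul d x)) / d) ^ d"
      using d w by (simp add: exp_of_nat_mult[symmetric])
    then show ?thesis using that by metis
  qed
  show ?thesis
  proof (intro exI[of _ z] conjI allI impI)
    show "z \<noteq> 0" using z w d by (auto simp: zero_power)
    fix n assume n: "nsmul n x \<in> H"
    define r where "r = n mod d"
    have nr: "n = (n div d) * d + r" by (simp add: r_def)
    then have "nsmul n x = nsmul (n div d) (nsmul d x) + nsmul r x"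
      by (metis nsmul_add nsmul_mult)
    then have "nsmul r x = nsmul n x - nsmul (n div d) (nsmul d x)" by simp
    then have "nsmul r x \<in> H" using n d HD by simp
    then have "r = 0" using dmin[of r] d by (auto simp: r_def)
    then have n': "n = (n div d) * d" using nr by simp
    have "f (nsmul n x) = f (nsmul (n div d) (nsmul d x))" by (subst n') (simp only: nsmul_mult)
    also have "\<dots> = (z ^ d) ^ (n div d)" using fD(2)[OF d(2)] z by simp
    also have "\<dots> = z ^ n" by (subst (2) n') (simp add: power_mult mult.commute)
    finally show "f (nsmul n x) = z ^ n" .
  qed
qed

text \<open>
  The elements of the countable group are adjoined one after the other, and the homomorphisms
  obtained are glued.
\<close>

lemma hom_on_extend:
  fixes f :: "'g::ab_group_add \<Rightarrow> complex"
  assumes cnt: "countable (UNIV :: 'g set)" and H: "subgrp H" and f: "hom_on H f"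
  shows "\<exists>f'. hom_on UNIV f' \<and> (\<forall>h\<in>H. f' h = f h)"
proof -
  define en where "en = from_nat_into (UNIV :: 'g set)"
  have en: "\<exists>n. en n = g" for g
    using from_nat_into_surj[OF cnt, of g] by (auto simp: en_def)
  define Q where "Q = (\<lambda>n (a :: 'g set \<times> ('g \<Rightarrow> complex)) b. fst a \<subseteq> fst b \<and> en n \<in> fst b \<and> (\<forall>h\<in>fst a. snd b h = snd a h))"
  define P where "P = (\<lambda>(n::nat) (a :: 'g set \<times> ('g \<Rightarrow> complex)). subgrp (fst a) \<and> hom_on (fst a) (snd a) \<and> H \<subseteq> fst a \<and> (\<forall>h\<in>H. snd a h = f h))"
  have "\<exists>s. \<forall>n. P n (s n) \<and> Q n (s n) (s (Suc n))"
  proof (rule dependent_nat_choice)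
    show "\<exists>a. P 0 a" using H f by (intro exI[of _ "(H, f)"]) (auto simp: P_def)
    fix a n assume a: "P n a"
    then have ha: "subgrp (fst a)" "hom_on (fst a) (snd a)" by (auto simp: P_def)
    obtain z where z: "z \<noteq> 0" "\<forall>m. nsmul m (en n) \<in> fst a \<longrightarrow> snd a (nsmul m (en n)) = z ^ m"
      using compatible_root_exists[OF ha] by blast
    obtain H' f' where *: "subgrp H'" "hom_on H' f'" "fst a \<subseteq> H'" "en n \<in> H'" "\<forall>h\<in>fst a. f' h = snd a h"
      using hom_on_adjoin[OF ha z(1), of "en n"] z(2) by blast
    then show "\<exists>b. P (Suc n) b \<and> Q n a b"
      using a by (intro exI[of _ "(H', f')"]) (auto simp: P_def Q_def)
  qed
  then obtain s where s0: "\<forall>n. P n (s n) \<and> Q n (s n) (s (Suc n))" ..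
  have s: "P n (s n)" "Q n (s n) (s (Suc n))" for n using s0 by simp_all
  have mono: "fst (s m) \<subseteq> fst (s n) \<and> (\<forall>h\<in>fst (s m). snd (s n) h = snd (s m) h)" if "m \<le> n" for m n
    using that
  proof (induction n rule: dec_induct)
    case (step n)
    then show ?case using s(2)[of n] unfolding Q_def by auto
  qed auto
  define idx where "idx g = (SOME n. g \<in> fst (s n))" for g
  have idx: "g \<in> fst (s (idx g))" for g
  proof -
    obtain n where "en n = g" using en by blast
    then have "g \<in> fst (s (Suc n))" using s(2)[of n] by (auto simp: Q_def)
    then show ?thesis unfolding idx_def by (rule someI)
  qed
  define f' where "f' g = snd (s (idx g)) g" for g
  have f': "f' g = snd (s n) g" if "g \<in> fst (s n)" for g n
    using mono[of n "idx g"] mono[of "idx g" n] that idx[of g] by (cases "n \<le> idx g") (auto simp: f'_def)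
  have "hom_on UNIV f'"
    unfolding hom_on_def
  proof (intro conjI ballI)
    fix x y
    show "f' x \<noteq> 0" using s(1)[of "idx x"] idx by (auto simp: f'_def P_def hom_on_def)
    define n where "n = max (idx x) (idx y)"
    have m: "x \<in> fst (s n)" "y \<in> fst (s n)"
      using mono[of "idx x" n] mono[of "idx y" n] idx by (auto simp: n_def)
    moreover have "x + y \<in> fst (s n)" using m s(1)[of n] subgrpD(4) unfolding P_def by blast
    ultimately show "f' (x + y) = f' x * f' y"
      using f' s(1)[of n] by (simp add: P_def hom_on_def)
  qed
  moreover have "f' h = f h" if "h \<in> H" for h
    using f'[of h 0] s(1)[of 0] that by (auto simp: P_def)
  ultimately show ?thesis by blast
qed

section \<open>Rich groups of characters\<close>

definition character :: "('g::ab_group_add \<Rightarrow> complex) \<Rightarrow> bool" where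
  "character \<xi> \<longleftrightarrow> (\<forall>g. norm (\<xi> g) = 1) \<and> (\<forall>g h. \<xi> (g + h) = \<xi> g * \<xi> h)"

lemma character_hom: "character \<xi> \<Longrightarrow> hom_on UNIV \<xi>"
  by (auto simp: character_def hom_on_def) (metis norm_zero zero_neq_one)

lemma subgrp_UNIV: "subgrp UNIV" by (simp add: subgrp_def)

lemma characterD:
  assumes "character \<xi>"
  shows "\<xi> 0 = 1" "\<xi> (nsmul n x) = \<xi> x ^ n" "\<xi> (x - y) = \<xi> x * cnj (\<xi> y)" "norm (\<xi> x) = 1"
    "\<xi> (x + y) = \<xi> x * \<xi> y" "\<xi> (- x) = cnj (\<xi> x)"
proof -
  note h = hom_onD[OF character_hom[OF assms] subgrp_UNIV]
  show 0: "\<xi> 0 = 1" by (rule h)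
  show "\<xi> (nsmul n x) = \<xi> x ^ n" by (rule h) simp
  show n: "norm (\<xi> x) = 1" for x using assms by (simp add: character_def)
  show d: "\<xi> (x - y) = \<xi> x * cnj (\<xi> y)" for x y
    using h(3)[of x y] n[of y] complex_div_cnj[of "\<xi> x" "\<xi> y"] by simp
  show "\<xi> (x + y) = \<xi> x * \<xi> y" using assms by (simp add: character_def)
  show "\<xi> (- x) = cnj (\<xi> x)" using d[of 0 x] 0 by simp
qed

lemma character_mult: "character \<xi> \<Longrightarrow> character \<psi> \<Longrightarrow> character (\<lambda>g. \<xi> g * \<psi> g)"
  by (simp add: character_def norm_mult)

lemma norm_cis_diff_le: "norm (cis a - cis b) \<le> \<bar>a - b\<bar>"
proof -
  have "norm (cis (a - b) - 1) \<le> \<bar>a - b\<bar>"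
    using iexp_approx1[of "a - b" 0] by (simp add: cis_conv_exp)
  moreover have "cis a - cis b = cis b * (cis (a - b) - 1)"
    by (simp add: algebra_simps cis_mult)
  ultimately show ?thesis by (simp add: norm_mult)
qed

lemma unit_complex_cis:
  assumes "norm (w :: complex) = 1"
  obtains t where "w = cis t" "0 \<le> t" "t < 2 * pi"
proof -
  have "w = cis (Arg2pi w)"
    using Arg2pi_eq[of w] assms by (simp add: cis_conv_exp)
  then show ?thesis using that Arg2pi_ge_0 Arg2pi_lt_2pi by blast
qed

text \<open>
  Given finitely many group elements \<open>F\<close> and characters \<open>\<Psi>\<close>, there is an element \<open>e\<close> that is almost
  independent of them: \<open>\<Psi>\<close> hardly sees \<open>e\<close>, but characters that hardly see \<open>F\<close> can be given
  approximately arbitrary values at \<open>e\<close>. Arbitrary means the values \<open>\<phi> h\<close> taken by the characters in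
  \<open>\<Gamma>\<close>. These need not be dense in the unit circle: in a group of finite exponent all values of
  characters are roots of unity of bounded order.
\<close>

definition rich :: "('g::ab_group_add \<Rightarrow> complex) set \<Rightarrow> bool" where
  "rich \<Gamma> \<longleftrightarrow> (\<forall>\<xi>\<in>\<Gamma>. character \<xi>) \<and> (\<forall>\<xi>\<in>\<Gamma>. \<forall>\<psi>\<in>\<Gamma>. (\<lambda>g. \<xi> g * \<psi> g) \<in> \<Gamma>) \<and>
     (\<exists>\<xi>\<in>\<Gamma>. \<exists>g. \<xi> g \<noteq> 1) \<and>
     (\<forall>F \<Psi> \<epsilon>. finite F \<longrightarrow> finite \<Psi> \<longrightarrow> \<Psi> \<subseteq> \<Gamma> \<longrightarrow> \<epsilon> > 0 \<longrightarrow>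
       (\<exists>e. (\<forall>\<xi>\<in>\<Psi>. norm (\<xi> e - 1) < \<epsilon>) \<and>
          (\<forall>\<phi>\<in>\<Gamma>. \<forall>h. \<exists>\<psi>\<in>\<Gamma>. (\<forall>f\<in>F. norm (\<psi> f - 1) < \<epsilon>) \<and> norm (\<psi> e - \<phi> h) < \<epsilon>)))"

text \<open>
  The values of the characters in \<open>\<Psi>\<close> along \<open>u\<close> are points of a finite-dimensional torus, so that a
  subsequence converges.
\<close>

lemma characters_pigeonhole:
  fixes u :: "nat \<Rightarrow> 'g::ab_group_add"
  assumes fin: "finite \<Psi>" and ch: "\<And>\<xi>. \<xi> \<in> \<Psi> \<Longrightarrow> character \<xi>" and eps: "\<epsilon> > 0"
  obtains i j where "i < j" "\<And>\<xi>. \<xi> \<in> \<Psi> \<Longrightarrow> norm (\<xi> (u j - u i) - 1) < \<epsilon>"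
proof -
  obtain k :: "nat \<Rightarrow> nat" where k: "strict_mono k"
    and cv: "\<And>\<xi>. \<xi> \<in> \<Psi> \<Longrightarrow> \<exists>l. (\<lambda>n. \<xi> (u (k n))) \<longlonglongrightarrow> l"
    using function_convergent_subsequence[of \<Psi> "\<lambda>n \<xi>. \<xi> (u n)" 1] countable_finite[OF fin] characterD(4)[OF ch]
    by (metis order_refl)
  have "eventually (\<lambda>n. norm (\<xi> (u (k (Suc n))) - \<xi> (u (k n))) < \<epsilon>) sequentially" if \<xi>: "\<xi> \<in> \<Psi>" for \<xi>
  proof -
    obtain l where l: "(\<lambda>n. \<xi> (u (k n))) \<longlonglongrightarrow> l" using cv[OF \<xi>] by blast
    have "(\<lambda>n. \<xi> (u (k (Suc n))) - \<xi> (u (k n))) \<longlonglongrightarrow> l - l"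
      using l LIMSEQ_Suc[OF l] by (intro tendsto_intros) auto
    then show ?thesis using eps by (auto simp: tendsto_iff dist_norm)
  qed
  then have "eventually (\<lambda>n. \<forall>\<xi>\<in>\<Psi>. norm (\<xi> (u (k (Suc n))) - \<xi> (u (k n))) < \<epsilon>) sequentially"
    using fin by (simp add: eventually_ball_finite)
  then obtain n where n: "\<forall>\<xi>\<in>\<Psi>. norm (\<xi> (u (k (Suc n))) - \<xi> (u (k n))) < \<epsilon>"
    by (auto simp: eventually_sequentially)
  show thesis
  proof (rule that)
    show "k n < k (Suc n)" using k by (simp add: strict_mono_def)
    fix \<xi> assume \<xi>: "\<xi> \<in> \<Psi>"
    note c = characterD[OF ch[OF \<xi>]]
    let ?a = "u (k (Suc n))" and ?b = "u (k n)"
    have "\<xi> (?a - ?b) - 1 = (\<xi> ?a - \<xi> ?b) * cnj (\<xi> ?b)"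
      using c(4)[of ?b] complex_norm_square[of "\<xi> ?b"] by (simp add: c(3) algebra_simps)
    then have "norm (\<xi> (?a - ?b) - 1) = norm (\<xi> ?a - \<xi> ?b)" by (simp add: norm_mult c)
    then show "norm (\<xi> (?a - ?b) - 1) < \<epsilon>" using n \<xi> by simp
  qed
qed

text \<open>
  If \<open>x\<close> has infinite order, the homomorphism that sends \<open>x\<close> to \<open>exp 1\<close> extends to the whole group,
  and the logarithm of its modulus is an additive real function \<open>L\<close> with \<open>L x = 1\<close>. The characters
  \<open>cis (\<theta> * L g)\<close> with small \<open>\<theta>\<close> are near \<open>1\<close> on a given finite set, and they run through the whole
  circle at an element where \<open>L\<close> is large.
\<close>

lemma rich_infinite_order:
  fixes x :: "'g::ab_group_add"
  assumes cnt: "countable (UNIV :: 'g set)" and x: "\<And>n. n > 0 \<Longrightarrow> nsmul n x \<noteq> 0"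
  shows "\<exists>\<Gamma> :: ('g \<Rightarrow> complex) set. rich \<Gamma>"
proof -
  have *: "subgrp {0::'g}" "hom_on {0::'g} (\<lambda>_. 1)" by (auto simp: subgrp_def hom_on_def)
  have c: "nsmul n x \<in> {0} \<Longrightarrow> 1 = exp (1::complex) ^ n" for n using x[of n] by (cases n) auto
  obtain H' f' where 1: "subgrp H'" "hom_on H' f'" "x \<in> H'" "f' x = exp 1"
    using hom_on_adjoin[OF * exp_not_eq_zero c] by blast
  obtain F where F: "hom_on UNIV F" "\<forall>h\<in>H'. F h = f' h" using hom_on_extend[OF cnt 1(1,2)] by blast
  define L where "L g = ln (norm (F g))" for g
  have Fx: "F x = exp 1" using F 1 by simp
  have Lx: "L x = 1" by (simp add: L_def Fx norm_exp_eq_Re)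
  have Ladd: "L (g + h) = L g + L h" for g h
    using F(1) by (auto simp: L_def hom_on_def norm_mult ln_mult)
  have L0: "L 0 = 0" using Ladd[of 0 0] by simp
  have Ln: "L (nsmul n g) = n * L g" for n g by (induction n) (simp_all add: L0 Ladd algebra_simps)
  have Ld: "L (g - h) = L g - L h" for g h using Ladd[of "g - h" h] by simp
  define \<Gamma> where "\<Gamma> = range (\<lambda>\<theta> g. cis (\<theta> * L g))"
  have ch: "character \<xi>" if "\<xi> \<in> \<Gamma>" for \<xi>
    using that by (auto simp: \<Gamma>_def character_def Ladd algebra_simps cis_mult)
  have "rich \<Gamma>"
    unfolding rich_def
  proof (intro conjI ballI allI impI)
    fix \<xi> \<psi> assume "\<xi> \<in> \<Gamma>" "\<psi> \<in> \<Gamma>"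
    then obtain a b where "\<xi> = (\<lambda>g. cis (a * L g))" "\<psi> = (\<lambda>g. cis (b * L g))" by (auto simp: \<Gamma>_def)
    then have "(\<lambda>g. \<xi> g * \<psi> g) = (\<lambda>g. cis ((a + b) * L g))" by (simp add: cis_mult algebra_simps)
    then show "(\<lambda>g. \<xi> g * \<psi> g) \<in> \<Gamma>" by (auto simp: \<Gamma>_def)
  next
    have "cis (pi * L x) \<noteq> 1" by (simp add: Lx)
    then show "\<exists>\<xi>\<in>\<Gamma>. \<exists>g. \<xi> g \<noteq> 1" by (auto simp: \<Gamma>_def)
  next
    fix F0 :: "'g set" and \<Psi> and \<epsilon> :: real
    assume F0: "finite F0" and \<Psi>: "finite \<Psi>" "\<Psi> \<subseteq> \<Gamma>" and eps: "\<epsilon> > 0"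
    \<comment> \<open>If \<open>\<theta> \<le> \<eta>\<close>, then \<open>cis (\<theta> * L f)\<close> is within \<open>\<epsilon>\<close> of \<open>1\<close> for \<open>f \<in> F0\<close>; if moreover
      \<open>L e > 2 * pi / \<eta>\<close>, such \<open>\<theta>\<close> yield all values at \<open>e\<close>.\<close>
    define B where "B = (\<Sum>f\<in>F0. \<bar>L f\<bar>)"
    have B: "\<bar>L f\<bar> \<le> B" if "f \<in> F0" for f
      unfolding B_def using F0 that by (intro member_le_sum) auto
    have B0: "B \<ge> 0" by (auto simp: B_def intro: sum_nonneg)
    define \<eta> where "\<eta> = \<epsilon> / (2 * (B + 1))"
    have "0 \<le> B * \<epsilon>" using eps B0 by simp
    then have "0 < B * \<epsilon> + \<epsilon> * 2" using eps by linarith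
    then have \<eta>: "\<eta> > 0" "\<eta> * B < \<epsilon>" using eps B0 by (auto simp: \<eta>_def field_simps)
    obtain K :: nat where K: "K > 2 * pi / \<eta>" using reals_Archimedean2 by blast
    \<comment> \<open>Differences of distinct multiples of \<open>K x\<close> have \<open>L\<close> at least \<open>K\<close>.\<close>
    obtain i j where ij: "i < j" "\<And>\<xi>. \<xi> \<in> \<Psi> \<Longrightarrow> norm (\<xi> (nsmul (j * K) x - nsmul (i * K) x) - 1) < \<epsilon>"
      using characters_pigeonhole[OF \<Psi>(1) _ eps, of "\<lambda>i. nsmul (i * K) x"] ch \<Psi>(2) by blast
    define e where "e = nsmul (j * K) x - nsmul (i * K) x"
    have "L e = (real j - real i) * K" by (simp add: e_def Ld Ln Lx algebra_simps)
    moreover have "1 * real K \<le> (real j - real i) * K" using ij(1) by (intro mult_right_mono) auto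
    ultimately have Le: "L e \<ge> K" by simp
    moreover have "2 * pi / \<eta> > 0" using \<eta> by simp
    ultimately have Le0: "L e > 2 * pi / \<eta>" "L e > 0" using K by auto
    show "\<exists>e. (\<forall>\<xi>\<in>\<Psi>. norm (\<xi> e - 1) < \<epsilon>) \<and>
          (\<forall>\<phi>\<in>\<Gamma>. \<forall>h. \<exists>\<psi>\<in>\<Gamma>. (\<forall>f\<in>F0. norm (\<psi> f - 1) < \<epsilon>) \<and> norm (\<psi> e - \<phi> h) < \<epsilon>)"
    proof (intro exI[of _ e] conjI ballI allI)
      show "norm (\<xi> e - 1) < \<epsilon>" if "\<xi> \<in> \<Psi>" for \<xi> using ij(2)[OF that] by (simp add: e_def)
      fix \<phi> h assume "\<phi> \<in> \<Gamma>"
      then have "norm (\<phi> h) = 1" using ch characterD(4) by blast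
      then obtain t where t: "\<phi> h = cis t" "0 \<le> t" "t < 2 * pi" by (rule unit_complex_cis)
      define \<theta> where "\<theta> = t / L e"
      have "t / L e \<le> 2 * pi / L e" using t Le0 by (intro divide_right_mono) auto
      also have "\<dots> < \<eta>" using Le0 \<eta> by (simp add: field_simps)
      finally have \<theta>: "0 \<le> \<theta>" "\<theta> \<le> \<eta>" using t Le0 by (auto simp: \<theta>_def)
      show "\<exists>\<psi>\<in>\<Gamma>. (\<forall>f\<in>F0. norm (\<psi> f - 1) < \<epsilon>) \<and> norm (\<psi> e - \<phi> h) < \<epsilon>"
      proof (intro bexI[of _ "\<lambda>g. cis (\<theta> * L g)"] conjI ballI)
        fix f assume f: "f \<in> F0"
        have "norm (cis (\<theta> * L f) - cis 0) \<le> \<bar>\<theta> * L f - 0\<bar>" by (rule norm_cis_diff_le)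
        also have "\<dots> = \<theta> * \<bar>L f\<bar>" using \<theta> by (simp add: abs_mult)
        also have "\<dots> \<le> \<eta> * B" using \<theta> B[OF f] by (intro mult_mono) auto
        finally show "norm (cis (\<theta> * L f) - 1) < \<epsilon>" using \<eta> by simp
      next
        show "norm (cis (\<theta> * L e) - \<phi> h) < \<epsilon>" using Le0 t eps by (simp add: \<theta>_def)
      qed (auto simp: \<Gamma>_def)
    qed
  qed (use ch in auto)
  then show ?thesis by blast
qed

text \<open>
  Adjoining an element of order \<open>n\<close> to a finite subgroup multiplies its size by at most \<open>n\<close>.
\<close>

lemma finite_subgrp_exists:
  fixes A :: "'g::ab_group_add set"
  assumes tor: "\<And>x :: 'g. \<exists>n>0. nsmul n x = 0" and "finite A"
  shows "\<exists>H. subgrp H \<and> finite H \<and> A \<subseteq> H"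
  using assms(2)
proof induction
  case empty
  then show ?case by (intro exI[of _ "{0}"]) (auto simp: subgrp_def)
next
  case (insert x A)
  then obtain H where H: "subgrp H" "finite H" "A \<subseteq> H" by auto
  note HD = subgrpD[OF H(1)]
  obtain n where n: "n > 0" "nsmul n x = 0" using tor by blast
  have r: "nsmul k x = nsmul (k mod n) x" for k
  proof -
    have "k = (k div n) * n + k mod n" by simp
    then have "nsmul k x = nsmul (k div n) (nsmul n x) + nsmul (k mod n) x" by (metis nsmul_add nsmul_mult)
    then show ?thesis by (simp add: n)
  qed
  have neg: "- nsmul k x = nsmul (k * (n - 1)) x" for k
  proof -
    have "nsmul k x + nsmul (k * (n - 1)) x = nsmul (k * n) x"
      using n by (simp add: nsmul_add[symmetric]) (metis Suc_pred mult_Suc_right)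
    also have "\<dots> = 0" by (simp add: nsmul_mult n)
    finally show ?thesis by (metis neg_eq_iff_add_eq_0)
  qed
  define H' where "H' = (\<lambda>(h, k). h + nsmul k x) ` (H \<times> UNIV)"
  have "H' = (\<lambda>(h, k). h + nsmul k x) ` (H \<times> {..<n})"
  proof
    show "H' \<subseteq> (\<lambda>(h, k). h + nsmul k x) ` (H \<times> {..<n})"
    proof
      fix y assume "y \<in> H'"
      then obtain h k where "h \<in> H" "y = h + nsmul k x" by (auto simp: H'_def)
      then show "y \<in> (\<lambda>(h, k). h + nsmul k x) ` (H \<times> {..<n})"
        using r[of k] n by (intro image_eqI[of _ _ "(h, k mod n)"]) auto
    qed
  qed (auto simp: H'_def)
  then have "finite H'" using H by simp
  moreover have "subgrp H'" unfolding subgrp_def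
  proof (intro conjI ballI)
    show "0 \<in> H'" unfolding H'_def by (rule image_eqI[of _ _ "(0, 0)"]) (auto simp: HD)
    fix a b assume "a \<in> H'" "b \<in> H'"
    then obtain h k h' k' where "h \<in> H" "h' \<in> H" "a = h + nsmul k x" "b = h' + nsmul k' x"
      by (auto simp: H'_def)
    then show "a - b \<in> H'" unfolding H'_def using neg[of k']
      by (intro image_eqI[of _ _ "(h - h', k + k' * (n - 1))"]) (auto simp: HD nsmul_add diff_conv_add_uminus[of _ "nsmul k' x"] simp del: add_uminus_conv_diff)
  qed
  moreover have "insert x A \<subseteq> H'"
  proof -
    have "x \<in> H'" unfolding H'_def by (rule image_eqI[of _ _ "(0, 1)"]) (auto simp: HD)
    moreover have "y \<in> H'" if "y \<in> A" for y
      unfolding H'_def by (rule image_eqI[of _ _ "(y, 0)"]) (use that H in auto)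
    ultimately show ?thesis by blast
  qed
  ultimately show ?case by blast
qed

text \<open>
  Let the finite subgroup \<open>H\<close> contain \<open>K f\<close> for \<open>f \<in> F\<close> and all \<open>p K g\<close>. Since the cosets
  \<open>M K g + H\<close> are infinite in number, the pigeonhole principle provides an \<open>e\<close> at which the
  characters of \<open>\<Psi>\<close> are near \<open>1\<close> although \<open>M K e \<notin> H\<close>. The order \<open>d\<close> of \<open>K e\<close> modulo \<open>H\<close> then
  divides \<open>p\<close> but not \<open>M\<close>. A homomorphism that is trivial on \<open>H\<close> may take any \<open>d\<close>-th root of unity
  as its value at \<open>K e\<close>, and it is a character because the group is torsion.
\<close>

lemma torsion_step:
  fixes F :: "'g::ab_group_add set"
  assumes cnt: "countable (UNIV :: 'g set)"
    and tor: "\<And>x :: 'g. \<exists>n>0. nsmul n x = 0"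
    and q: "finite (range (nsmul (p * K) :: 'g \<Rightarrow> 'g))"
    and MK: "infinite (range (nsmul (M * K) :: 'g \<Rightarrow> 'g))"
    and F: "finite F" and \<Psi>: "finite \<Psi>" "\<And>\<xi>. \<xi> \<in> \<Psi> \<Longrightarrow> character \<xi>" and eps: "\<epsilon> > 0"
  shows "\<exists>e d. d > 0 \<and> \<not> d dvd M \<and> d dvd p \<and> (\<forall>\<xi>\<in>\<Psi>. norm (\<xi> e - 1) < \<epsilon>) \<and>
    (\<forall>\<omega>. \<omega> ^ d = 1 \<longrightarrow> (\<exists>\<psi>. character \<psi> \<and> (\<forall>g. \<psi> g ^ (p * K) = 1) \<and> (\<forall>f\<in>F. \<psi> f ^ K = 1) \<and> \<psi> e ^ K = \<omega>))"
proof -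
  obtain H where H: "subgrp H" "finite H" "nsmul K ` F \<union> range (nsmul (p * K)) \<subseteq> H"
    using finite_subgrp_exists[OF tor, of "nsmul K ` F \<union> range (nsmul (p * K))"] F q by auto
  note HD = subgrpD[OF H(1)]
  define c where "c g = (\<lambda>h. nsmul (M * K) g + h) ` H" for g
  have "range (nsmul (M * K)) \<subseteq> \<Union> (range c)"
  proof
    fix y :: 'g assume "y \<in> range (nsmul (M * K))"
    then obtain g where g: "y = nsmul (M * K) g" by blast
    then have "y \<in> c g" unfolding c_def by (intro image_eqI[of _ _ 0]) (auto simp: HD)
    then show "y \<in> \<Union> (range c)" by blast
  qed
  then have "infinite (\<Union> (range c))" using MK finite_subset by blast
  then have "infinite (range c)" using H(2) by (auto simp: c_def)
  then obtain s :: "nat \<Rightarrow> 'g set" where s: "inj s" "range s \<subseteq> range c"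
    using infinite_countable_subset by blast
  then have "\<forall>i. \<exists>g. c g = s i" by (metis image_iff range_subsetD)
  then obtain u where u: "\<And>i. c (u i) = s i" by metis
  obtain i j where ij: "i < j" "\<And>\<xi>. \<xi> \<in> \<Psi> \<Longrightarrow> norm (\<xi> (u j - u i) - 1) < \<epsilon>"
    using characters_pigeonhole[OF \<Psi> eps] by blast
  define e where "e = u j - u i"
  have eH: "nsmul (M * K) e \<notin> H"
  proof
    assume a: "nsmul (M * K) e \<in> H"
    define a where "a = nsmul (M * K) e"
    have aH: "a \<in> H" using \<open>nsmul (M * K) e \<in> H\<close> by (simp add: a_def)
    have eq: "nsmul (M * K) (u j) = a + nsmul (M * K) (u i)" by (simp add: a_def e_def nsmul_diff)
    have "c (u j) = c (u i)"
    proof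
      show "c (u j) \<subseteq> c (u i)"
      proof
        fix y assume "y \<in> c (u j)"
        then obtain h where "h \<in> H" "y = nsmul (M * K) (u j) + h" by (auto simp: c_def)
        then show "y \<in> c (u i)" unfolding c_def using aH HD by (intro image_eqI[of _ _ "a + h"]) (auto simp: eq add.assoc add.commute add.left_commute)
      qed
      show "c (u i) \<subseteq> c (u j)"
      proof
        fix y assume "y \<in> c (u i)"
        then obtain h where "h \<in> H" "y = nsmul (M * K) (u i) + h" by (auto simp: c_def)
        then show "y \<in> c (u j)" unfolding c_def using aH HD by (intro image_eqI[of _ _ "h - a"]) (auto simp: eq add.assoc add.commute add.left_commute)
      qed
    qed
    then have "s j = s i" by (simp add: u)
    then have "j = i" using s(1) by (simp add: inj_eq)
    then show False using ij(1) by simp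
  qed
  define y where "y = nsmul K e"
  have yM: "nsmul M y \<notin> H" using eH by (simp add: y_def nsmul_mult)
  have ex: "\<exists>n>0. nsmul n y \<in> H" using tor[of y] HD by metis
  define d where "d = (LEAST n. n > 0 \<and> nsmul n y \<in> H)"
  have d: "d > 0" "nsmul d y \<in> H" using LeastI_ex[OF ex] by (auto simp: d_def)
  have dmin: "\<not> (n > 0 \<and> nsmul n y \<in> H)" if "n < d" for n
    using not_less_Least[OF that[unfolded d_def]] by simp
  have ddvd: "d dvd n" if "nsmul n y \<in> H" for n
  proof -
    have "n = (n div d) * d + n mod d" by simp
    then have "nsmul n y = nsmul (n div d) (nsmul d y) + nsmul (n mod d) y" by (metis nsmul_add nsmul_mult)
    then have "nsmul (n mod d) y = nsmul n y - nsmul (n div d) (nsmul d y)" by simp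
    then have "nsmul (n mod d) y \<in> H" using that d HD by simp
    then have "n mod d = 0" using dmin[of "n mod d"] d by auto
    then show ?thesis by auto
  qed
  show ?thesis
  proof (intro exI[of _ e] exI[of _ d] conjI allI impI ballI)
    show "d > 0" by fact
    show "\<not> d dvd M"
    proof
      assume "d dvd M"
      then obtain k where "M = k * d" by (metis dvd_def mult.commute)
      then have "nsmul M y = nsmul k (nsmul d y)" by (simp add: nsmul_mult)
      then show False using yM d HD by simp
    qed
    show "d dvd p"
    proof (rule ddvd)
      have "nsmul p y = nsmul (p * K) e" by (simp add: y_def nsmul_mult)
      then show "nsmul p y \<in> H" using H(3) by auto
    qed
    show "norm (\<xi> e - 1) < \<epsilon>" if "\<xi> \<in> \<Psi>" for \<xi> using ij(2)[OF that] by (simp add: e_def)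
    fix \<omega> :: complex assume \<omega>: "\<omega> ^ d = 1"
    have h1: "hom_on H (\<lambda>_. 1)" by (simp add: hom_on_def)
    have w0: "\<omega> \<noteq> 0" using \<omega> d by (auto simp: zero_power)
    have "1 = \<omega> ^ n" if n: "nsmul n y \<in> H" for n
    proof -
      obtain k where "n = d * k" using ddvd n by (auto simp: dvd_def)
      then show ?thesis by (simp add: power_mult \<omega>)
    qed
    from hom_on_adjoin[OF H(1) h1 w0 this]
    obtain H' f' where 1: "subgrp H'" "hom_on H' f'" "H \<subseteq> H'" "y \<in> H'" "\<forall>h\<in>H. f' h = 1" "f' y = \<omega>" by blast
    obtain \<psi> where \<psi>: "hom_on UNIV \<psi>" "\<forall>h\<in>H'. \<psi> h = f' h" using hom_on_extend[OF cnt 1(1,2)] by blast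
    note \<psi>D = hom_onD[OF \<psi>(1) subgrp_UNIV]
    have \<psi>n: "\<psi> g ^ n = \<psi> (nsmul n g)" for g n using \<psi>D(2)[of g n] by simp
    have \<psi>H: "\<psi> h = 1" if "h \<in> H" for h using \<psi>(2) 1 that by auto
    show "\<exists>\<psi>. character \<psi> \<and> (\<forall>g. \<psi> g ^ (p * K) = 1) \<and> (\<forall>f\<in>F. \<psi> f ^ K = 1) \<and> \<psi> e ^ K = \<omega>"
    proof (intro exI[of _ \<psi>] conjI allI ballI)
      show "character \<psi>" unfolding character_def
      proof (intro conjI allI)
        fix g :: 'g
        obtain n where n: "n > 0" "nsmul n g = 0" using tor by blast
        then have "\<psi> g ^ n = 1" using \<psi>n \<psi>D(1) by simp
        then show "norm (\<psi> g) = 1" using n(1) power_eq_1_iff[of "\<psi> g" n] by simp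
      qed (use \<psi> in \<open>simp add: hom_on_def\<close>)
      show "\<psi> g ^ (p * K) = 1" for g using H(3) by (auto simp: \<psi>n intro!: \<psi>H)
      show "\<psi> f ^ K = 1" if "f \<in> F" for f using H(3) that by (auto simp: \<psi>n intro!: \<psi>H)
      show "\<psi> e ^ K = \<omega>" using \<psi>(2) 1 by (simp add: \<psi>n y_def[symmetric])
    qed
  qed
qed

text \<open>
  The rich group consists of the \<open>K\<close>-th powers of the characters whose \<open>p K\<close>-th power is trivial.
  Its values \<open>w\<close> have \<open>w ^ p = 1\<close>, and at the element \<open>e\<close> of \<open>torsion_step\<close> all \<open>d\<close>-th roots of
  unity are available; the assumption \<open>MK\<close> says that they are close to all of these \<open>w\<close> if \<open>M\<close> is
  well chosen. With \<open>p = 0\<close> and \<open>K = 1\<close> the group is the full group of characters.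
\<close>

lemma rich_torsion:
  assumes cnt: "countable (UNIV :: 'g::ab_group_add set)"
    and tor: "\<And>x :: 'g. \<exists>n>0. nsmul n x = 0"
    and q: "finite (range (nsmul (p * K) :: 'g \<Rightarrow> 'g))"
    and MK: "\<And>\<epsilon>. \<epsilon> > 0 \<Longrightarrow> \<exists>M. infinite (range (nsmul (M * K) :: 'g \<Rightarrow> 'g)) \<and>
      (\<forall>d w. d > 0 \<longrightarrow> \<not> d dvd M \<longrightarrow> d dvd p \<longrightarrow> norm w = 1 \<longrightarrow> w ^ p = 1 \<longrightarrow>
        (\<exists>\<omega>::complex. \<omega> ^ d = 1 \<and> norm (\<omega> - w) < \<epsilon>))"
  shows "\<exists>\<Gamma> :: ('g \<Rightarrow> complex) set. rich \<Gamma>"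
proof -
  define \<Gamma> :: "('g \<Rightarrow> complex) set" where "\<Gamma> = (\<lambda>\<psi> g. \<psi> g ^ K) ` {\<psi>. character \<psi> \<and> (\<forall>g. \<psi> g ^ (p * K) = 1)}"
  have ch: "character \<xi>" if "\<xi> \<in> \<Gamma>" for \<xi>
    using that by (auto simp: \<Gamma>_def character_def norm_power power_mult_distrib)
  have step: "\<exists>e. (\<forall>\<xi>\<in>\<Psi>. norm (\<xi> e - 1) < \<epsilon>) \<and>
          (\<forall>\<phi>\<in>\<Gamma>. \<forall>h. \<exists>\<psi>\<in>\<Gamma>. (\<forall>f\<in>F. norm (\<psi> f - 1) < \<epsilon>) \<and> norm (\<psi> e - \<phi> h) < \<epsilon>) \<and> (\<exists>\<psi>\<in>\<Gamma>. \<psi> e \<noteq> 1)"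
    if F: "finite F" and \<Psi>: "finite \<Psi>" "\<Psi> \<subseteq> \<Gamma>" and eps: "\<epsilon> > 0" for F \<Psi> \<epsilon>
  proof -
    obtain M where M: "infinite (range (nsmul (M * K) :: 'g \<Rightarrow> 'g))"
      and ap: "\<And>d w. d > 0 \<Longrightarrow> \<not> d dvd M \<Longrightarrow> d dvd p \<Longrightarrow> norm w = 1 \<Longrightarrow> w ^ p = 1 \<Longrightarrow>
        \<exists>\<omega>::complex. \<omega> ^ d = 1 \<and> norm (\<omega> - w) < \<epsilon>"
      using MK[OF eps] by metis
    have chP: "\<xi> \<in> \<Psi> \<Longrightarrow> character \<xi>" for \<xi> using ch \<Psi>(2) by blast
    obtain e d where d: "d > 0" "\<not> d dvd M" "d dvd p"
      and e: "\<forall>\<xi>\<in>\<Psi>. norm (\<xi> e - 1) < \<epsilon>"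
      and r: "\<And>\<omega>. \<omega> ^ d = 1 \<Longrightarrow> \<exists>\<psi>. character \<psi> \<and> (\<forall>g. \<psi> g ^ (p * K) = 1) \<and> (\<forall>f\<in>F. \<psi> f ^ K = 1) \<and> \<psi> e ^ K = \<omega>"
      using torsion_step[OF cnt tor q M F \<Psi>(1) chP eps] by auto
    have r': "\<exists>\<psi>\<in>\<Gamma>. (\<forall>f\<in>F. \<psi> f = 1) \<and> \<psi> e = \<omega>" if "\<omega> ^ d = 1" for \<omega>
      using r[OF that] by (auto simp: \<Gamma>_def)
    show ?thesis
    proof (intro exI[of _ e] conjI allI ballI)
      show "norm (\<xi> e - 1) < \<epsilon>" if "\<xi> \<in> \<Psi>" for \<xi> using e that by blast
    next
      fix \<phi> h assume \<phi>: "\<phi> \<in> \<Gamma>"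
      have "\<phi> h ^ p = 1"
        using \<phi> by (auto simp: \<Gamma>_def power_mult[symmetric] mult.commute)
      then obtain \<omega> where \<omega>: "\<omega> ^ d = 1" "norm (\<omega> - \<phi> h) < \<epsilon>"
        using ap[OF d, of "\<phi> h"] characterD(4)[OF ch[OF \<phi>]] by auto
      show "\<exists>\<psi>\<in>\<Gamma>. (\<forall>f\<in>F. norm (\<psi> f - 1) < \<epsilon>) \<and> norm (\<psi> e - \<phi> h) < \<epsilon>"
        using r'[OF \<omega>(1)] \<omega>(2) eps by force
    next
      \<comment> \<open>A primitive \<open>d\<close>-th root of unity is a nontrivial value.\<close>
      have "d \<noteq> 1" using d(2) by auto
      then have "d > 1" using d by simp
      have "cis (2 * pi / d) ^ d = 1" using d(1) unfolding Complex.DeMoivre by simp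
      moreover have "cis (2 * pi / d) \<noteq> 1"
      proof
        assume "cis (2 * pi / d) = 1"
        then have "cos (2 * pi / d) = 1" by (simp add: complex_eq_iff)
        then obtain n :: int where "2 * pi / d = of_int n * 2 * pi" by (metis cos_one_2pi_int)
        then have "pi * (1 / d) = pi * real_of_int n" by argo
        then have n: "1 / d = real_of_int n" by (subst (asm) mult_cancel_left) simp
        have "0 < 1 / real d" "1 / real d < 1" using \<open>d > 1\<close> by auto
        then show False unfolding n by simp
      qed
      ultimately show "\<exists>\<psi>\<in>\<Gamma>. \<psi> e \<noteq> 1" using r' by metis
    qed
  qed
  have "rich \<Gamma>"
    unfolding rich_def
  proof (intro conjI ballI allI impI)
    fix \<xi> \<psi> assume "\<xi> \<in> \<Gamma>" "\<psi> \<in> \<Gamma>"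
    then obtain a b where "\<xi> = (\<lambda>g. a g ^ K)" "\<psi> = (\<lambda>g. b g ^ K)" "character a" "character b"
      "\<forall>g. a g ^ (p * K) = 1" "\<forall>g. b g ^ (p * K) = 1" by (auto simp: \<Gamma>_def)
    then show "(\<lambda>g. \<xi> g * \<psi> g) \<in> \<Gamma>" unfolding \<Gamma>_def
      by (intro image_eqI[of _ _ "\<lambda>g. a g * b g"]) (auto simp: power_mult_distrib character_mult)
  next
    show "\<exists>\<xi>\<in>\<Gamma>. \<exists>g. \<xi> g \<noteq> 1" using step[of "{}" "{}" 1] by auto
  next
    fix F :: "'g set" and \<Psi> and \<epsilon> :: real
    assume "finite F" "finite \<Psi>" "\<Psi> \<subseteq> \<Gamma>" "\<epsilon> > 0"
    from step[OF this] show "\<exists>e. (\<forall>\<xi>\<in>\<Psi>. norm (\<xi> e - 1) < \<epsilon>) \<and>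
          (\<forall>\<phi>\<in>\<Gamma>. \<forall>h. \<exists>\<psi>\<in>\<Gamma>. (\<forall>f\<in>F. norm (\<psi> f - 1) < \<epsilon>) \<and> norm (\<psi> e - \<phi> h) < \<epsilon>)" by blast
  qed (use ch in auto)
  then show ?thesis by blast
qed

lemma root_of_unity_near:
  assumes "norm (w::complex) = 1" "d > 0" "2 * pi / real d < \<epsilon>"
  shows "\<exists>\<omega>. \<omega> ^ d = 1 \<and> norm (\<omega> - w) < \<epsilon>"
proof -
  obtain t where t: "w = cis t" "0 \<le> t" "t < 2 * pi" using assms(1) by (rule unit_complex_cis)
  define k where "k = nat \<lfloor>t * d / (2 * pi)\<rfloor>"
  have "0 \<le> t * d / (2 * pi)" using t by simp
  then have k: "real k \<le> t * d / (2 * pi)" "t * d / (2 * pi) < k + 1"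
    unfolding k_def by linarith+
  define a where "a = 2 * pi * k / d"
  have "a \<le> t" using k assms(2) by (simp add: a_def field_simps)
  moreover have "t < a + 2 * pi / d" using k assms(2) by (simp add: a_def field_simps)
  ultimately have "\<bar>a - t\<bar> < \<epsilon>" using assms(3) by linarith
  then have "norm (cis a - w) < \<epsilon>" using norm_cis_diff_le[of a t] t by simp
  moreover have "cis a ^ d = 1"
  proof -
    have "real d * a = real k * (2 * pi)" using assms(2) by (simp add: a_def)
    then have "cis a ^ d = cis (real k * (2 * pi))" unfolding Complex.DeMoivre by (rule arg_cong)
    also have "\<dots> = cis (2 * pi) ^ k" by (simp only: Complex.DeMoivre)
    also have "\<dots> = 1" by simp
    finally show ?thesis .
  qed
  ultimately show ?thesis by blast
qed

theorem rich_exists: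
  assumes cnt: "countable (UNIV :: 'g::ab_group_add set)" and inf: "infinite (UNIV :: 'g set)"
  shows "\<exists>\<Gamma> :: ('g \<Rightarrow> complex) set. rich \<Gamma>"
proof (cases "\<forall>x :: 'g. \<exists>n>0. nsmul n x = 0")
  case False
  then obtain x :: 'g where "\<And>n. n > 0 \<Longrightarrow> nsmul n x \<noteq> 0" by blast
  then show ?thesis by (rule rich_infinite_order[OF cnt])
next
  case tor: True
  show ?thesis
  proof (cases "\<exists>N>0. finite (range (nsmul N :: 'g \<Rightarrow> 'g))")
    case True
    \<comment> \<open>For a prime factor \<open>p\<close> of the least \<open>N\<close> with \<open>N G\<close> with \<open>N G\<close> finite, all values are roots
      of unity. A divisor of \<open>p\<close> that does not divide \<open>M = 1\<close> is \<open>p\<close>.\<close>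
    define N where "N = (LEAST N. N > 0 \<and> finite (range (nsmul N :: 'g \<Rightarrow> 'g)))"
    have N: "N > 0" "finite (range (nsmul N :: 'g \<Rightarrow> 'g))" using LeastI_ex[OF True] by (auto simp: N_def)
    have Nmin: "\<not> (n > 0 \<and> finite (range (nsmul n :: 'g \<Rightarrow> 'g)))" if "n < N" for n
      using not_less_Least[OF that[unfolded N_def]] by simp
    have "range (nsmul 1 :: 'g \<Rightarrow> 'g) = UNIV" by auto
    then have "N \<noteq> 1" using N(2) inf by metis
    then obtain p where p: "prime p" "p dvd N" using prime_factor_nat by blast
    then obtain K where K: "N = p * K" by (auto simp: dvd_def)
    have "K > 0" "K < N" using N(1) K prime_gt_1_nat[OF p(1)] by (auto intro: gr0I)
    then have Kinf: "infinite (range (nsmul K :: 'g \<Rightarrow> 'g))" using Nmin by blast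
    show ?thesis
    proof (rule rich_torsion[OF cnt _ N(2)[unfolded K]])
      show "\<exists>n>0. nsmul n x = 0" for x :: 'g using tor by blast
      fix \<epsilon> :: real assume "\<epsilon> > 0"
      show "\<exists>M. infinite (range (nsmul (M * K) :: 'g \<Rightarrow> 'g)) \<and>
        (\<forall>d w. d > 0 \<longrightarrow> \<not> d dvd M \<longrightarrow> d dvd p \<longrightarrow> norm w = 1 \<longrightarrow> w ^ p = 1 \<longrightarrow>
        (\<exists>\<omega>::complex. \<omega> ^ d = 1 \<and> norm (\<omega> - w) < \<epsilon>))"
      proof (intro exI[of _ "1::nat"] conjI allI impI)
        fix d :: nat and w :: complex
        assume "d > 0" "\<not> d dvd 1" "d dvd p" "norm w = 1" and w: "w ^ p = 1"
        then have "d dvd p" "d \<noteq> 1" by auto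
        then have "d = p" using p(1) prime_nat_iff by blast
        then show "\<exists>\<omega>. \<omega> ^ d = 1 \<and> norm (\<omega> - w) < \<epsilon>" using w \<open>\<epsilon> > 0\<close> by (intro exI[of _ w]) auto
      qed (use Kinf in simp)
    qed
  next
    case False
    show ?thesis
    proof (rule rich_torsion[OF cnt, of 0 1])
      show "\<exists>n>0. nsmul n x = 0" for x :: 'g using tor by blast
      fix \<epsilon> :: real assume eps: "\<epsilon> > 0"
      \<comment> \<open>A number \<open>d\<close> that does not divide \<open>M = R!\<close> is larger than \<open>R\<close>, so the \<open>d\<close>-th roots of
        unity are \<open>\<epsilon>\<close>-dense in the circle.\<close>
      obtain R :: nat where R: "R > 2 * pi / \<epsilon>" using reals_Archimedean2 by blast
      show "\<exists>M. infinite (range (nsmul (M * 1) :: 'g \<Rightarrow> 'g)) \<and>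
        (\<forall>d w. d > 0 \<longrightarrow> \<not> d dvd M \<longrightarrow> d dvd 0 \<longrightarrow> norm w = 1 \<longrightarrow> w ^ 0 = 1 \<longrightarrow>
        (\<exists>\<omega>::complex. \<omega> ^ d = 1 \<and> norm (\<omega> - w) < \<epsilon>))"
      proof (intro exI[of _ "fact R :: nat"] conjI allI impI)
        show "infinite (range (nsmul (fact R * 1) :: 'g \<Rightarrow> 'g))" using False by (metis fact_gt_zero mult_1_right)
        fix d :: nat and w :: complex
        assume d: "d > 0" "\<not> d dvd fact R" and w: "norm w = 1"
        then have "d > R" using dvd_fact[of d R] by (cases "d \<le> R") auto
        then have "real d > 2 * pi / \<epsilon>" using R by linarith
        then have "2 * pi / real d < \<epsilon>" using eps d by (simp add: field_simps)
        then show "\<exists>\<omega>. \<omega> ^ d = 1 \<and> norm (\<omega> - w) < \<epsilon>" using root_of_unity_near w d by blast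
      qed
    qed auto
  qed
qed

section \<open>Concentration of measure in boxes\<close>

definition box_avg :: "nat \<Rightarrow> nat set \<Rightarrow> ((nat \<Rightarrow> nat) \<Rightarrow> real) \<Rightarrow> real" where
  "box_avg L I f = (\<Sum>x\<in>I \<rightarrow>\<^sub>E {..<L}. f x) / real L ^ card I"

lemma box_avg_insert:
  assumes "finite I" "i \<notin> I"
  shows "box_avg L (insert i I) f = box_avg L I (\<lambda>x. (\<Sum>a<L. f (x(i := a))) / L)"
proof -
  have "(\<Sum>x\<in>insert i I \<rightarrow>\<^sub>E {..<L}. f x) = (\<Sum>(a, x)\<in>{..<L} \<times> (I \<rightarrow>\<^sub>E {..<L}). f (x(i := a)))"
    unfolding PiE_insert_eq
    by (subst sum.reindex) (use inj_combinator[OF assms(2), of "\<lambda>_. {..<L}"] in \<open>auto simp: case_prod_unfold\<close>)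
  also have "\<dots> = (\<Sum>x\<in>I \<rightarrow>\<^sub>E {..<L}. \<Sum>a<L. f (x(i := a)))"
    by (simp add: sum.cartesian_product[symmetric] sum.swap[of _ "{..<L}"])
  finally show ?thesis
    using assms by (simp add: box_avg_def sum_divide_distrib[symmetric] field_simps)
qed

lemma box_avg_mono: "(\<And>x. x \<in> I \<rightarrow>\<^sub>E {..<L} \<Longrightarrow> f x \<le> g x) \<Longrightarrow> box_avg L I f \<le> box_avg L I g"
  unfolding box_avg_def by (intro divide_right_mono sum_mono) auto

lemma box_avg_const: "finite I \<Longrightarrow> L > 0 \<Longrightarrow> box_avg L I (\<lambda>_. c) = c"
  by (simp add: box_avg_def card_PiE)

lemma box_avg_add: "box_avg L I (\<lambda>x. f x + g x) = box_avg L I f + box_avg L I g"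
  by (simp add: box_avg_def sum.distrib add_divide_distrib)

lemma box_avg_cmult: "box_avg L I (\<lambda>x. c * f x) = c * box_avg L I f"
  by (simp add: box_avg_def sum_distrib_left)

text \<open>
  The Efron-Stein inequality for the uniform distribution on a box. Averaging over one coordinate
  decreases the variance by at most \<open>1\<close>, and the averaged function still changes by at most \<open>1\<close> in
  each of the other coordinates.
\<close>

lemma box_variance_le:
  assumes "finite I" "L > 0"
    and "\<And>x i a. x \<in> I \<rightarrow>\<^sub>E {..<L} \<Longrightarrow> i \<in> I \<Longrightarrow> a < L \<Longrightarrow> \<bar>f (x(i := a)) - f x\<bar> \<le> 1"
  shows "box_avg L I (\<lambda>x. (f x)\<^sup>2) \<le> (box_avg L I f)\<^sup>2 + card I"
  using assms(1,3)
proof (induction I arbitrary: f)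
  case empty
  then show ?case by (simp add: box_avg_def)
next
  case (insert i I)
  define g where "g x = (\<Sum>a<L. f (x(i := a))) / L" for x
  have upd: "x(i := a) \<in> insert i I \<rightarrow>\<^sub>E {..<L}" if "x \<in> I \<rightarrow>\<^sub>E {..<L}" "a < L" for x a
    using that by (auto simp: PiE_iff extensional_def)
  have fg: "\<bar>f (x(i := a)) - g x\<bar> \<le> 1" if x: "x \<in> I \<rightarrow>\<^sub>E {..<L}" and a: "a < L" for x a
  proof -
    have e: "f (x(i := a)) - g x = (\<Sum>b<L. f (x(i := a)) - f (x(i := b))) / L"
      using assms(2) by (simp add: g_def sum_subtractf diff_divide_distrib)
    have "\<bar>f (x(i := a)) - g x\<bar> \<le> (\<Sum>b<L. \<bar>f (x(i := a)) - f (x(i := b))\<bar>) / L"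
      unfolding e by (simp add: divide_right_mono)
    also have "\<dots> \<le> (\<Sum>b<L. 1) / L"
    proof (intro divide_right_mono sum_mono)
      fix b assume "b \<in> {..<L}"
      then have "\<bar>f ((x(i := b))(i := a)) - f (x(i := b))\<bar> \<le> 1"
        by (intro insert.prems upd x) (use a in auto)
      then show "\<bar>f (x(i := a)) - f (x(i := b))\<bar> \<le> 1" by (simp only: fun_upd_upd)
    qed simp
    finally show ?thesis using assms(2) by simp
  qed
  have "box_avg L (insert i I) (\<lambda>x. (f x)\<^sup>2) \<le> box_avg L I (\<lambda>x. (g x)\<^sup>2 + 1)"
    unfolding box_avg_insert[OF insert.hyps]
  proof (rule box_avg_mono)
    fix x assume x: "x \<in> I \<rightarrow>\<^sub>E {..<L}"
    have s: "(\<Sum>a<L. f (x(i := a))) = L * g x" using assms(2) by (simp add: g_def)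
    have "(\<Sum>a<L. (f (x(i := a)) - g x)\<^sup>2) = (\<Sum>a<L. (f (x(i := a)))\<^sup>2) - 2 * g x * (\<Sum>a<L. f (x(i := a))) + L * (g x)\<^sup>2"
      by (simp add: power2_diff sum.distrib sum_subtractf sum_distrib_left mult_ac)
    then have "(\<Sum>a<L. (f (x(i := a)))\<^sup>2) = L * (g x)\<^sup>2 + (\<Sum>a<L. (f (x(i := a)) - g x)\<^sup>2)"
      unfolding s by (simp add: power2_eq_square algebra_simps)
    also have "\<dots> \<le> L * (g x)\<^sup>2 + (\<Sum>a<L. 1)"
      using fg[OF x] by (intro add_left_mono sum_mono) (auto simp: abs_square_le_1)
    finally show "(\<Sum>a<L. (f (x(i := a)))\<^sup>2) / L \<le> (g x)\<^sup>2 + 1"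
      using assms(2) by (simp add: field_simps)
  qed
  also have "\<dots> = box_avg L I (\<lambda>x. (g x)\<^sup>2) + 1"
    using insert.hyps assms(2) by (simp add: box_avg_add box_avg_const)
  also have "box_avg L I (\<lambda>x. (g x)\<^sup>2) \<le> (box_avg L I g)\<^sup>2 + card I"
  proof (rule insert.IH)
    fix x j a assume x: "x \<in> I \<rightarrow>\<^sub>E {..<L}" and j: "j \<in> I" and a: "a < L"
    have ji: "j \<noteq> i" using j insert.hyps by auto
    have e: "g (x(j := a)) - g x = (\<Sum>b<L. f ((x(i := b))(j := a)) - f (x(i := b))) / L"
      by (simp add: g_def sum_subtractf diff_divide_distrib fun_upd_twist[OF ji])
    have "\<bar>g (x(j := a)) - g x\<bar> \<le> (\<Sum>b<L. \<bar>f ((x(i := b))(j := a)) - f (x(i := b))\<bar>) / L"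
      unfolding e by (simp add: divide_right_mono)
    also have "\<dots> \<le> (\<Sum>b<L. 1) / L"
    proof (intro divide_right_mono sum_mono)
      fix b assume "b \<in> {..<L}"
      then show "\<bar>f ((x(i := b))(j := a)) - f (x(i := b))\<bar> \<le> 1"
        by (intro insert.prems upd x) (use j a in auto)
    qed simp
    finally show "\<bar>g (x(j := a)) - g x\<bar> \<le> 1" using assms(2) by simp
  qed
  also have "box_avg L I g = box_avg L (insert i I) f"
    unfolding box_avg_insert[OF insert.hyps] g_def ..
  finally show ?case using insert.hyps by simp
qed

lemma box_sum_subset_le:
  assumes "finite I" "L > 0" "A \<subseteq> I \<rightarrow>\<^sub>E {..<L}" "\<And>x. f x \<ge> (0::real)"
  shows "(\<Sum>x\<in>A. f x) \<le> box_avg L I f * real L ^ card I"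
proof -
  have "(\<Sum>x\<in>A. f x) \<le> (\<Sum>x\<in>I \<rightarrow>\<^sub>E {..<L}. f x)"
    using assms by (intro sum_mono2 finite_PiE) auto
  then show ?thesis using assms(2) by (simp add: box_avg_def)
qed

text \<open>
  The Hamming distance \<open>f\<close> to \<open>A\<close> has variance at most \<open>card I\<close>. As \<open>f\<close> vanishes on the set \<open>A\<close> of
  density \<open>\<alpha>\<close>, Chebyshev's inequality bounds its mean by \<open>sqrt (card I / \<alpha>)\<close>; as \<open>B\<close> has density
  \<open>\<alpha>\<close>, the inequality also gives a point of \<open>B\<close> where \<open>f\<close> exceeds its mean by no more than that.
\<close>

lemma dense_sets_hamming_close:
  fixes I :: "nat set" and A B :: "(nat \<Rightarrow> nat) set" and \<alpha> :: real
  assumes I: "finite I" and L: "L > 0" and \<alpha>: "\<alpha> > 0"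
    and A: "A \<subseteq> I \<rightarrow>\<^sub>E {..<L}" "\<alpha> * real L ^ card I \<le> card A"
    and B: "B \<subseteq> I \<rightarrow>\<^sub>E {..<L}" "\<alpha> * real L ^ card I \<le> card B"
  shows "\<exists>a\<in>A. \<exists>b\<in>B. real (card {i\<in>I. a i \<noteq> b i}) \<le> 2 * sqrt (card I / \<alpha>)"
proof -
  define N where "N = real L ^ card I"
  have N: "N > 0" using L by (simp add: N_def)
  have fin: "finite (I \<rightarrow>\<^sub>E {..<L})" using I by (intro finite_PiE) auto
  have fA: "finite A" and fB: "finite B" using finite_subset A(1) B(1) fin by auto
  have "real (card A) > 0" using A(2) N \<alpha> by (smt (verit) N_def mult_pos_pos)
  then have A0: "A \<noteq> {}" by auto
  have B0: "real (card B) > 0" using B(2) N \<alpha> by (smt (verit) N_def mult_pos_pos)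
  define H where "H x = (\<lambda>y. card {i\<in>I. x i \<noteq> y i}) ` A" for x :: "nat \<Rightarrow> nat"
  define f where "f x = real (Min (H x))" for x
  have Hf: "finite (H x)" "H x \<noteq> {}" for x using fA A0 by (auto simp: H_def)
  have att: "\<exists>y\<in>A. f x = real (card {i\<in>I. x i \<noteq> y i})" for x
    using Min_in[OF Hf[of x]] by (auto simp: f_def H_def)
  have le: "f x \<le> real (card {i\<in>I. x i \<noteq> y i})" if "y \<in> A" for x y
    unfolding f_def using that Hf by (auto simp: H_def intro!: Min_le)
  have f0: "f x = 0" if "x \<in> A" for x
    using le[OF that, of x] by (simp add: f_def)
  have lip1: "f (x(j := a)) \<le> f x + 1" for x j a
  proof -
    obtain y where y: "y \<in> A" "f x = real (card {i\<in>I. x i \<noteq> y i})" using att by blast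
    have "f (x(j := a)) \<le> real (card {i\<in>I. (x(j := a)) i \<noteq> y i})" by (rule le[OF y(1)])
    also have "card {i\<in>I. (x(j := a)) i \<noteq> y i} \<le> card (insert j {i\<in>I. x i \<noteq> y i})"
      using I by (intro card_mono) auto
    also have "\<dots> \<le> card {i\<in>I. x i \<noteq> y i} + 1" using I by (simp add: card_insert_if)
    finally show ?thesis using y(2) by simp
  qed
  have lip: "\<bar>f (x(j := a)) - f x\<bar> \<le> 1" for x j a
    using lip1[of x j a] lip1[of "x(j := a)" j "x j"] by simp
  define e where "e = box_avg L I f"
  have var: "box_avg L I (\<lambda>x. (f x - e)\<^sup>2) \<le> card I"
  proof -
    have "(\<lambda>x. (f x - e)\<^sup>2) = (\<lambda>x. (f x)\<^sup>2 + ((-2 * e) * f x + e\<^sup>2))"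
      by (auto simp: power2_eq_square algebra_simps)
    then have "box_avg L I (\<lambda>x. (f x - e)\<^sup>2) = box_avg L I (\<lambda>x. (f x)\<^sup>2) + ((-2 * e) * e + e\<^sup>2)"
      using I L by (simp only: box_avg_add box_avg_cmult box_avg_const e_def[symmetric])
    also have "\<dots> \<le> card I" using box_variance_le[OF I L, of f] lip
      by (simp add: e_def[symmetric] power2_eq_square)
    finally show ?thesis .
  qed
  have cheb: "(\<Sum>x\<in>C. (f x - e)\<^sup>2) \<le> card I * N" if "C \<subseteq> I \<rightarrow>\<^sub>E {..<L}" for C
  proof -
    have "(\<Sum>x\<in>C. (f x - e)\<^sup>2) \<le> box_avg L I (\<lambda>x. (f x - e)\<^sup>2) * N"
      unfolding N_def by (rule box_sum_subset_le[OF I L that]) simp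
    also have "\<dots> \<le> card I * N" using var N by (intro mult_right_mono) auto
    finally show ?thesis .
  qed
  have "\<alpha> * N * e\<^sup>2 \<le> card A * e\<^sup>2" using A(2) by (intro mult_right_mono) (auto simp: N_def)
  also have "\<dots> = (\<Sum>x\<in>A. (f x - e)\<^sup>2)" using f0 by simp
  also have "\<dots> \<le> card I * N" by (rule cheb[OF A(1)])
  finally have "e\<^sup>2 \<le> card I / \<alpha>" using N \<alpha> by (simp add: field_simps)
  then have e: "e \<le> sqrt (card I / \<alpha>)" by (rule real_le_rsqrt)
  have "\<exists>b\<in>B. (f b - e)\<^sup>2 \<le> card I / \<alpha>"
  proof (rule ccontr)
    assume "\<not> ?thesis"
    then have *: "\<And>b. b \<in> B \<Longrightarrow> card I / \<alpha> < (f b - e)\<^sup>2" by force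
    have "card I * N \<le> card B * (card I / \<alpha>)"
    proof -
      have "card I / \<alpha> * (\<alpha> * N) \<le> card I / \<alpha> * card B"
        using B(2) \<alpha> by (intro mult_left_mono) (auto simp: N_def)
      then show ?thesis using \<alpha> by (simp add: field_simps)
    qed
    also have "\<dots> = (\<Sum>b\<in>B. card I / \<alpha>)" by simp
    also have "\<dots> < (\<Sum>b\<in>B. (f b - e)\<^sup>2)"
      using * B0 fB by (intro sum_strict_mono) auto
    also have "\<dots> \<le> card I * N" by (rule cheb[OF B(1)])
    finally show False by simp
  qed
  then obtain b where b: "b \<in> B" "(f b - e)\<^sup>2 \<le> card I / \<alpha>" by blast
  have "f b - e \<le> sqrt (card I / \<alpha>)" by (rule real_le_rsqrt[OF b(2)])
  then have fb: "f b \<le> 2 * sqrt (card I / \<alpha>)" using e by simp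
  obtain a where "a \<in> A" "f b = real (card {i\<in>I. b i \<noteq> a i})" using att by blast
  moreover have "{i\<in>I. b i \<noteq> a i} = {i\<in>I. a i \<noteq> b i}" by auto
  ultimately show ?thesis using fb b(1) by auto
qed

text \<open>
  The set \<open>A1\<close> of points whose shift by \<open>1\<close> in every coordinate lies in \<open>A\<close> has almost the density
  of \<open>A\<close> if the box is long, so \<open>A1\<close> and \<open>A\<close> contain points at small Hamming distance.
\<close>

lemma box_shift_almost_fixed:
  fixes \<delta> \<epsilon> :: real
  assumes \<delta>: "\<delta> > 0" and \<epsilon>: "\<epsilon> > 0"
  shows "\<exists>M L. M > 1 \<and> L > 0 \<and> (\<forall>A \<subseteq> {..<M} \<rightarrow>\<^sub>E {..<L}. \<delta> * real L ^ M \<le> card A \<longrightarrow>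
    (\<exists>a\<in>A. \<exists>b\<in>A. real (card {i\<in>{..<M}. a i \<noteq> b i + 1}) \<le> \<epsilon> * M))"
proof -
  \<comment> \<open>With this \<open>M\<close>, the bound \<open>2 * sqrt (M / (\<delta> / 2))\<close> for the distance of two sets of density
    \<open>\<delta> / 2\<close> is at most \<open>\<epsilon> * M\<close>.\<close>
  obtain M0 :: nat where M0: "M0 > 8 / (\<delta> * \<epsilon>\<^sup>2)" using reals_Archimedean2 by blast
  define M where "M = M0 + 2"
  have M: "real M \<ge> 8 / (\<delta> * \<epsilon>\<^sup>2)" "M > 1" using M0 by (auto simp: M_def)
  \<comment> \<open>At most the proportion \<open>M / L \<le> \<delta> / 2\<close> of the points have a coordinate \<open>0\<close> and cannot be
    shifted down.\<close>
  obtain L0 :: nat where L0: "L0 > 2 * M / \<delta>" using reals_Archimedean2 by blast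
  define L where "L = L0 + 1"
  have L: "real L \<ge> 2 * M / \<delta>" "L > 0" using L0 by (auto simp: L_def)
  let ?I = "{..<M}" let ?X = "?I \<rightarrow>\<^sub>E {..<L}"
  have fin: "finite ?X" by (intro finite_PiE) auto
  show ?thesis
  proof (rule exI[of _ M], rule exI[of _ L], intro conjI allI impI)
    fix A assume A: "A \<subseteq> ?X" and dA: "\<delta> * real L ^ M \<le> card A"
    define A1 where "A1 = {x\<in>?X. (\<lambda>i\<in>?I. x i + 1) \<in> A}"
    define Z where "Z i = {y\<in>?X. y i = 0}" for i
    have Z: "real L * card (Z i) \<le> real L ^ M" if "i < M" for i
    proof -
      have "Z i \<subseteq> (\<Pi>\<^sub>E j\<in>?I. if j = i then {0} else {..<L})"
        by (auto simp: Z_def PiE_iff extensional_def)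
      then have "card (Z i) \<le> card (\<Pi>\<^sub>E j\<in>?I. if j = i then {0} else {..<L})"
        by (intro card_mono finite_PiE) auto
      also have "\<dots> = (\<Prod>j\<in>?I. if j = i then 1 else L)"
        by (simp add: card_PiE if_distrib cong: if_cong)
      also have "\<dots> = L ^ (M - 1)"
        using that by (simp add: prod.remove[of _ i])
      finally have "real (card (Z i)) \<le> real L ^ (M - 1)" by (metis of_nat_le_iff of_nat_power)
      then have "real L * card (Z i) \<le> real L * real L ^ (M - 1)" by (rule mult_left_mono) simp
      also have "\<dots> = real L ^ M" using M(2) by (simp add: power_eq_if)
      finally show ?thesis .
    qed
    have "A \<subseteq> (\<lambda>x. \<lambda>i\<in>?I. x i + 1) ` A1 \<union> (\<Union>i\<in>?I. Z i)"
    proof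
      fix y assume y: "y \<in> A"
      show "y \<in> (\<lambda>x. \<lambda>i\<in>?I. x i + 1) ` A1 \<union> (\<Union>i\<in>?I. Z i)"
      proof (cases "\<exists>i<M. y i = 0")
        case True
        then show ?thesis using y A by (auto simp: Z_def)
      next
        case False
        define x where "x = (\<lambda>i\<in>?I. y i - 1)"
        have yX: "y \<in> ?X" using y A by blast
        have e: "(\<lambda>i\<in>?I. x i + 1) = y"
          using False yX by (fastforce simp: x_def PiE_iff extensional_def)
        have "x i < L" if "i < M" for i
        proof -
          have "y i < L" using yX that by (auto simp: PiE_iff)
          then show ?thesis using that by (simp add: x_def)
        qed
        then have "x \<in> ?X" by (auto simp: PiE_iff x_def)
        then have "x \<in> A1" unfolding A1_def mem_Collect_eq e using y by (rule conjI)
        then show ?thesis using e by (metis (mono_tags, lifting) UnCI image_eqI)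
      qed
    qed
    then have "card A \<le> card ((\<lambda>x. \<lambda>i\<in>?I. x i + 1) ` A1 \<union> (\<Union>i\<in>?I. Z i))"
      using fin by (intro card_mono) (auto simp: A1_def Z_def)
    also have "\<dots> \<le> card ((\<lambda>x. \<lambda>i\<in>?I. x i + 1) ` A1) + card (\<Union>i\<in>?I. Z i)" by (rule card_Un_le)
    also have "\<dots> \<le> card A1 + (\<Sum>i\<in>?I. card (Z i))"
      using fin by (intro add_mono card_image_le card_UN_le) (auto simp: A1_def)
    finally have "real (card A) \<le> real (card A1 + (\<Sum>i\<in>?I. card (Z i)))" by (simp only: of_nat_le_iff)
    then have c1: "real (card A) \<le> card A1 + (\<Sum>i\<in>?I. real (card (Z i)))" by simp
    have "real L * (\<Sum>i\<in>?I. real (card (Z i))) \<le> (\<Sum>i\<in>?I. real L ^ M)"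
      unfolding sum_distrib_left using Z by (intro sum_mono) auto
    also have "\<dots> = M * real L ^ M" by simp
    also have "\<dots> \<le> (\<delta> / 2 * L) * real L ^ M"
      using L \<delta> by (intro mult_right_mono) (auto simp: field_simps)
    finally have "real L * (\<Sum>i\<in>?I. real (card (Z i))) \<le> real L * (\<delta> / 2 * real L ^ M)" by (simp add: mult_ac)
    then have "(\<Sum>i\<in>?I. real (card (Z i))) \<le> \<delta> / 2 * real L ^ M" using L(2) by simp
    then have dA1: "\<delta> / 2 * real L ^ M \<le> card A1" using c1 dA by simp
    have "0 \<le> \<delta> / 2 * real L ^ M" using \<delta> by simp
    then have dA': "\<delta> / 2 * real L ^ M \<le> card A" using dA by simp
    obtain x b where x: "x \<in> A" and b: "b \<in> A1"
      and c: "real (card {i\<in>?I. x i \<noteq> b i}) \<le> 2 * sqrt (card ?I / (\<delta> / 2))"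
      using dense_sets_hamming_close[of ?I L "\<delta> / 2" A A1] L \<delta> A dA1 dA' by (auto simp: A1_def)
    define a where "a = (\<lambda>i\<in>?I. b i + 1)"
    have aA: "a \<in> A" using b by (simp add: A1_def a_def)
    have eq: "{i\<in>?I. a i \<noteq> x i + 1} = {i\<in>?I. x i \<noteq> b i}" by (auto simp: a_def)
    have le: "2 * sqrt (card ?I / (\<delta> / 2)) \<le> \<epsilon> * M"
    proof -
      have "8 / \<delta> \<le> \<epsilon>\<^sup>2 * M" using M(1) \<delta> \<epsilon> by (simp add: field_simps)
      then have "8 / \<delta> * M \<le> \<epsilon>\<^sup>2 * M * M" by (intro mult_right_mono) auto
      then have "4 * (card ?I / (\<delta> / 2)) \<le> (\<epsilon> * M)\<^sup>2" by (simp add: power2_eq_square mult_ac)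
      then have "sqrt (4 * (card ?I / (\<delta> / 2))) \<le> \<epsilon> * M" using \<epsilon> by (intro real_le_lsqrt) auto
      then show ?thesis unfolding real_sqrt_mult[of 4] by simp
    qed
    have "real (card {i\<in>?I. a i \<noteq> x i + 1}) \<le> \<epsilon> * M" unfolding eq using c le by (rule order_trans)
    then show "\<exists>a\<in>A. \<exists>b\<in>A. real (card {i\<in>?I. a i \<noteq> b i + 1}) \<le> \<epsilon> * M"
      using x aA by blast
  qed (use M L in auto)
qed

section \<open>Averages of characters\<close>

text \<open>
  For a nonempty list of characters these averages are positive definite with value \<open>1\<close> at \<open>0\<close>, so
  they are covariances of stationary processes; the list may contain repetitions, which act as
  weights.
\<close>

definition char_avg :: "('g \<Rightarrow> complex) list \<Rightarrow> 'g \<Rightarrow> real" where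
  "char_avg \<phi>s g = (\<Sum>\<phi>\<leftarrow>\<phi>s. Re (\<phi> g)) / real (length \<phi>s)"

lemma character_Re: "character \<phi> \<Longrightarrow> \<bar>Re (\<phi> g)\<bar> \<le> 1"
  using abs_Re_le_cmod[of "\<phi> g"] characterD(4) by metis

lemma abs_sum_list_le:
  fixes f :: "'a \<Rightarrow> real"
  assumes "\<And>x. x \<in> set xs \<Longrightarrow> \<bar>f x\<bar> \<le> c"
  shows "\<bar>\<Sum>x\<leftarrow>xs. f x\<bar> \<le> c * length xs"
  using assms
proof (induction xs)
  case (Cons a xs)
  have "\<bar>f a\<bar> \<le> c" "\<bar>\<Sum>x\<leftarrow>xs. f x\<bar> \<le> c * length xs" using Cons by auto
  then show ?case by (simp add: algebra_simps)
qed simp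

lemma abs_char_avg_le:
  assumes "\<And>\<phi>. \<phi> \<in> set \<phi>s \<Longrightarrow> character \<phi>"
  shows "\<bar>char_avg \<phi>s g\<bar> \<le> 1"
proof (cases "\<phi>s = []")
  case False
  have "\<bar>\<Sum>\<phi>\<leftarrow>\<phi>s. Re (\<phi> g)\<bar> \<le> 1 * real (length \<phi>s)"
    by (rule abs_sum_list_le) (use assms character_Re in auto)
  then show ?thesis using False by (simp add: char_avg_def field_simps)
qed (simp add: char_avg_def)

text \<open>
  The factor \<open>\<psi> \<phi>\<close> may depend on the character \<open>\<phi>\<close> that it multiplies.
\<close>

definition twist :: "(('g \<Rightarrow> complex) \<Rightarrow> 'g \<Rightarrow> complex) \<Rightarrow> ('g \<Rightarrow> complex) list \<Rightarrow> ('g \<Rightarrow> complex) list" where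
  "twist \<psi> \<phi>s = map (\<lambda>\<phi> g. \<phi> g * \<psi> \<phi> g) \<phi>s"

lemma char_avg_twists:
  assumes "m > 0"
  shows "char_avg (concat (map (\<lambda>l. twist (\<psi> l) \<phi>s) [0..<m])) g = (\<Sum>l<m. char_avg (twist (\<psi> l) \<phi>s) g) / m"
proof -
  have "(\<Sum>\<phi>\<leftarrow>concat (map (\<lambda>l. twist (\<psi> l) \<phi>s) [0..<m]). Re (\<phi> g)) = (\<Sum>l<m. \<Sum>\<phi>\<leftarrow>twist (\<psi> l) \<phi>s. Re (\<phi> g))"
    by (induction m) auto
  moreover have "length (concat (map (\<lambda>l. twist (\<psi> l) \<phi>s) [0..<m])) = m * length \<phi>s"
    by (induction m) (auto simp: twist_def)
  ultimately show ?thesis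
    by (simp add: char_avg_def sum_divide_distrib[symmetric] twist_def mult.commute)
qed

lemma char_avg_twist_close:
  assumes "\<phi>s \<noteq> []" "\<And>\<phi>. \<phi> \<in> set \<phi>s \<Longrightarrow> character \<phi>" "\<And>\<phi>. \<phi> \<in> set \<phi>s \<Longrightarrow> norm (\<psi> \<phi> g - 1) \<le> \<epsilon>"
  shows "\<bar>char_avg (twist \<psi> \<phi>s) g - char_avg \<phi>s g\<bar> \<le> \<epsilon>"
proof -
  have *: "\<bar>Re (\<phi> g * \<psi> \<phi> g) - Re (\<phi> g)\<bar> \<le> \<epsilon>" if "\<phi> \<in> set \<phi>s" for \<phi>
  proof -
    have e: "Re (\<phi> g * \<psi> \<phi> g) - Re (\<phi> g) = Re (\<phi> g * (\<psi> \<phi> g - 1))" by (simp add: algebra_simps)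
    have "\<bar>Re (\<phi> g * \<psi> \<phi> g) - Re (\<phi> g)\<bar> \<le> norm (\<phi> g * (\<psi> \<phi> g - 1))"
      unfolding e by (rule abs_Re_le_cmod)
    also have "\<dots> = norm (\<psi> \<phi> g - 1)" using characterD(4)[OF assms(2)[OF that]] by (simp add: norm_mult)
    finally show ?thesis using assms(3)[OF that] by simp
  qed
  have e: "(\<Sum>\<phi>\<leftarrow>twist \<psi> \<phi>s. Re (\<phi> g)) - (\<Sum>\<phi>\<leftarrow>\<phi>s. Re (\<phi> g)) = (\<Sum>\<phi>\<leftarrow>\<phi>s. Re (\<phi> g * \<psi> \<phi> g) - Re (\<phi> g))"
    by (simp add: twist_def sum_list_subtractf o_def)
  have "\<bar>(\<Sum>\<phi>\<leftarrow>twist \<psi> \<phi>s. Re (\<phi> g)) - (\<Sum>\<phi>\<leftarrow>\<phi>s. Re (\<phi> g))\<bar> \<le> \<epsilon> * length \<phi>s"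
    unfolding e by (rule abs_sum_list_le) (rule *)
  then have "\<bar>(\<Sum>\<phi>\<leftarrow>twist \<psi> \<phi>s. Re (\<phi> g)) - (\<Sum>\<phi>\<leftarrow>\<phi>s. Re (\<phi> g))\<bar> / length \<phi>s \<le> \<epsilon>"
    using assms(1) by (simp add: field_simps)
  then show ?thesis
    using assms(1) by (simp add: char_avg_def twist_def diff_divide_distrib[symmetric])
qed

lemma char_avg_twists_close:
  assumes "m > 0" "\<phi>s \<noteq> []" "\<And>\<phi>. \<phi> \<in> set \<phi>s \<Longrightarrow> character \<phi>"
    "\<And>l \<phi>. l < m \<Longrightarrow> \<phi> \<in> set \<phi>s \<Longrightarrow> norm (\<psi> l \<phi> g - 1) \<le> \<epsilon>"
  shows "\<bar>char_avg (concat (map (\<lambda>l. twist (\<psi> l) \<phi>s) [0..<m])) g - char_avg \<phi>s g\<bar> \<le> \<epsilon>"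
proof -
  have e: "(\<Sum>l<m. char_avg (twist (\<psi> l) \<phi>s) g) / m - char_avg \<phi>s g = (\<Sum>l<m. char_avg (twist (\<psi> l) \<phi>s) g - char_avg \<phi>s g) / m"
    using assms(1) by (simp add: sum_subtractf diff_divide_distrib)
  have "\<bar>(\<Sum>l<m. char_avg (twist (\<psi> l) \<phi>s) g) / m - char_avg \<phi>s g\<bar>
      \<le> (\<Sum>l<m. \<bar>char_avg (twist (\<psi> l) \<phi>s) g - char_avg \<phi>s g\<bar>) / m"
    unfolding e by (simp add: divide_right_mono)
  also have "\<dots> \<le> (\<Sum>l<m. \<epsilon>) / m"
    using char_avg_twist_close[OF assms(2,3)] assms(4) by (intro divide_right_mono sum_mono) auto
  finally show ?thesis using assms(1) by (simp add: char_avg_twists[OF assms(1)])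
qed

lemma richD:
  assumes "rich \<Gamma>"
  shows "\<xi> \<in> \<Gamma> \<Longrightarrow> character \<xi>" "\<xi> \<in> \<Gamma> \<Longrightarrow> \<psi> \<in> \<Gamma> \<Longrightarrow> (\<lambda>g. \<xi> g * \<psi> g) \<in> \<Gamma>"
    "\<exists>\<xi>\<in>\<Gamma>. \<exists>g. \<xi> g \<noteq> 1"
    "finite F \<Longrightarrow> finite \<Psi> \<Longrightarrow> \<Psi> \<subseteq> \<Gamma> \<Longrightarrow> \<epsilon> > 0 \<Longrightarrow>
       \<exists>e. (\<forall>\<xi>\<in>\<Psi>. norm (\<xi> e - 1) < \<epsilon>) \<and>
          (\<forall>\<phi>\<in>\<Gamma>. \<forall>h. \<exists>\<psi>\<in>\<Gamma>. (\<forall>f\<in>F. norm (\<psi> f - 1) < \<epsilon>) \<and> norm (\<psi> e - \<phi> h) < \<epsilon>)"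
  using assms[unfolded rich_def, THEN conjunct1]
    assms[unfolded rich_def, THEN conjunct2, THEN conjunct1]
    assms[unfolded rich_def, THEN conjunct2, THEN conjunct2, THEN conjunct1]
    assms[unfolded rich_def, THEN conjunct2, THEN conjunct2, THEN conjunct2, rule_format, of F \<Psi> \<epsilon>]
  by (simp_all only: simp_thms)

lemma set_twists_subset:
  assumes "rich \<Gamma>" "set \<phi>s \<subseteq> \<Gamma>" "\<And>l \<phi>. l < m \<Longrightarrow> \<phi> \<in> set \<phi>s \<Longrightarrow> \<psi> l \<phi> \<in> \<Gamma>"
  shows "set (concat (map (\<lambda>l. twist (\<psi> l) \<phi>s) [0..<m])) \<subseteq> \<Gamma>"
  using assms(2,3) richD(2)[OF assms(1)] by (auto simp: twist_def)

lemma Re_less_one_of_unit: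
  assumes "norm (z::complex) = 1" "z \<noteq> 1"
  shows "Re z < 1"
proof -
  have "Re z \<le> 1" using complex_Re_le_cmod[of z] assms by simp
  moreover have "Re z \<noteq> 1"
  proof
    assume "Re z = 1"
    then have "Im z = 0" using assms(1) cmod_power2[of z] by simp
    then show False using \<open>Re z = 1\<close> assms(2) by (simp add: complex_eq_iff)
  qed
  ultimately show ?thesis by simp
qed

text \<open>
  One character that is nontrivial at \<open>g\<close> is appended to many copies of the given list: its weight
  is positive, which makes the average smaller than \<open>1\<close> at \<open>g\<close>, and as small as desired.
\<close>

lemma freeness_step:
  assumes rich: "rich \<Gamma>" and \<phi>s: "\<phi>s \<noteq> []" "set \<phi>s \<subseteq> \<Gamma>" and \<phi>0: "\<phi>0 \<in> \<Gamma>" "\<phi>0 g \<noteq> 1" and \<tau>: "\<tau> > 0"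
  shows "\<exists>\<phi>s'. \<phi>s' \<noteq> [] \<and> set \<phi>s' \<subseteq> \<Gamma> \<and> (\<forall>k. \<bar>char_avg \<phi>s' k - char_avg \<phi>s k\<bar> \<le> \<tau>) \<and> char_avg \<phi>s' g < 1"
proof -
  obtain n :: nat where n: "n > 2 / \<tau>" using reals_Archimedean2 by blast
  have "2 / \<tau> > 0" using \<tau> by simp
  then have n0: "n > 0" using n by (cases n) auto
  define r where "r = length \<phi>s"
  have r: "r > 0" using \<phi>s by (simp add: r_def)
  define \<phi>s' where "\<phi>s' = concat (replicate n \<phi>s) @ [\<phi>0]"
  have len: "length \<phi>s' = n * r + 1" unfolding \<phi>s'_def r_def by (induction n) auto
  have sm: "(\<Sum>\<phi>\<leftarrow>\<phi>s'. Re (\<phi> k)) = n * (\<Sum>\<phi>\<leftarrow>\<phi>s. Re (\<phi> k)) + Re (\<phi>0 k)" for k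
    unfolding \<phi>s'_def by (induction n) (auto simp: algebra_simps)
  have ch: "\<phi> \<in> set \<phi>s \<Longrightarrow> character \<phi>" for \<phi> using \<phi>s(2) richD(1)[OF rich] by blast
  have ch0: "character \<phi>0" using richD(1)[OF rich \<phi>0(1)] .
  have s: "(\<Sum>\<phi>\<leftarrow>\<phi>s. Re (\<phi> k)) = r * char_avg \<phi>s k" for k
    using r by (simp add: char_avg_def r_def)
  have avg: "char_avg \<phi>s' k = (n * r * char_avg \<phi>s k + Re (\<phi>0 k)) / (n * r + 1)" for k
    unfolding char_avg_def[of \<phi>s'] len sm s by (simp add: mult.assoc)
  have pos: "real n * real r + 1 > 0" by (simp add: add_nonneg_pos)
  show ?thesis
  proof (intro exI[of _ \<phi>s'] conjI allI)
    fix k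
    have e: "char_avg \<phi>s' k - char_avg \<phi>s k = (Re (\<phi>0 k) - char_avg \<phi>s k) / (n * r + 1)"
      using pos by (simp add: avg field_simps)
    have "\<bar>char_avg \<phi>s' k - char_avg \<phi>s k\<bar> \<le> 2 / (n * r + 1)"
      unfolding e using character_Re[OF ch0, of k] abs_char_avg_le[OF ch, of \<phi>s k] by (auto simp: abs_divide intro!: divide_right_mono)
    also have "\<dots> \<le> 2 / n"
    proof (rule divide_left_mono)
      have "n \<le> n * r" using r by simp
      then show "real n \<le> real (n * r + 1)" by linarith
    qed (use n0 in \<open>auto intro!: mult_pos_pos add_pos_nonneg\<close>)
    also have "\<dots> \<le> \<tau>" using n \<tau> n0 by (simp add: field_simps)
    finally show "\<bar>char_avg \<phi>s' k - char_avg \<phi>s k\<bar> \<le> \<tau>" .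
  next
    have "char_avg \<phi>s g \<le> 1" using abs_char_avg_le[OF ch, of \<phi>s g] by simp
    then have "real (n * r) * char_avg \<phi>s g \<le> real (n * r) * 1" by (intro mult_left_mono) auto
    moreover have "Re (\<phi>0 g) < 1" using Re_less_one_of_unit characterD(4)[OF ch0] \<phi>0(2) by blast
    ultimately have "n * r * char_avg \<phi>s g + Re (\<phi>0 g) < n * r + 1" by simp
    then show "char_avg \<phi>s' g < 1" using pos by (simp add: avg)
  next
    show "set \<phi>s' \<subseteq> \<Gamma>" using \<phi>s(2) \<phi>0(1) by (auto simp: \<phi>s'_def)
  qed (simp add: \<phi>s'_def)
qed

lemma norm_geometric_sum_le:
  assumes "norm (z::complex) = 1" "z \<noteq> 1"
  shows "norm (\<Sum>a<n. z ^ a) \<le> 2 / norm (1 - z)"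
proof -
  have "(\<Sum>a<n. z ^ a) = (1 - z ^ n) / (1 - z)" using assms(2) by (simp add: sum_gp_strict)
  moreover have "norm (1 - z ^ n) \<le> 2" using norm_triangle_ineq4[of 1 "z ^ n"] assms(1) by (simp add: norm_power)
  ultimately show ?thesis by (simp add: norm_divide divide_right_mono)
qed

text \<open>
  Let \<open>z \<noteq> 1\<close> be a value of a character in \<open>\<Gamma>\<close>. The list is twisted by characters \<open>\<psi> a\<close> that are
  near \<open>1\<close> on \<open>F\<close> and near \<open>z ^ a\<close> at a new element \<open>e\<close>; on \<open>e + F\<close> the average then almost contains
  the factor \<open>(\<Sum>a<A. z ^ a) / A\<close>, a bounded geometric sum divided by \<open>A\<close>.
\<close>

lemma mixing_step:
  fixes \<phi>s :: "('g::ab_group_add \<Rightarrow> complex) list"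
  assumes rich: "rich \<Gamma>" and \<phi>s: "\<phi>s \<noteq> []" "set \<phi>s \<subseteq> \<Gamma>" and F: "finite F" and \<tau>: "\<tau> > 0" and \<epsilon>: "\<epsilon> > 0"
  shows "\<exists>\<phi>s' e. \<phi>s' \<noteq> [] \<and> set \<phi>s' \<subseteq> \<Gamma> \<and> (\<forall>k\<in>F. \<bar>char_avg \<phi>s' k - char_avg \<phi>s k\<bar> \<le> \<tau>) \<and>
    (\<forall>k\<in>F. \<bar>char_avg \<phi>s' (e + k)\<bar> \<le> \<epsilon>)"
proof -
  obtain \<phi>0 h0 where \<phi>0: "\<phi>0 \<in> \<Gamma>" "\<phi>0 h0 \<noteq> 1" using richD(3)[OF rich] by blast
  have ch0: "character \<phi>0" using richD(1)[OF rich \<phi>0(1)] .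
  define z where "z = \<phi>0 h0"
  have z: "norm z = 1" "z \<noteq> 1" using characterD(4)[OF ch0] \<phi>0 by (auto simp: z_def)
  have z': "norm (1 - z) > 0" using z by simp
  obtain A :: nat where A: "A > 4 / (norm (1 - z) * \<epsilon>)" using reals_Archimedean2 by blast
  have "4 / (norm (1 - z) * \<epsilon>) > 0" using z' \<epsilon> by simp
  then have A0: "A > 0" using A by (cases A) auto
  define \<eta> where "\<eta> = min \<tau> (\<epsilon> / 4)"
  have \<eta>: "\<eta> > 0" "\<eta> \<le> \<tau>" "\<eta> \<le> \<epsilon> / 4" using \<tau> \<epsilon> by (auto simp: \<eta>_def)
  obtain e where e: "\<And>\<phi> h. \<phi> \<in> \<Gamma> \<Longrightarrow> \<exists>\<psi>\<in>\<Gamma>. (\<forall>f\<in>F. norm (\<psi> f - 1) < \<eta>) \<and> norm (\<psi> e - \<phi> h) < \<eta>"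
    using richD(4)[OF rich F, of "{}" \<eta>] \<eta> by auto
  have "\<exists>\<psi>. \<psi> \<in> \<Gamma> \<and> (\<forall>f\<in>F. norm (\<psi> f - 1) < \<eta>) \<and> norm (\<psi> e - z ^ a) < \<eta>" for a
    using e[OF \<phi>0(1), of "nsmul a h0"] by (auto simp: characterD(2)[OF ch0] z_def)
  then obtain \<psi> where \<psi>: "\<And>a. \<psi> a \<in> \<Gamma>" "\<And>a f. f \<in> F \<Longrightarrow> norm (\<psi> a f - 1) < \<eta>" "\<And>a. norm (\<psi> a e - z ^ a) < \<eta>"
    by metis
  have ch: "\<phi> \<in> set \<phi>s \<Longrightarrow> character \<phi>" for \<phi> using \<phi>s(2) richD(1)[OF rich] by blast
  have ch\<psi>: "character (\<psi> a)" for a using \<psi>(1) richD(1)[OF rich] by blast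
  define \<phi>s' where "\<phi>s' = concat (map (\<lambda>l. twist (\<lambda>_. \<psi> l) \<phi>s) [0..<A])"
  show ?thesis
  proof (intro exI[of _ \<phi>s'] exI[of _ e] conjI ballI)
    show "\<phi>s' \<noteq> []" using A0 \<phi>s(1) by (auto simp: \<phi>s'_def twist_def intro!: exI[of _ 0])
    show "set \<phi>s' \<subseteq> \<Gamma>" unfolding \<phi>s'_def by (rule set_twists_subset[OF rich \<phi>s(2)]) (rule \<psi>(1))
    fix k assume k: "k \<in> F"
    show "\<bar>char_avg \<phi>s' k - char_avg \<phi>s k\<bar> \<le> \<tau>" unfolding \<phi>s'_def
      using \<psi>(2)[OF k] \<eta> by (intro char_avg_twists_close[OF A0 \<phi>s(1) ch]) (auto intro: less_imp_le order_trans)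
    have "norm (\<Sum>a<A. \<psi> a (e + k)) \<le> norm (\<Sum>a<A. \<psi> a (e + k) - z ^ a) + norm (\<Sum>a<A. z ^ a)"
      using norm_triangle_ineq[of "\<Sum>a<A. \<psi> a (e + k) - z ^ a" "\<Sum>a<A. z ^ a"] by (simp add: sum_subtractf)
    also have "norm (\<Sum>a<A. \<psi> a (e + k) - z ^ a) \<le> (\<Sum>a<A. 2 * \<eta>)"
    proof (rule order_trans[OF norm_sum sum_mono])
      fix a
      have eq: "\<psi> a (e + k) - z ^ a = \<psi> a e * (\<psi> a k - 1) + (\<psi> a e - z ^ a)"
        by (simp add: characterD(5)[OF ch\<psi>] algebra_simps)
      have "norm (\<psi> a (e + k) - z ^ a) \<le> norm (\<psi> a e * (\<psi> a k - 1)) + norm (\<psi> a e - z ^ a)"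
        unfolding eq by (rule norm_triangle_ineq)
      also have "\<dots> \<le> 2 * \<eta>" using \<psi>(2)[OF k, of a] \<psi>(3)[of a] by (simp add: norm_mult characterD(4)[OF ch\<psi>])
      finally show "norm (\<psi> a (e + k) - z ^ a) \<le> 2 * \<eta>" .
    qed
    also have "\<dots> \<le> A * (\<epsilon> / 2)" using \<eta>(3) A0 by simp
    also have "norm (\<Sum>a<A. z ^ a) \<le> A * (\<epsilon> / 2)"
    proof -
      have "2 / norm (1 - z) \<le> A * (\<epsilon> / 2)" using A z' \<epsilon> by (simp add: field_simps)
      then show ?thesis using norm_geometric_sum_le[OF z, of A] by simp
    qed
    finally have S: "norm (\<Sum>a<A. \<psi> a (e + k)) \<le> A * \<epsilon>" by (simp add: mult.commute)
    have eq: "(\<Sum>l<A. char_avg (twist (\<lambda>_. \<psi> l) \<phi>s) (e + k)) = (\<Sum>\<phi>\<leftarrow>\<phi>s. Re (\<phi> (e + k) * (\<Sum>a<A. \<psi> a (e + k)))) / length \<phi>s"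
    proof -
      have "(\<Sum>l<A. \<Sum>\<phi>\<leftarrow>\<phi>s. Re (\<phi> (e + k) * \<psi> l (e + k))) = (\<Sum>\<phi>\<leftarrow>\<phi>s. Re (\<phi> (e + k) * (\<Sum>a<A. \<psi> a (e + k))))"
        by (induction \<phi>s) (simp_all add: sum.distrib sum_distrib_left)
      then show ?thesis by (simp add: char_avg_def twist_def o_def sum_divide_distrib[symmetric])
    qed
    have "\<bar>\<Sum>l<A. char_avg (twist (\<lambda>_. \<psi> l) \<phi>s) (e + k)\<bar> \<le> A * \<epsilon>"
    proof -
      have "\<bar>\<Sum>\<phi>\<leftarrow>\<phi>s. Re (\<phi> (e + k) * (\<Sum>a<A. \<psi> a (e + k)))\<bar> \<le> A * \<epsilon> * length \<phi>s"
      proof (rule abs_sum_list_le)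
        fix \<phi> assume "\<phi> \<in> set \<phi>s"
        then have "norm (\<phi> (e + k) * (\<Sum>a<A. \<psi> a (e + k))) \<le> A * \<epsilon>"
          using S by (simp add: norm_mult characterD(4)[OF ch])
        then show "\<bar>Re (\<phi> (e + k) * (\<Sum>a<A. \<psi> a (e + k)))\<bar> \<le> A * \<epsilon>"
          by (rule order_trans[OF abs_Re_le_cmod])
      qed
      then show ?thesis unfolding eq using \<phi>s(1) by (simp add: field_simps)
    qed
    then have "\<bar>\<Sum>l<A. char_avg (twist (\<lambda>_. \<psi> l) \<phi>s) (e + k)\<bar> / A \<le> \<epsilon>"
      using A0 by (simp add: field_simps)
    then show "\<bar>char_avg \<phi>s' (e + k)\<bar> \<le> \<epsilon>"
      unfolding \<phi>s'_def char_avg_twists[OF A0] by simp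
  qed
qed

text \<open>
  Elements \<open>e l\<close> and twists \<open>\<psi> l\<close> that are almost dual to each other: the twisted character
  \<open>\<phi> * \<psi> l \<phi>\<close> is near \<open>1\<close> at \<open>e l'\<close> for \<open>l' \<noteq> l\<close>, near \<open>\<phi> h\<close> at \<open>e l\<close>, and near \<open>\<phi>\<close> on \<open>F\<close>.
\<close>

definition hamming_blocks :: "('g::ab_group_add \<Rightarrow> complex) set \<Rightarrow> ('g \<Rightarrow> complex) list \<Rightarrow> 'g set \<Rightarrow> real \<Rightarrow> 'g \<Rightarrow> nat \<Rightarrow>
    (nat \<Rightarrow> ('g \<Rightarrow> complex) \<Rightarrow> 'g \<Rightarrow> complex) \<Rightarrow> (nat \<Rightarrow> 'g) \<Rightarrow> bool" where
  "hamming_blocks \<Gamma> \<phi>s F \<kappa> h m \<psi> e \<longleftrightarrow> (\<forall>l<m. \<forall>\<phi>\<in>set \<phi>s. \<psi> l \<phi> \<in> \<Gamma> \<and>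
     (\<forall>f\<in>F. norm (\<psi> l \<phi> f - 1) < \<kappa>) \<and> norm (\<phi> (e l) - 1) < \<kappa> \<and>
     (\<forall>l'<m. l' \<noteq> l \<longrightarrow> norm (\<psi> l \<phi> (e l') - 1) < \<kappa>) \<and> norm (\<psi> l \<phi> (e l) - \<phi> h) < \<kappa>)"

lemma hamming_blocksD:
  assumes "hamming_blocks \<Gamma> \<phi>s F \<kappa> h m \<psi> e" "l < m" "\<phi> \<in> set \<phi>s"
  shows "\<psi> l \<phi> \<in> \<Gamma>" "f \<in> F \<Longrightarrow> norm (\<psi> l \<phi> f - 1) < \<kappa>" "norm (\<phi> (e l) - 1) < \<kappa>"
    "l' < m \<Longrightarrow> l' \<noteq> l \<Longrightarrow> norm (\<psi> l \<phi> (e l') - 1) < \<kappa>" "norm (\<psi> l \<phi> (e l) - \<phi> h) < \<kappa>"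
  using assms unfolding hamming_blocks_def by auto

text \<open>
  Richness supplies the blocks one at a time: the characters chosen so far are near \<open>1\<close> at the new
  element, and the new characters are near \<open>1\<close> at the elements chosen so far.
\<close>

lemma hamming_blocks_exist:
  fixes F :: "'g::ab_group_add set"
  assumes rich: "rich \<Gamma>" and \<phi>s: "set \<phi>s \<subseteq> \<Gamma>" and F: "finite F" and \<kappa>: "\<kappa> > 0"
  shows "\<exists>\<psi> e. hamming_blocks \<Gamma> \<phi>s F \<kappa> h m \<psi> e"
proof (induction m)
  case (Suc m)
  then obtain \<psi> e where "hamming_blocks \<Gamma> \<phi>s F \<kappa> h m \<psi> e" by blast
  note IH = hamming_blocksD[OF this]
  define \<Psi> where "\<Psi> = set \<phi>s \<union> (\<lambda>(l, \<phi>). \<psi> l \<phi>) ` ({..<m} \<times> set \<phi>s)"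
  have \<Psi>: "finite \<Psi>" "\<Psi> \<subseteq> \<Gamma>" using \<phi>s IH(1) by (auto simp: \<Psi>_def)
  have "finite (F \<union> e ` {..<m})" using F by simp
  from richD(4)[OF rich this \<Psi> \<kappa>] obtain d where d: "\<And>\<xi>. \<xi> \<in> \<Psi> \<Longrightarrow> norm (\<xi> d - 1) < \<kappa>"
    "\<And>\<phi>. \<phi> \<in> \<Gamma> \<Longrightarrow> \<exists>\<psi>\<in>\<Gamma>. (\<forall>f\<in>F \<union> e ` {..<m}. norm (\<psi> f - 1) < \<kappa>) \<and> norm (\<psi> d - \<phi> h) < \<kappa>"
    by blast
  have "\<forall>\<phi>. \<exists>\<psi>. \<phi> \<in> set \<phi>s \<longrightarrow> \<psi> \<in> \<Gamma> \<and> (\<forall>f\<in>F \<union> e ` {..<m}. norm (\<psi> f - 1) < \<kappa>) \<and> norm (\<psi> d - \<phi> h) < \<kappa>"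
    using d(2) \<phi>s by blast
  then obtain \<rho> where \<rho>: "\<And>\<phi>. \<phi> \<in> set \<phi>s \<Longrightarrow> \<rho> \<phi> \<in> \<Gamma>"
    "\<And>\<phi> f. \<phi> \<in> set \<phi>s \<Longrightarrow> f \<in> F \<union> e ` {..<m} \<Longrightarrow> norm (\<rho> \<phi> f - 1) < \<kappa>"
    "\<And>\<phi>. \<phi> \<in> set \<phi>s \<Longrightarrow> norm (\<rho> \<phi> d - \<phi> h) < \<kappa>" by metis
  have dP: "\<phi> \<in> set \<phi>s \<Longrightarrow> norm (\<phi> d - 1) < \<kappa>" "l < m \<Longrightarrow> \<phi> \<in> set \<phi>s \<Longrightarrow> norm (\<psi> l \<phi> d - 1) < \<kappa>" for l \<phi>
    by (rule d(1), force simp: \<Psi>_def)+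
  show ?case unfolding hamming_blocks_def
  proof (rule exI[of _ "\<psi>(m := \<rho>)"], rule exI[of _ "e(m := d)"], intro allI impI ballI)
    fix l \<phi> assume l: "l < Suc m" and \<phi>: "\<phi> \<in> set \<phi>s"
    show "(\<psi>(m := \<rho>)) l \<phi> \<in> \<Gamma> \<and> (\<forall>f\<in>F. norm ((\<psi>(m := \<rho>)) l \<phi> f - 1) < \<kappa>) \<and> norm (\<phi> ((e(m := d)) l) - 1) < \<kappa> \<and>
      (\<forall>l'<Suc m. l' \<noteq> l \<longrightarrow> norm ((\<psi>(m := \<rho>)) l \<phi> ((e(m := d)) l') - 1) < \<kappa>) \<and>
      norm ((\<psi>(m := \<rho>)) l \<phi> ((e(m := d)) l) - \<phi> h) < \<kappa>"
    proof (cases "l = m")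
      case True
      then show ?thesis using \<rho>[OF \<phi>] dP(1)[OF \<phi>] by (auto simp: less_Suc_eq)
    next
      case False
      then have lm: "l < m" using l by simp
      have "norm (\<psi> l \<phi> d - 1) < \<kappa>" using dP(2) lm \<phi> by blast
      then show ?thesis using IH[OF lm \<phi>] False lm by (auto simp: less_Suc_eq)
    qed
  qed
qed (simp add: hamming_blocks_def)

lemma character_sum:
  assumes "character \<xi>"
  shows "\<xi> (\<Sum>i\<in>I. f i) = (\<Prod>i\<in>I. \<xi> (f i))"
  by (induction I rule: infinite_finite_induct) (auto simp: characterD(1,5)[OF assms])

definition box_vec :: "nat \<Rightarrow> (nat \<Rightarrow> 'g::ab_group_add) \<Rightarrow> (nat \<Rightarrow> nat) \<Rightarrow> 'g" where
  "box_vec M e a = (\<Sum>i<M. nsmul (a i) (e i))"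

text \<open>
  As the \<open>e i\<close> add up to \<open>h\<close>, the value of \<open>\<xi>\<close> is the product of the powers of \<open>\<xi> (e i)\<close> with
  exponents \<open>a i - b i - 1\<close>. The exponent vanishes for \<open>i = l\<close>, the only \<open>i\<close> for which \<open>\<xi> (e i)\<close>
  need not be near \<open>1\<close>.
\<close>

lemma character_box_shift_close:
  fixes M L :: nat and \<kappa> :: real
  assumes \<xi>: "character \<xi>" and h: "(\<Sum>i<M. e i) = h" and l: "a l = b l + 1"
    and ab: "\<And>i. i < M \<Longrightarrow> a i < L" "\<And>i. i < M \<Longrightarrow> b i < L"
    and e: "\<And>i. i < M \<Longrightarrow> i \<noteq> l \<Longrightarrow> norm (\<xi> (e i) - 1) \<le> \<kappa>" and \<kappa>: "\<kappa> \<ge> 0"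
  shows "norm (\<xi> (box_vec M e a - box_vec M e b - h) - 1) \<le> 2 * real M * real L * \<kappa>"
proof -
  note c = characterD[OF \<xi>]
  have "\<xi> (box_vec M e a - box_vec M e b - h) = (\<Prod>i<M. \<xi> (e i) ^ a i * cnj (\<xi> (e i)) ^ (b i + 1))"
    unfolding h[symmetric] box_vec_def c(3) character_sum[OF \<xi>]
    by (simp add: c(2) prod.distrib mult_ac)
  then have "norm (\<xi> (box_vec M e a - box_vec M e b - h) - 1)
      = norm ((\<Prod>i<M. \<xi> (e i) ^ a i * cnj (\<xi> (e i)) ^ (b i + 1)) - (\<Prod>i<M. 1))" by simp
  also have "\<dots> \<le> (\<Sum>i<M. norm (\<xi> (e i) ^ a i * cnj (\<xi> (e i)) ^ (b i + 1) - 1))"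
    by (rule norm_prod_diff) (simp_all add: norm_mult norm_power c)
  also have "\<dots> \<le> (\<Sum>i<M. 2 * real L * \<kappa>)"
  proof (rule sum_mono)
    fix i assume i: "i \<in> {..<M}"
    define u where "u = \<xi> (e i)"
    have u: "norm u = 1" by (simp add: u_def c)
    have uu: "u * cnj u = 1" using u complex_norm_square[of u] by simp
    have "u ^ (b i + 1) * cnj u ^ (b i + 1) = 1" unfolding power_mult_distrib[symmetric] uu by simp
    then have eq: "u ^ a i * cnj u ^ (b i + 1) - 1 = (u ^ a i - u ^ (b i + 1)) * cnj u ^ (b i + 1)"
      by (simp add: algebra_simps)
    have "norm (u ^ a i * cnj u ^ (b i + 1) - 1) = norm (u ^ a i - u ^ (b i + 1))"
      unfolding eq norm_mult norm_power by (simp add: u)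
    also have "\<dots> \<le> 2 * real L * \<kappa>"
    proof (cases "i = l")
      case True
      then show ?thesis using l \<kappa> by simp
    next
      case False
      have "norm (u ^ a i - u ^ (b i + 1)) \<le> norm (u ^ a i - 1 ^ a i) + norm (u ^ (b i + 1) - 1 ^ (b i + 1))"
        using norm_triangle_ineq4[of "u ^ a i - 1" "u ^ (b i + 1) - 1"] by simp
      also have "\<dots> \<le> a i * norm (u - 1) + (b i + 1) * norm (u - 1)"
        using u by (intro add_mono norm_power_diff) auto
      also have "\<dots> = (a i + b i + 1) * norm (u - 1)" by (simp add: algebra_simps)
      also have "\<dots> \<le> (2 * real L) * \<kappa>"
        using ab[of i] e[of i] False i by (intro mult_mono) (auto simp: u_def)
      finally show ?thesis by simp
    qed
    finally show "norm (\<xi> (e i) ^ a i * cnj (\<xi> (e i)) ^ (b i + 1) - 1) \<le> 2 * real L * \<kappa>" by (simp add: u_def)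
  qed
  finally show ?thesis by (simp add: mult_ac)
qed

text \<open>
  To the \<open>m = M - 1\<close> blocks the element \<open>e m\<close> is added that makes the sum equal to \<open>h\<close>. The twisted
  character \<open>\<xi> l \<phi>\<close> is near \<open>1\<close> at \<open>e m\<close> too, because it is near \<open>\<phi> h\<close> both at \<open>h\<close> and at the sum of
  the other elements. Hence it is near \<open>1\<close> at all elements except \<open>e l\<close>, and
  \<open>character_box_shift_close\<close> applies to every \<open>l\<close> with \<open>a l = b l + 1\<close>; the few remaining \<open>l\<close>
  contribute little to the average.
\<close>

lemma hamming_step:
  fixes F :: "'g::ab_group_add set"
  assumes rich: "rich \<Gamma>" and \<phi>s: "\<phi>s \<noteq> []" "set \<phi>s \<subseteq> \<Gamma>" and F: "finite F"
    and \<tau>: "\<tau> > 0" and \<epsilon>: "\<epsilon> > 0" and M: "M > 1"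
  shows "\<exists>\<phi>s' e. \<phi>s' \<noteq> [] \<and> set \<phi>s' \<subseteq> \<Gamma> \<and> (\<forall>k\<in>F. \<bar>char_avg \<phi>s' k - char_avg \<phi>s k\<bar> \<le> \<tau>) \<and>
    (\<forall>a\<in>{..<M} \<rightarrow>\<^sub>E {..<L}. \<forall>b\<in>{..<M} \<rightarrow>\<^sub>E {..<L}. real (card {i\<in>{..<M}. a i \<noteq> b i + 1}) \<le> \<epsilon> / 8 * M \<longrightarrow>
      char_avg \<phi>s' (box_vec M e a - box_vec M e b - h) \<ge> 1 - \<epsilon>)"
proof -
  define m where "m = M - 1"
  have m: "m > 0" "M = Suc m" using M by (auto simp: m_def)
  \<comment> \<open>The error is \<open>\<kappa>\<close> times three factors: \<open>M\<close> coordinates, exponents of at most \<open>2 L\<close>, and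
    \<open>2 m + 1\<close> errors accumulated at \<open>e m\<close>.\<close>
  define Q where "Q = 2 * real M * (real L + 1) * (2 * real m + 1)"
  have Q: "Q > 0" using M by (simp add: Q_def add_nonneg_pos)
  define \<kappa> where "\<kappa> = min \<tau> (\<epsilon> / (2 * Q))"
  have \<kappa>: "\<kappa> > 0" "\<kappa> \<le> \<tau>" and \<kappa>2: "\<kappa> \<le> \<epsilon> / (2 * Q)"
    using \<tau> \<epsilon> Q by (auto simp: \<kappa>_def)
  have \<kappa>3: "2 * real M * real L * ((2 * real m + 1) * \<kappa>) \<le> \<epsilon> / 2"
  proof -
    have "2 * real M * real L * ((2 * real m + 1) * \<kappa>) \<le> 2 * real M * (real L + 1) * ((2 * real m + 1) * \<kappa>)"
      using \<kappa> by (intro mult_right_mono mult_left_mono) auto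
    also have "\<dots> = \<kappa> * Q" by (simp add: Q_def)
    also have "\<dots> \<le> \<epsilon> / 2" using \<kappa>2 Q by (simp add: field_simps)
    finally show ?thesis .
  qed
  have "finite (insert h F)" using F by simp
  from hamming_blocks_exist[OF rich \<phi>s(2) this \<kappa>(1), of h m]
  obtain \<psi> e0 where "hamming_blocks \<Gamma> \<phi>s (insert h F) \<kappa> h m \<psi> e0" by blast
  note B = hamming_blocksD[OF this]
  define e where "e = e0(m := h - (\<Sum>l<m. e0 l))"
  have e_lt: "e i = e0 i" if "i < m" for i using that by (simp add: e_def)
  have em: "e m = h - (\<Sum>l<m. e0 l)" by (simp add: e_def)
  have eh: "(\<Sum>i<M. e i) = h" unfolding m(2) lessThan_Suc using e_lt em by simp
  have ch: "\<phi> \<in> set \<phi>s \<Longrightarrow> character \<phi>" for \<phi> using \<phi>s(2) richD(1)[OF rich] by blast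
  have ch\<psi>: "l < m \<Longrightarrow> \<phi> \<in> set \<phi>s \<Longrightarrow> character (\<psi> l \<phi>)" for l \<phi> using B(1) richD(1)[OF rich] by blast
  define \<xi> where "\<xi> = (\<lambda>l \<phi> g. \<phi> g * \<psi> l \<phi> g)"
  have ch\<xi>: "character (\<xi> l \<phi>)" if "l < m" "\<phi> \<in> set \<phi>s" for l \<phi>
    unfolding \<xi>_def using character_mult[OF ch ch\<psi>] that by blast
  have prod_close: "norm (\<xi> l \<phi> g - c) \<le> norm (\<phi> g - 1) + norm (\<psi> l \<phi> g - c)" if "l < m" "\<phi> \<in> set \<phi>s" for l \<phi> g c
  proof -
    have "\<xi> l \<phi> g - c = (\<phi> g - 1) * \<psi> l \<phi> g + (\<psi> l \<phi> g - c)" by (simp add: \<xi>_def algebra_simps)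
    then have "norm (\<xi> l \<phi> g - c) \<le> norm ((\<phi> g - 1) * \<psi> l \<phi> g) + norm (\<psi> l \<phi> g - c)"
      by (simp only: norm_triangle_ineq)
    then show ?thesis by (simp add: norm_mult characterD(4)[OF ch\<psi>[OF that]])
  qed
  have \<xi>_e: "norm (\<xi> l \<phi> (e i) - 1) \<le> (2 * real m + 1) * \<kappa>" if l: "l < m" and \<phi>: "\<phi> \<in> set \<phi>s" and i: "i < M" "i \<noteq> l" for l \<phi> i
  proof (cases "i = m")
    case False
    then have im: "i < m" using i m by simp
    have "norm (\<xi> l \<phi> (e i) - 1) \<le> 2 * \<kappa>"
      using prod_close[OF l \<phi>, of "e i" 1] B(3)[OF im \<phi>] B(4)[OF l \<phi> im i(2)] by (simp add: e_lt[OF im])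
    also have "\<dots> \<le> (2 * real m + 1) * \<kappa>" using m(1) \<kappa> by (intro mult_right_mono) auto
    finally show ?thesis .
  next
    case True
    note c = characterD[OF ch\<xi>[OF l \<phi>]]
    have "\<xi> l \<phi> (e i) - 1 = (\<xi> l \<phi> h - (\<Prod>j<m. \<xi> l \<phi> (e0 j))) * cnj (\<Prod>j<m. \<xi> l \<phi> (e0 j))"
    proof -
      have "(\<Prod>j<m. \<xi> l \<phi> (e0 j)) * cnj (\<Prod>j<m. \<xi> l \<phi> (e0 j)) = 1"
        using c(4)[of "\<Sum>j<m. e0 j"] complex_norm_square[of "\<Prod>j<m. \<xi> l \<phi> (e0 j)"]
        by (simp only: character_sum[OF ch\<xi>[OF l \<phi>]]) simp
      then show ?thesis unfolding True em c(3) character_sum[OF ch\<xi>[OF l \<phi>]]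
        by (simp add: algebra_simps del: cnj_prod complex_cnj_mult)
    qed
    then have "norm (\<xi> l \<phi> (e i) - 1) = norm (\<xi> l \<phi> h - (\<Prod>j<m. \<xi> l \<phi> (e0 j)))"
      by (simp add: norm_mult prod_norm[symmetric] c)
    also have "\<dots> \<le> norm (\<xi> l \<phi> h - \<phi> h) + norm ((\<Prod>j<m. \<xi> l \<phi> (e0 j)) - \<phi> h)"
      using norm_triangle_ineq4[of "\<xi> l \<phi> h - \<phi> h" "(\<Prod>j<m. \<xi> l \<phi> (e0 j)) - \<phi> h"] by simp
    also have "norm (\<xi> l \<phi> h - \<phi> h) \<le> \<kappa>"
    proof -
      have "\<xi> l \<phi> h - \<phi> h = \<phi> h * (\<psi> l \<phi> h - 1)" by (simp add: \<xi>_def algebra_simps)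
      then show ?thesis using B(2)[OF l \<phi>, of h] by (simp add: norm_mult characterD(4)[OF ch[OF \<phi>]])
    qed
    also have "norm ((\<Prod>j<m. \<xi> l \<phi> (e0 j)) - \<phi> h) \<le> m * (2 * \<kappa>)"
    proof -
      have eq: "\<phi> h = (\<Prod>j<m. if j = l then \<phi> h else 1)" using l by simp
      have "norm ((\<Prod>j<m. \<xi> l \<phi> (e0 j)) - (\<Prod>j<m. if j = l then \<phi> h else 1)) \<le> (\<Sum>j<m. norm (\<xi> l \<phi> (e0 j) - (if j = l then \<phi> h else 1)))"
        by (rule norm_prod_diff) (auto simp: c characterD(4)[OF ch[OF \<phi>]])
      also have "\<dots> \<le> (\<Sum>j<m. 2 * \<kappa>)"
      proof (rule sum_mono)
        fix j assume "j \<in> {..<m}"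
        then have j: "j < m" by simp
        show "norm (\<xi> l \<phi> (e0 j) - (if j = l then \<phi> h else 1)) \<le> 2 * \<kappa>"
          using prod_close[OF l \<phi>, of "e0 j" "if j = l then \<phi> h else 1"] B(3)[OF j \<phi>] B(4)[OF l \<phi> j] B(5)[OF l \<phi>]
          by (cases "j = l") auto
      qed
      finally show ?thesis unfolding eq[symmetric] by simp
    qed
    finally show ?thesis by (simp add: algebra_simps)
  qed
  define \<phi>s' where "\<phi>s' = concat (map (\<lambda>l. twist (\<psi> l) \<phi>s) [0..<m])"
  show ?thesis
  proof (rule exI[of _ \<phi>s'], rule exI[of _ e], intro conjI ballI impI)
    show "\<phi>s' \<noteq> []" using m \<phi>s(1) by (auto simp: \<phi>s'_def twist_def intro!: exI[of _ 0])
    show "set \<phi>s' \<subseteq> \<Gamma>" unfolding \<phi>s'_def by (rule set_twists_subset[OF rich \<phi>s(2)]) (rule B(1))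
    fix k assume k: "k \<in> F"
    show "\<bar>char_avg \<phi>s' k - char_avg \<phi>s k\<bar> \<le> \<tau>" unfolding \<phi>s'_def
    proof (rule char_avg_twists_close[OF m(1) \<phi>s(1) ch])
      fix l \<phi> assume "l < m" "\<phi> \<in> set \<phi>s"
      then show "norm (\<psi> l \<phi> k - 1) \<le> \<tau>" using B(2)[of l \<phi> k] k \<kappa> by simp
    qed
  next
    fix a b assume ab: "a \<in> {..<M} \<rightarrow>\<^sub>E {..<L}" "b \<in> {..<M} \<rightarrow>\<^sub>E {..<L}"
      and bad: "real (card {i\<in>{..<M}. a i \<noteq> b i + 1}) \<le> \<epsilon> / 8 * M"
    define g where "g = box_vec M e a - box_vec M e b - h"
    define X where "X = {i\<in>{..<m}. a i \<noteq> b i + 1}"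
    have "card X \<le> card {i\<in>{..<M}. a i \<noteq> b i + 1}" using m by (intro card_mono) (auto simp: X_def)
    then have X: "real (card X) \<le> \<epsilon> / 8 * M" using bad by linarith
    \<comment> \<open>Each \<open>l\<close> in \<open>X\<close> lowers the average by at most \<open>2 / m\<close>, so at most \<open>\<epsilon> m / 4\<close> of them lower
      it by at most \<open>\<epsilon> / 2\<close>.\<close>
    have "\<epsilon> / 8 * M \<le> \<epsilon> / 8 * (2 * m)" using m \<epsilon> by (intro mult_left_mono) auto
    then have X: "real (card X) \<le> \<epsilon> / 4 * m" using X by simp
    have c: "char_avg (twist (\<psi> l) \<phi>s) g \<ge> 1 - \<epsilon> / 2 - 2 * indicator X l" if l: "l < m" for l
    proof (cases "l \<in> X")
      case True
      have "\<bar>char_avg (twist (\<psi> l) \<phi>s) g\<bar> \<le> 1"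
        by (rule abs_char_avg_le) (use ch\<xi>[OF l, unfolded \<xi>_def] in \<open>auto simp: twist_def\<close>)
      then show ?thesis using True \<epsilon> by (simp add: abs_le_iff)
    next
      case False
      then have l1: "a l = b l + 1" using l by (simp add: X_def)
      have "1 - \<epsilon> / 2 \<le> Re (\<xi> l \<phi> g)" if \<phi>: "\<phi> \<in> set \<phi>s" for \<phi>
      proof -
        have "norm (\<xi> l \<phi> g - 1) \<le> 2 * real M * real L * ((2 * real m + 1) * \<kappa>)"
          unfolding g_def
          by (rule character_box_shift_close[where l = l, OF ch\<xi>[OF l \<phi>] eh, of a b])
            (use l1 ab \<xi>_e[OF l \<phi>] \<kappa> in \<open>auto simp: PiE_iff\<close>)
        also note \<kappa>3
        finally have "\<bar>Re (\<xi> l \<phi> g - 1)\<bar> \<le> \<epsilon> / 2" by (rule order_trans[OF abs_Re_le_cmod])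
        then show ?thesis unfolding minus_complex.sel one_complex.sel by linarith
      qed
      then have "(\<Sum>\<phi>\<leftarrow>\<phi>s. 1 - \<epsilon> / 2) \<le> (\<Sum>\<phi>\<leftarrow>\<phi>s. Re (\<xi> l \<phi> g))" by (intro sum_list_mono)
      then have "(1 - \<epsilon> / 2) * length \<phi>s \<le> (\<Sum>\<phi>\<leftarrow>twist (\<psi> l) \<phi>s. Re (\<phi> g))"
        by (simp add: twist_def \<xi>_def o_def sum_list_triv mult.commute)
      then show ?thesis using False \<phi>s(1) by (simp add: char_avg_def twist_def field_simps)
    qed
    have "m * (1 - \<epsilon>) \<le> m * (1 - \<epsilon> / 2) - 2 * card X" using X by (simp add: algebra_simps)
    also have "\<dots> = (\<Sum>l<m. 1 - \<epsilon> / 2 - 2 * indicator X l)"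
    proof -
      have "(\<Sum>l<m. indicator X l :: real) = card X"
      proof -
        have "(\<Sum>l<m. indicator X l :: real) = (\<Sum>l\<in>{..<m} \<inter> X. 1)"
          by (simp add: indicator_def sum.inter_restrict)
        moreover have "{..<m} \<inter> X = X" by (auto simp: X_def)
        ultimately show ?thesis by simp
      qed
      then show ?thesis by (simp add: sum_subtractf sum_distrib_left[symmetric])
    qed
    also have "\<dots> \<le> (\<Sum>l<m. char_avg (twist (\<psi> l) \<phi>s) g)" using c by (intro sum_mono) auto
    finally have "1 - \<epsilon> \<le> (\<Sum>l<m. char_avg (twist (\<psi> l) \<phi>s) g) / m" using m(1) by (simp add: field_simps)
    then show "1 - \<epsilon> \<le> char_avg \<phi>s' (box_vec M e a - box_vec M e b - h)"
      unfolding \<phi>s'_def char_avg_twists[OF m(1)] g_def .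
  qed
qed

section \<open>Recurrence along boxes and Bohr neighbourhoods\<close>

text \<open>
  Unlike recurrence for all sets of positive measure, recurrence for sets of measure at least \<open>\<delta>\<close> is
  inherited by a suitable finite subset if the group is countable.
\<close>

definition recurrent_at :: "real \<Rightarrow> 'g::ab_group_add set \<Rightarrow> bool" where
  "recurrent_at \<delta> R \<longleftrightarrow> (\<forall>(M :: ('g \<Rightarrow> bool) measure) T D. G_system M T \<longrightarrow> D \<in> sets M \<longrightarrow>
     measure M D \<ge> \<delta> \<longrightarrow> (\<exists>g\<in>R. measure M (D \<inter> T g ` D) > 0))"

lemma recurrent_at_all_types:
  fixes R :: "'g::ab_group_add set" and M :: "'x measure"
  assumes "recurrent_at \<delta> R" "G_system M T" "D \<in> sets M" "measure M D \<ge> \<delta>"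
  shows "\<exists>g\<in>R. measure M (D \<inter> T g ` D) > 0"
proof -
  obtain N :: "('g \<Rightarrow> bool) measure" and U E where
    "G_system N U" "E \<in> sets N" "measure N E = measure M D"
      "\<forall>g. measure N (E \<inter> U g ` E) = measure M (D \<inter> T g ` D)"
      "weak_mixing M T \<longrightarrow> weak_mixing N U"
    by (rule symbolic_factor[OF assms(2,3)])
  then show ?thesis using assms(1,4) unfolding recurrent_at_def by metis
qed

lemma G_systemD:
  assumes "G_system M T"
  shows "prob_space M" "T g \<in> measurable M M" "x \<in> space M \<Longrightarrow> T 0 x = x"
    "x \<in> space M \<Longrightarrow> T (g + h) x = T g (T h x)" "x \<in> space M \<Longrightarrow> T g x \<in> space M"
    "x \<in> space M \<Longrightarrow> T (- g) (T g x) = x"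
    "D \<in> sets M \<Longrightarrow> measure M (T g ` D) = measure M D"
proof -
  show 1: "T g \<in> measurable M M" and 2: "x \<in> space M \<Longrightarrow> T 0 x = x"
    and 3: "x \<in> space M \<Longrightarrow> T (g + h) x = T g (T h x)" for g h x
    using assms by (simp_all add: G_system_def)
  show "x \<in> space M \<Longrightarrow> T g x \<in> space M" using measurable_space[OF 1] .
  show "x \<in> space M \<Longrightarrow> T (- g) (T g x) = x" using 3[of x "- g" g] 2 by simp
qed (use assms in \<open>auto simp: G_system_def\<close>)

lemma G_system_pair:
  assumes M: "G_system M T" and N: "G_system N U"
  shows "G_system (M \<Otimes>\<^sub>M N) (\<lambda>g. map_prod (T g) (U g))"
proof (rule G_systemI)
  interpret M: prob_space M using M by (rule G_systemD)
  interpret N: prob_space N using N by (rule G_systemD)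
  interpret P: pair_prob_space M N ..
  show "prob_space (M \<Otimes>\<^sub>M N)" by (rule P.prob_space_axioms)
  have [measurable]: "T g \<in> measurable M M" "U g \<in> measurable N N" for g
    using M N by (simp_all add: G_system_def)
  fix g
  show "map_prod (T g) (U g) \<in> measurable (M \<Otimes>\<^sub>M N) (M \<Otimes>\<^sub>M N)"
    unfolding map_prod_def by measurable
  have "sigma_finite_measure (distr N N (U g))"
    by (simp add: G_system_distr[OF N] N.sigma_finite_measure_axioms)
  then have "distr M M (T g) \<Otimes>\<^sub>M distr N N (U g)
      = distr (M \<Otimes>\<^sub>M N) (M \<Otimes>\<^sub>M N) (\<lambda>(x, y). (T g x, U g y))"
    by (intro pair_measure_distr) auto
  then show "distr (M \<Otimes>\<^sub>M N) (M \<Otimes>\<^sub>M N) (map_prod (T g) (U g)) = M \<Otimes>\<^sub>M N"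
    by (simp add: G_system_distr[OF M] G_system_distr[OF N] map_prod_def)
qed (use M N in \<open>auto simp: G_system_def space_pair_measure\<close>)

definition circle :: "complex measure" where
  "circle = distr (uniform_measure lborel {0..<1::real}) borel (\<lambda>x. cis (2 * pi * x))"

lemma measurable_cis_2pi [measurable]: "(\<lambda>x. cis (2 * pi * x)) \<in> borel_measurable borel"
  by (intro borel_measurable_continuous_onI continuous_intros)

lemma emeasure_circle:
  assumes "A \<in> sets borel"
  shows "emeasure circle A = emeasure lborel {x\<in>{0..<1}. cis (2 * pi * x) \<in> A}"
proof -
  have "emeasure circle A = emeasure (uniform_measure lborel {0..<1::real}) {x. cis (2 * pi * x) \<in> A}"
    unfolding circle_def by (subst emeasure_distr) (use assms in \<open>auto simp: vimage_def\<close>)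
  also have "\<dots> = emeasure lborel ({0..<1::real} \<inter> {x. cis (2 * pi * x) \<in> A}) / emeasure lborel {0..<1::real}"
    by (rule emeasure_uniform_measure) (use measurable_sets_borel[OF measurable_cis_2pi assms] in \<open>auto simp: vimage_def\<close>)
  also have "\<dots> = emeasure lborel {x\<in>{0..<1}. cis (2 * pi * x) \<in> A}"
    by (simp add: Int_def divide_ennreal_def)
  finally show ?thesis .
qed

lemma prob_space_circle: "prob_space circle"
  unfolding circle_def
  by (intro prob_space.prob_space_distr prob_space_uniform_measure) auto

lemma emeasure_lborel_translate:
  fixes S :: "real set"
  assumes "S \<in> sets borel"
  shows "emeasure lborel {x. c + x \<in> S} = emeasure lborel S"
proof -
  have "emeasure lborel S = emeasure (distr lborel borel ((+) c)) S" by (simp add: lborel_distr_plus)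
  also have "\<dots> = emeasure lborel {x. c + x \<in> S}" using assms by (subst emeasure_distr) (auto simp: vimage_def)
  finally show ?thesis by simp
qed

text \<open>
  Rotation by \<open>cis (2 * pi * a)\<close> translates the parameter interval \<open>[0, 1)\<close> to \<open>[a, a + 1)\<close>, and the
  part beyond \<open>1\<close> is moved back by periodicity.
\<close>

lemma circle_rotation:
  assumes "norm w = 1"
  shows "distr circle circle ((*) w) = circle"
proof (rule measure_eqI)
  fix A assume "A \<in> sets (distr circle circle ((*) w))"
  then have A: "A \<in> sets borel" by (simp add: circle_def)
  have wA: "{z. w * z \<in> A} \<in> sets borel"
  proof -
    have "(*) w \<in> borel_measurable borel" by measurable
    from measurable_sets_borel[OF this A] show ?thesis by (simp add: vimage_def)
  qed
  obtain t where t: "w = cis t" "0 \<le> t" "t < 2 * pi" using assms by (rule unit_complex_cis)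
  define a where "a = t / (2 * pi)"
  have a: "0 \<le> a" "a < 1" "w = cis (2 * pi * a)" using t by (auto simp: a_def)
  define B where "B = {x. cis (2 * pi * x) \<in> A}"
  have B: "B \<in> sets borel" using measurable_sets_borel[OF measurable_cis_2pi A] by (simp add: B_def vimage_def)
  have per: "1 + x \<in> B \<longleftrightarrow> x \<in> B" for x
  proof -
    have "cis (2 * pi * (1 + x)) = cis (2 * pi) * cis (2 * pi * x)" by (simp add: cis_mult algebra_simps)
    then show ?thesis by (simp add: B_def)
  qed
  have "emeasure (distr circle circle ((*) w)) A = emeasure circle {z. w * z \<in> A}"
    by (subst emeasure_distr) (use A in \<open>auto simp: circle_def vimage_def\<close>)
  also have "\<dots> = emeasure lborel {x\<in>{0..<1}. a + x \<in> B}"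
    unfolding emeasure_circle[OF wA] by (simp add: B_def a(3) cis_mult distrib_left)
  also have "{x\<in>{0..<1}. a + x \<in> B} = {x. a + x \<in> {a..<a+1} \<inter> B}" by auto
  also have "emeasure lborel \<dots> = emeasure lborel ({a..<a+1} \<inter> B)"
    by (rule emeasure_lborel_translate) (use B in auto)
  also have "{a..<a+1} \<inter> B = ({a..<1} \<inter> B) \<union> ({1..<1+a} \<inter> B)" using a by auto
  also have "emeasure lborel \<dots> = emeasure lborel ({a..<1} \<inter> B) + emeasure lborel ({1..<1+a} \<inter> B)"
    by (rule plus_emeasure[symmetric]) (use B in auto)
  also have "emeasure lborel ({1..<1+a} \<inter> B) = emeasure lborel {x. 1 + x \<in> {1..<1+a} \<inter> B}"
    by (rule emeasure_lborel_translate[symmetric]) (use B in auto)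
  also have "{x. 1 + x \<in> {1..<1+a} \<inter> B} = {0..<a} \<inter> B" using per by auto
  also have "emeasure lborel ({a..<1} \<inter> B) + emeasure lborel ({0..<a} \<inter> B) = emeasure lborel (({a..<1} \<inter> B) \<union> ({0..<a} \<inter> B))"
    by (rule plus_emeasure) (use B in auto)
  also have "({a..<1} \<inter> B) \<union> ({0..<a} \<inter> B) = {x\<in>{0..<1}. cis (2 * pi * x) \<in> A}" using a by (auto simp: B_def)
  finally show "emeasure (distr circle circle ((*) w)) A = emeasure circle A"
    by (simp add: emeasure_circle[OF A])
qed simp

lemma G_system_circle:
  assumes \<xi>: "character \<xi>"
  shows "G_system circle (\<lambda>g. (*) (\<xi> g))"
proof (rule G_systemI)
  show "(*) (\<xi> g) \<in> measurable circle circle" for g by (simp add: circle_def)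
  show "distr circle circle ((*) (\<xi> g)) = circle" for g
    by (rule circle_rotation) (rule characterD(4)[OF \<xi>])
qed (auto simp: prob_space_circle characterD[OF \<xi>])

lemma circle_ball_pos:
  assumes "\<epsilon> > 0"
  shows "measure circle (ball 1 \<epsilon>) > 0"
proof -
  interpret prob_space circle by (rule prob_space_circle)
  define c where "c = min 1 (\<epsilon> / (2 * pi))"
  have c: "0 < c" "c \<le> 1" "2 * pi * c \<le> \<epsilon>" using assms by (auto simp: c_def min_def field_simps)
  have sub: "{0..<c} \<subseteq> {x\<in>{0..<1}. cis (2 * pi * x) \<in> ball 1 \<epsilon>}"
  proof
    fix x assume x: "x \<in> {0..<c}"
    have "norm (cis 0 - cis (2 * pi * x)) \<le> \<bar>0 - 2 * pi * x\<bar>" by (rule norm_cis_diff_le)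
    also have "\<dots> = 2 * pi * x" using x by simp
    also have "\<dots> < 2 * pi * c" using x by simp
    finally show "x \<in> {x\<in>{0..<1}. cis (2 * pi * x) \<in> ball 1 \<epsilon>}" using x c by (simp add: dist_norm)
  qed
  have "{x. cis (2 * pi * x) \<in> ball 1 \<epsilon>} \<in> sets borel"
    using measurable_sets_borel[OF measurable_cis_2pi, of "ball 1 \<epsilon>"] by (simp add: vimage_def)
  then have m: "{x\<in>{0..<1}. cis (2 * pi * x) \<in> ball 1 \<epsilon>} \<in> sets borel"
    by (simp add: Collect_conj_eq atLeastLessThan_def[symmetric])
  have "0 < emeasure lborel {0..<c}" using c by simp
  also have "\<dots> \<le> emeasure circle (ball 1 \<epsilon>)"
    unfolding emeasure_circle[OF borel_open[OF open_ball]]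
    by (rule emeasure_mono[OF sub]) (use m in simp)
  finally show ?thesis by (simp add: emeasure_eq_measure)
qed

text \<open>
  Recurrence is applied to the product with the rotation of the circle by \<open>\<xi>\<close>. A return of \<open>D \<times> U\<close>,
  with \<open>U\<close> a small disc about \<open>1\<close>, happens at a time \<open>g\<close> for which \<open>\<xi> g\<close> moves a point of \<open>U\<close> into
  \<open>U\<close>.
\<close>

lemma recurrence_inter_character:
  fixes R :: "'g::ab_group_add set"
  assumes R: "set_of_recurrence R" and \<xi>: "character \<xi>" and \<epsilon>: "\<epsilon> > 0"
  shows "set_of_recurrence {g\<in>R. norm (\<xi> g - 1) < \<epsilon>}"
  unfolding set_of_recurrence_def recurrence_on_def
proof (intro allI impI)
  fix M :: "('g \<Rightarrow> bool) measure" and T :: "'g \<Rightarrow> ('g \<Rightarrow> bool) \<Rightarrow> 'g \<Rightarrow> bool" and D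
  assume M: "G_system M T" and D: "D \<in> sets M" and pos: "measure M D > 0"
  define U where "U = ball (1::complex) (\<epsilon> / 2)"
  have U: "U \<in> sets circle" by (simp add: U_def circle_def)
  interpret M: prob_space M using M by (rule G_systemD)
  interpret C: prob_space circle by (rule prob_space_circle)
  interpret P: pair_prob_space M circle ..
  have rect: "measure (M \<Otimes>\<^sub>M circle) (A \<times> B) = measure M A * measure circle B"
    if "A \<in> sets M" "B \<in> sets circle" for A B
    using that by (simp add: measure_def C.emeasure_pair_measure_Times enn2real_mult)
  let ?T = "\<lambda>g :: 'g. map_prod (T g) ((*) (\<xi> g))"
  have S: "G_system (M \<Otimes>\<^sub>M circle) ?T" by (rule G_system_pair[OF M G_system_circle[OF \<xi>]])
  have "measure (M \<Otimes>\<^sub>M circle) (D \<times> U) > 0"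
    unfolding rect[OF D U] using pos circle_ball_pos[of "\<epsilon> / 2"] \<epsilon> by (simp add: U_def)
  moreover have "D \<times> U \<in> sets (M \<Otimes>\<^sub>M circle)" using D U by (rule pair_measureI)
  moreover have "recurrence_on TYPE(('g \<Rightarrow> bool) \<times> complex) R" using R by (rule set_of_recurrence_all_types)
  ultimately obtain g where g: "g \<in> R" "measure (M \<Otimes>\<^sub>M circle) ((D \<times> U) \<inter> ?T g ` (D \<times> U)) > 0"
    using S unfolding recurrence_on_def by blast
  have im: "(D \<times> U) \<inter> ?T g ` (D \<times> U) = (D \<inter> T g ` D) \<times> (U \<inter> (*) (\<xi> g) ` U)" by auto
  have TD: "T g ` D \<in> sets M" by (rule G_system_image[OF M D])
  have TU: "(*) (\<xi> g) ` U \<in> sets circle" by (rule G_system_image[OF G_system_circle[OF \<xi>] U])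
  have "measure M (D \<inter> T g ` D) * measure circle (U \<inter> (*) (\<xi> g) ` U) > 0"
    using g(2) rect[of "D \<inter> T g ` D" "U \<inter> (*) (\<xi> g) ` U"] D U TD TU unfolding im by auto
  then have p: "measure M (D \<inter> T g ` D) > 0" "measure circle (U \<inter> (*) (\<xi> g) ` U) > 0"
    using measure_nonneg[of M "D \<inter> T g ` D"] measure_nonneg[of circle "U \<inter> (*) (\<xi> g) ` U"]
    unfolding zero_less_mult_iff by linarith+
  then have "U \<inter> (*) (\<xi> g) ` U \<noteq> {}" by auto
  then obtain z where z: "z \<in> U" "\<xi> g * z \<in> U" by auto
  have "norm (\<xi> g - 1) \<le> norm (\<xi> g - \<xi> g * z) + norm (\<xi> g * z - 1)"
    using norm_triangle_ineq[of "\<xi> g - \<xi> g * z" "\<xi> g * z - 1"] by simp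
  also have "\<xi> g - \<xi> g * z = \<xi> g * (1 - z)" by (simp add: algebra_simps)
  also have "norm \<dots> = norm (1 - z)" by (simp add: norm_mult characterD(4)[OF \<xi>])
  also have "norm (1 - z) + norm (\<xi> g * z - 1) < \<epsilon>"
    using z by (simp add: U_def dist_norm norm_minus_commute)
  finally show "\<exists>g\<in>{g \<in> R. norm (\<xi> g - 1) < \<epsilon>}. measure M (D \<inter> T g ` D) > 0" using g p by blast
qed

lemma recurrence_inter_bohr:
  fixes R :: "'g::ab_group_add set"
  assumes R: "set_of_recurrence R" and "finite \<Psi>" and \<epsilon>: "\<epsilon> > 0" and "\<And>\<xi>. \<xi> \<in> \<Psi> \<Longrightarrow> character \<xi>"
  shows "set_of_recurrence {g\<in>R. \<forall>\<xi>\<in>\<Psi>. norm (\<xi> g - 1) < \<epsilon>}"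
  using assms(2,4)
proof induction
  case (insert \<xi> \<Psi>)
  have "set_of_recurrence {g\<in>{g\<in>R. \<forall>\<xi>\<in>\<Psi>. norm (\<xi> g - 1) < \<epsilon>}. norm (\<xi> g - 1) < \<epsilon>}"
    by (rule recurrence_inter_character) (use insert \<epsilon> in auto)
  moreover have "{g\<in>{g\<in>R. \<forall>\<xi>\<in>\<Psi>. norm (\<xi> g - 1) < \<epsilon>}. norm (\<xi> g - 1) < \<epsilon>}
     = {g\<in>R. \<forall>\<xi>\<in>insert \<xi> \<Psi>. norm (\<xi> g - 1) < \<epsilon>}" by auto
  ultimately show ?case by simp
qed (use R in simp)

text \<open>
  The set \<open>E = D \<inter> T (b + h) ` D\<close> has positive measure and \<open>S - b\<close> is a set of recurrence, even
  within a Bohr neighbourhood of \<open>0\<close>. A return of \<open>E\<close> after time \<open>s - b\<close> is a return of \<open>D\<close> after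
  time \<open>(s - b) + (b + h) = s + h\<close>.
\<close>

lemma recurrence_near:
  fixes S :: "'g::ab_group_add set" and M :: "'x measure"
  assumes S: "measure_expanding S" and \<Psi>: "finite \<Psi>" "\<And>\<xi>. \<xi> \<in> \<Psi> \<Longrightarrow> character \<xi>" and \<epsilon>: "\<epsilon> > 0"
    and M: "G_system M T" and D: "D \<in> sets M" and pos: "measure M (D \<inter> T (b + h) ` D) > 0"
  shows "\<exists>s\<in>S. (\<forall>\<xi>\<in>\<Psi>. norm (\<xi> (s - b) - 1) < \<epsilon>) \<and> measure M (D \<inter> T (s + h) ` D) > 0"
proof -
  interpret M: prob_space M using M by (rule G_systemD)
  have Dsp: "D \<subseteq> space M" using D by (rule sets.sets_into_space)
  define E where "E = D \<inter> T (b + h) ` D"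
  have E: "E \<in> sets M" using D G_system_image(2)[OF M D] by (auto simp: E_def)
  have "set_of_recurrence (translate S (- b))" using S by (simp add: measure_expanding_def)
  from recurrence_inter_bohr[OF this \<Psi>(1) \<epsilon> \<Psi>(2)]
  have "recurrence_on TYPE('x) {g\<in>translate S (- b). \<forall>\<xi>\<in>\<Psi>. norm (\<xi> g - 1) < \<epsilon>}"
    by (intro set_of_recurrence_all_types) blast
  then obtain t where t: "t \<in> translate S (- b)" "\<forall>\<xi>\<in>\<Psi>. norm (\<xi> t - 1) < \<epsilon>" "measure M (E \<inter> T t ` E) > 0"
    using M E pos unfolding recurrence_on_def E_def by blast
  obtain s where s: "s \<in> S" "t = s - b" using t(1) by (auto simp: translate_def)
  have sub: "E \<inter> T t ` E \<subseteq> D \<inter> T (s + h) ` D"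
  proof
    fix x assume "x \<in> E \<inter> T t ` E"
    then obtain y where "x \<in> D" "y \<in> D" "x = T t (T (b + h) y)" by (auto simp: E_def)
    moreover have "T (t + (b + h)) y = T t (T (b + h) y)" using M Dsp \<open>y \<in> D\<close> by (intro G_systemD(4)) auto
    moreover have "t + (b + h) = s + h" by (simp add: s)
    ultimately show "x \<in> D \<inter> T (s + h) ` D" by (metis IntI imageI)
  qed
  have "measure M (E \<inter> T t ` E) \<le> measure M (D \<inter> T (s + h) ` D)"
    by (rule M.finite_measure_mono[OF sub]) (use D G_system_image(2)[OF M D] in auto)
  then show ?thesis using t s by (intro bexI[of _ s]) auto
qed

text \<open>
  Were all intersections \<open>D \<inter> T (b + h) ` D\<close> with good \<open>b\<close> null, one could remove them from \<open>D\<close>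
  without loss of measure. The mean proportion of \<open>a\<close> in the box with \<open>T (\<Sum>i. a i e i) x\<close> in what
  remains is at least \<open>\<delta>\<close>, so some point \<open>x\<close> attains this proportion, and two of its visits with a
  good difference contradict the removal.
\<close>

lemma box_recurrence:
  fixes M :: "'x measure" and T :: "'g::ab_group_add \<Rightarrow> 'x \<Rightarrow> 'x" and K L :: nat
  assumes cnt: "countable (UNIV :: 'g set)"
    and M: "G_system M T" and D: "D \<in> sets M" and \<delta>: "measure M D \<ge> \<delta>"
    and box: "\<And>A. A \<subseteq> {..<K} \<rightarrow>\<^sub>E {..<L} \<Longrightarrow> \<delta> * real L ^ K \<le> card A \<Longrightarrow>
      \<exists>a\<in>A. \<exists>b\<in>A. good (box_vec K e a - box_vec K e b - h)"
  shows "\<exists>b. good b \<and> measure M (D \<inter> T (b + h) ` D) > 0"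
proof (rule ccontr)
  assume no: "\<not> ?thesis"
  interpret M: prob_space M using M by (rule G_systemD)
  have TD: "T g ` D \<in> sets M" for g by (rule G_system_image[OF M D])
  have null: "measure M (D \<inter> T (b + h) ` D) = 0" if "good b" for b
  proof -
    have "\<not> 0 < measure M (D \<inter> T (b + h) ` D)" using no that by blast
    then show ?thesis using measure_nonneg[of M "D \<inter> T (b + h) ` D"] by linarith
  qed
  define N where "N = (\<Union>b\<in>{b. good b}. D \<inter> T (b + h) ` D)"
  have N: "N \<in> null_sets M" unfolding N_def
  proof (rule null_sets_UN')
    show "countable {b. good b}" by (rule countable_subset[OF _ cnt]) simp
    show "D \<inter> T (b + h) ` D \<in> null_sets M" if "b \<in> {b. good b}" for b
      using null[of b] that D TD by (auto simp: M.emeasure_eq_measure intro!: null_setsI)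
  qed
  define D' where "D' = D - N"
  have D': "D' \<in> sets M" using D N by (auto simp: D'_def)
  have "measure M D' = measure M D"
    unfolding D'_def using D N by (rule measure_Diff_null_set)
  then have mD': "measure M D' \<ge> \<delta>" using \<delta> by simp
  let ?X = "{..<K} \<rightarrow>\<^sub>E {..<L}"
  have finX: "finite ?X" by (intro finite_PiE) auto
  have cardX: "real (card ?X) = real L ^ K" by (simp add: card_PiE)
  define f where "f x = (\<Sum>a\<in>?X. indicator D' (T (box_vec K e a) x) :: real)" for x
  have [measurable]: "T g \<in> measurable M M" for g by (rule G_systemD(2)[OF M])
  have int: "integrable M (\<lambda>x. indicator D' (T g x) :: real)" for g
    by (rule M.integrable_const_bound[of _ 1]) (use D' in auto)
  have E1: "M.expectation (\<lambda>x. indicator D' (T g x) :: real) = measure M D'" for g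
  proof -
    have "measure M D' = (\<integral>x. indicator D' x \<partial>distr M M (T g))"
      using D' by (simp add: G_system_distr[OF M])
    also have "\<dots> = M.expectation (\<lambda>x. indicator D' (T g x) :: real)"
      by (rule integral_distr) (use D' in auto)
    finally show ?thesis by simp
  qed
  have "M.expectation f = (\<Sum>a\<in>?X. measure M D')"
    unfolding f_def by (subst Bochner_Integration.integral_sum) (auto simp: int E1)
  also have "\<dots> = real L ^ K * measure M D'" using cardX by simp
  also have "\<dots> \<ge> real L ^ K * \<delta>" using mD' by (intro mult_left_mono) auto
  finally have Ef: "M.expectation f \<ge> \<delta> * real L ^ K" by (simp add: mult.commute)
  have intf: "integrable M f" unfolding f_def by (intro Bochner_Integration.integrable_sum int)
  have "\<exists>x\<in>space M. f x \<ge> \<delta> * real L ^ K"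
  proof (rule ccontr)
    assume "\<not> ?thesis"
    then have "AE x in M. f x < \<delta> * real L ^ K" by (intro AE_I2) force
    from M.expectation_less[OF intf this] Ef show False by simp
  qed
  then obtain x where x: "x \<in> space M" "f x \<ge> \<delta> * real L ^ K" by blast
  define A where "A = {a\<in>?X. T (box_vec K e a) x \<in> D'}"
  have "f x = (\<Sum>a\<in>?X. if T (box_vec K e a) x \<in> D' then 1 else 0)"
    unfolding f_def by (intro sum.cong) (auto simp: indicator_def)
  also have "\<dots> = card A" unfolding A_def using finX by (simp add: sum.If_cases Int_def)
  finally have "\<delta> * real L ^ K \<le> card A" using x(2) by simp
  moreover have "A \<subseteq> ?X" by (auto simp: A_def)
  ultimately obtain a b where ab: "a \<in> A" "b \<in> A" "good (box_vec K e a - box_vec K e b - h)"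
    using box by blast
  define c where "c = box_vec K e a - box_vec K e b - h"
  define y where "y = T (box_vec K e b) x"
  have "T (box_vec K e a) x = T ((c + h) + box_vec K e b) x" by (simp add: c_def)
  also have "\<dots> = T (c + h) y" unfolding y_def by (rule G_systemD(4)[OF M x(1)])
  finally have eq: "T (box_vec K e a) x = T (c + h) y" .
  have "y \<in> D" using ab(2) by (simp add: A_def D'_def y_def)
  moreover have "T (c + h) y \<in> D" "T (c + h) y \<notin> N" using ab(1) by (auto simp: A_def D'_def eq)
  moreover have "good c" using ab(3) by (simp add: c_def)
  ultimately show False by (auto simp: N_def)
qed

section \<open>Compactness of recurrence\<close>

text \<open>
  The number \<open>p J K\<close> is to be the probability that a random subset of the group meets \<open>J\<close> exactly in
  \<open>K\<close>. A consistent and translation invariant family of such numbers is realized by a stationary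
  process with values \<open>0\<close> and \<open>1\<close>.
\<close>

context
  fixes p :: "'g::ab_group_add set \<Rightarrow> 'g set \<Rightarrow> real"
  assumes p_nonneg: "\<And>J K. p J K \<ge> 0"
    and p_empty: "p {} {} = 1"
    and p_refine: "\<And>H J K. finite H \<Longrightarrow> J \<subseteq> H \<Longrightarrow> K \<subseteq> J \<Longrightarrow> p J K = (\<Sum>K'\<in>{K'\<in>Pow H. K' \<inter> J = K}. p H K')"
    and p_shift: "\<And>J K h. finite J \<Longrightarrow> K \<subseteq> J \<Longrightarrow> p ((\<lambda>g. g + h) ` J) ((\<lambda>g. g + h) ` K) = p J K"
begin

definition char_fun :: "'g set \<Rightarrow> 'g set \<Rightarrow> 'g \<Rightarrow> real" where
  "char_fun J K = (\<lambda>g\<in>J. if g \<in> K then 1 else 0)"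

definition marginal :: "'g set \<Rightarrow> ('g \<Rightarrow> real) measure" where
  "marginal J = distr (point_measure (Pow J) (\<lambda>K. ennreal (p J K))) (PiM J (\<lambda>_. borel)) (char_fun J)"

lemma char_fun_measurable: "char_fun J \<in> point_measure (Pow J) f \<rightarrow>\<^sub>M PiM J (\<lambda>_. borel)"
  by (auto simp: char_fun_def space_PiM PiE_iff extensional_def)

lemma emeasure_marginal:
  assumes J: "finite J" and A: "A \<in> sets (PiM J (\<lambda>_. borel))"
  shows "emeasure (marginal J) A = ennreal (\<Sum>K\<in>{K\<in>Pow J. char_fun J K \<in> A}. p J K)"
proof -
  have "emeasure (marginal J) A = emeasure (point_measure (Pow J) (\<lambda>K. ennreal (p J K))) {K\<in>Pow J. char_fun J K \<in> A}"
    unfolding marginal_def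
    by (subst emeasure_distr[OF char_fun_measurable A]) (auto simp: space_point_measure intro!: arg_cong2[where f=emeasure])
  also have "\<dots> = (\<Sum>K\<in>{K\<in>Pow J. char_fun J K \<in> A}. ennreal (p J K))"
    by (rule emeasure_point_measure_finite) (use J in auto)
  also have "\<dots> = ennreal (\<Sum>K\<in>{K\<in>Pow J. char_fun J K \<in> A}. p J K)"
    by (rule sum_ennreal) (rule p_nonneg)
  finally show ?thesis .
qed

lemma sets_marginal: "sets (marginal J) = sets (PiM J (\<lambda>_. borel))"
  by (simp add: marginal_def)

lemma p_total: "finite J \<Longrightarrow> (\<Sum>K\<in>Pow J. p J K) = 1"
  using p_refine[of J "{}" "{}"] p_empty by (simp add: Pow_def)

lemma polish_projective_marginal: "polish_projective UNIV marginal"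
proof (intro polish_projective.intro projective_family.intro)
  fix J H :: "'g set" assume JH: "J \<subseteq> H" and H: "finite H"
  have J: "finite J" using JH H finite_subset by blast
  show "marginal J = distr (marginal H) (PiM J (\<lambda>_. borel)) (\<lambda>f. restrict f J)"
  proof (rule measure_eqI)
    show "sets (marginal J) = sets (distr (marginal H) (PiM J (\<lambda>_. borel)) (\<lambda>f. restrict f J))"
      by (simp add: sets_marginal)
    fix A assume "A \<in> sets (marginal J)"
    then have A: "A \<in> sets (PiM J (\<lambda>_. borel))" by (simp add: sets_marginal)
    have m: "(\<lambda>f. restrict f J) \<in> PiM H (\<lambda>_. borel) \<rightarrow>\<^sub>M PiM J (\<lambda>_. borel :: real measure)"
      by (rule measurable_restrict_subset[OF JH])
    have m': "(\<lambda>f. restrict f J) \<in> marginal H \<rightarrow>\<^sub>M PiM J (\<lambda>_. borel)"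
      using m by (simp add: measurable_cong_sets[OF sets_marginal refl])
    define A' where "A' = (\<lambda>f. restrict f J) -` A \<inter> space (PiM H (\<lambda>_. borel :: real measure))"
    have A': "A' \<in> sets (PiM H (\<lambda>_. borel))" unfolding A'_def using m A by (rule measurable_sets)
    have rc: "restrict (char_fun H K') J = char_fun J (K' \<inter> J)" for K'
      using JH by (auto simp: char_fun_def fun_eq_iff)
    have eA': "char_fun H K' \<in> A' \<longleftrightarrow> char_fun J (K' \<inter> J) \<in> A" for K'
    proof -
      have "char_fun H K' \<in> space (PiM H (\<lambda>_. borel))"
        by (auto simp: char_fun_def space_PiM PiE_iff extensional_def)
      then show ?thesis by (simp add: A'_def rc)
    qed
    have "emeasure (distr (marginal H) (PiM J (\<lambda>_. borel)) (\<lambda>f. restrict f J)) A = emeasure (marginal H) A'"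
      unfolding emeasure_distr[OF m' A] A'_def
      by (simp add: sets_eq_imp_space_eq[OF sets_marginal])
    also have "\<dots> = ennreal (\<Sum>K'\<in>{K'\<in>Pow H. char_fun J (K' \<inter> J) \<in> A}. p H K')"
      unfolding emeasure_marginal[OF H A'] eA' ..
    also have "(\<Sum>K'\<in>{K'\<in>Pow H. char_fun J (K' \<inter> J) \<in> A}. p H K')
        = (\<Sum>K\<in>{K\<in>Pow J. char_fun J K \<in> A}. \<Sum>K'\<in>{K'\<in>{K'\<in>Pow H. char_fun J (K' \<inter> J) \<in> A}. K' \<inter> J = K}. p H K')"
      by (rule sum.group[symmetric]) (use H J in auto)
    also have "\<dots> = (\<Sum>K\<in>{K\<in>Pow J. char_fun J K \<in> A}. p J K)"
    proof (rule sum.cong[OF refl])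
      fix K assume K: "K \<in> {K\<in>Pow J. char_fun J K \<in> A}"
      then have "{K'\<in>{K'\<in>Pow H. char_fun J (K' \<inter> J) \<in> A}. K' \<inter> J = K} = {K'\<in>Pow H. K' \<inter> J = K}" by auto
      then show "(\<Sum>K'\<in>{K'\<in>{K'\<in>Pow H. char_fun J (K' \<inter> J) \<in> A}. K' \<inter> J = K}. p H K') = p J K"
        using p_refine[OF H JH, of K] K by simp
    qed
    finally show "emeasure (marginal J) A = emeasure (distr (marginal H) (PiM J (\<lambda>_. borel)) (\<lambda>f. restrict f J)) A"
      unfolding emeasure_marginal[OF J A] by (rule sym)
  qed
next
  fix J :: "'g set" assume J: "finite J"
  show "prob_space (marginal J)"
  proof
    have s: "space (marginal J) = space (PiM J (\<lambda>_. borel))" by (rule sets_eq_imp_space_eq[OF sets_marginal])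
    have "{K\<in>Pow J. char_fun J K \<in> space (PiM J (\<lambda>_. borel))} = Pow J"
      by (auto simp: char_fun_def space_PiM PiE_iff extensional_def)
    then show "emeasure (marginal J) (space (marginal J)) = 1"
      unfolding s emeasure_marginal[OF J sets.top] by (simp add: p_total[OF J])
  qed
qed

text \<open>
  Kolmogorov's extension theorem provides the process, whose shift invariance is checked on
  cylinders. The set \<open>D\<close> is the event that \<open>0\<close> belongs to the random set; its image under the shift
  by \<open>g\<close> is the event that \<open>- g\<close> does.
\<close>

lemma stationary_process_exists:
  "\<exists>(N :: ('g \<Rightarrow> real) measure) U D. G_system N U \<and> D \<in> sets N \<and> measure N D = p {0} {0} \<and>
     (\<forall>g. measure N (D \<inter> U g ` D) = p {0, -g} {0, -g})"
proof -
  interpret polish_projective UNIV marginal by (rule polish_projective_marginal)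
  define U where "U h w g = w (g + h)" for h g :: 'g and w :: "'g \<Rightarrow> real"
  have sp: "space lim = UNIV" by (auto simp: space_PiM)
  have sts: "sets lim = sets (PiM UNIV (\<lambda>_. borel))" by simp
  have embeq: "emb UNIV J X = {w. restrict w J \<in> X}" for J and X :: "('g \<Rightarrow> real) set"
    by (auto simp: prod_emb_def space_PiM)
  have Um: "U h \<in> measurable lim lim" for h
  proof -
    have "U h \<in> PiM UNIV (\<lambda>_. borel) \<rightarrow>\<^sub>M PiM UNIV (\<lambda>_. borel)"
      unfolding U_def by (rule measurable_PiM_single') (auto simp: space_PiM)
    then show ?thesis by (simp add: measurable_cong_sets[OF sts sts])
  qed
  have G: "G_system lim U"
  proof (rule G_systemI)
    show "prob_space lim" by (rule P.prob_space_axioms)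
    fix h
    show "distr lim lim (U h) = lim"
    proof (rule measure_eqI_PiM_infinite)
      show "sets (distr lim lim (U h)) = sets (PiM UNIV (\<lambda>_. borel))" by simp
      show "sets lim = sets (PiM UNIV (\<lambda>_. borel))" by simp
      show "finite_measure (distr lim lim (U h))"
        by (intro prob_space.finite_measure P.prob_space_distr Um)
      fix A :: "'g \<Rightarrow> real set" and J :: "'g set"
      assume J: "finite J" and A: "\<And>i. i \<in> J \<Longrightarrow> A i \<in> sets borel"
      define J' where "J' = (\<lambda>g. g + h) ` J"
      have J': "finite J'" using J by (simp add: J'_def)
      have X: "PiE J A \<in> sets (PiM J (\<lambda>_. borel))" using J A by (intro sets_PiM_I_finite) auto
      have X': "PiE J' (\<lambda>g. A (g - h)) \<in> sets (PiM J' (\<lambda>_. borel))"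
        using J' A by (intro sets_PiM_I_finite) (auto simp: J'_def)
      have pre: "U h -` emb UNIV J (PiE J A) \<inter> space lim = emb UNIV J' (PiE J' (\<lambda>g. A (g - h)))"
        by (auto simp: embeq sp J'_def PiE_iff U_def space_PiM)
      have E: "emb UNIV J (PiE J A) \<in> sets lim" using J X by auto
      have cf: "char_fun J' ((\<lambda>g. g + h) ` K) \<in> PiE J' (\<lambda>g. A (g - h)) \<longleftrightarrow> char_fun J K \<in> PiE J A" if "K \<subseteq> J" for K
        using that by (auto simp: char_fun_def PiE_iff J'_def)
      have "emeasure (distr lim lim (U h)) (emb UNIV J (PiE J A)) = emeasure lim (emb UNIV J' (PiE J' (\<lambda>g. A (g - h))))"
        by (subst emeasure_distr[OF Um E]) (simp only: pre)
      also have "\<dots> = ennreal (\<Sum>K'\<in>{K'\<in>Pow J'. char_fun J' K' \<in> PiE J' (\<lambda>g. A (g - h))}. p J' K')"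
        unfolding emeasure_lim_emb[OF subset_UNIV J' X'] by (rule emeasure_marginal[OF J' X'])
      also have "(\<Sum>K'\<in>{K'\<in>Pow J'. char_fun J' K' \<in> PiE J' (\<lambda>g. A (g - h))}. p J' K')
          = (\<Sum>K\<in>{K\<in>Pow J. char_fun J K \<in> PiE J A}. p J' ((\<lambda>g. g + h) ` K))"
      proof (rule sum.reindex_cong[where l = "image (\<lambda>g. g + h)"])
        show "inj_on ((`) (\<lambda>g. g + h)) {K\<in>Pow J. char_fun J K \<in> PiE J A}"
          by (rule inj_onI) (simp add: inj_image_eq_iff)
        show "{K'\<in>Pow J'. char_fun J' K' \<in> PiE J' (\<lambda>g. A (g - h))} = (`) (\<lambda>g. g + h) ` {K\<in>Pow J. char_fun J K \<in> PiE J A}"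
        proof (intro equalityI subsetI)
          fix K' assume K': "K' \<in> {K'\<in>Pow J'. char_fun J' K' \<in> PiE J' (\<lambda>g. A (g - h))}"
          then obtain K where K: "K \<subseteq> J" "K' = (\<lambda>g. g + h) ` K" unfolding J'_def by (auto simp: subset_image_iff)
          then show "K' \<in> (`) (\<lambda>g. g + h) ` {K\<in>Pow J. char_fun J K \<in> PiE J A}" using K' cf[OF K(1)] by auto
        next
          fix K' assume "K' \<in> (`) (\<lambda>g. g + h) ` {K\<in>Pow J. char_fun J K \<in> PiE J A}"
          then obtain K where K: "K \<subseteq> J" "K' = (\<lambda>g. g + h) ` K" "char_fun J K \<in> PiE J A" by auto
          then show "K' \<in> {K'\<in>Pow J'. char_fun J' K' \<in> PiE J' (\<lambda>g. A (g - h))}" using cf[OF K(1)] by (auto simp: J'_def)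
        qed
      qed simp
      also have "\<dots> = (\<Sum>K\<in>{K\<in>Pow J. char_fun J K \<in> PiE J A}. p J K)"
        using p_shift[OF J] by (intro sum.cong) (auto simp: J'_def)
      also have "ennreal \<dots> = emeasure lim (emb UNIV J (PiE J A))"
        unfolding emeasure_lim_emb[OF subset_UNIV J X] by (rule emeasure_marginal[OF J X, symmetric])
      finally show "emeasure (distr lim lim (U h)) (prod_emb UNIV (\<lambda>_. borel) J (PiE J A)) = emeasure lim (prod_emb UNIV (\<lambda>_. borel) J (PiE J A))" .
    qed
  qed (auto simp: U_def Um add.assoc)
  have cyl: "measure lim {w. \<forall>g\<in>J. w g = 1} = p J J" "{w. \<forall>g\<in>J. w g = 1} \<in> sets lim" if J: "finite J" for J
  proof -
    let ?X = "PiE J (\<lambda>_. {1::real})"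
    have X: "?X \<in> sets (PiM J (\<lambda>_. borel))" using J by (intro sets_PiM_I_finite) auto
    have "restrict w J \<in> ?X \<longleftrightarrow> (\<forall>g\<in>J. w g = 1)" for w unfolding PiE_iff by simp
    then have e: "{w. \<forall>g\<in>J. w g = 1} = emb UNIV J ?X" by (simp only: embeq)
    have "char_fun J K \<in> ?X \<longleftrightarrow> J \<subseteq> K" for K unfolding PiE_iff by (auto simp: char_fun_def)
    then have c: "{K\<in>Pow J. char_fun J K \<in> ?X} = {J}" by auto
    have "emeasure lim (emb UNIV J ?X) = ennreal (p J J)"
      unfolding emeasure_lim_emb[OF subset_UNIV J X] emeasure_marginal[OF J X] c by simp
    then show "measure lim {w. \<forall>g\<in>J. w g = 1} = p J J" using p_nonneg by (simp add: measure_def e)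
    show "{w. \<forall>g\<in>J. w g = 1} \<in> sets lim" unfolding e using J X by auto
  qed
  define D where "D = {w :: 'g \<Rightarrow> real. \<forall>g\<in>{0}. w g = 1}"
  have D: "D \<in> sets lim" unfolding D_def by (rule cyl) simp
  show ?thesis
  proof (rule exI[of _ lim], rule exI[of _ U], rule exI[of _ D], intro conjI allI G D)
    show "measure lim D = p {0} {0}" unfolding D_def by (rule cyl) simp
    fix g
    have "D \<inter> U g ` D = {w. \<forall>k\<in>{0, -g}. w k = 1}"
      unfolding G_system_image(1)[OF G D] by (auto simp: D_def U_def sp space_PiM)
    then show "measure lim (D \<inter> U g ` D) = p {0, -g} {0, -g}" using cyl(1)[of "{0, -g}"] by simp
  qed
qed

end

text \<open>
  If every finite part of \<open>R\<close> failed, there would be systems with sets \<open>D i\<close> of measure at least \<open>\<delta>\<close>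
  that do not return at more and more times in \<open>R\<close>. Along a subsequence, the probabilities of all
  finite patterns of visits to \<open>D i\<close> converge; the limits are the pattern probabilities of a
  stationary process, in which a set of measure at least \<open>\<delta>\<close> never returns at a time in \<open>R\<close>.
\<close>

lemma recurrent_at_finite_subset:
  fixes R :: "'g::ab_group_add set"
  assumes cnt: "countable (UNIV :: 'g set)" and R: "recurrent_at \<delta> R"
  shows "\<exists>R0\<subseteq>R. finite R0 \<and> recurrent_at \<delta> R0"
proof (rule ccontr)
  assume neg: "\<not> ?thesis"
  define en where "en = from_nat_into (UNIV :: 'g set)"
  have en: "\<exists>n. en n = g" for g
    using from_nat_into_surj[OF cnt, of g] by (auto simp: en_def)
  define Rn where "Rn i = R \<inter> en ` {..<i}" for i
  have "\<not> recurrent_at \<delta> (Rn i)" for i using neg by (auto simp: Rn_def)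
  then have "\<exists>(M :: ('g \<Rightarrow> bool) measure) T D. G_system M T \<and> D \<in> sets M \<and> measure M D \<ge> \<delta> \<and>
      (\<forall>g\<in>Rn i. measure M (D \<inter> T g ` D) = 0)" for i
    unfolding recurrent_at_def using measure_nonneg by (metis less_eq_real_def)
  then obtain M :: "nat \<Rightarrow> ('g \<Rightarrow> bool) measure" and T D where
    G: "\<And>i. G_system (M i) (T i)" and D: "\<And>i. D i \<in> sets (M i)" and mD: "\<And>i. measure (M i) (D i) \<ge> \<delta>"
    and null: "\<And>i g. g \<in> Rn i \<Longrightarrow> measure (M i) (D i \<inter> T i g ` D i) = 0" by metis
  define E where "E i J K = {x\<in>space (M i). \<forall>g\<in>J. T i g x \<in> D i \<longleftrightarrow> g \<in> K}" for i J K
  have Tm [measurable]: "T i g \<in> measurable (M i) (M i)" for i g by (rule G_systemD(2)[OF G])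
  have Es: "E i J K \<in> sets (M i)" if "finite J" for i J K
  proof -
    have "E i J K = space (M i) \<inter> (\<Inter>g\<in>J. if g \<in> K then T i g -` D i \<inter> space (M i) else space (M i) - (T i g -` D i \<inter> space (M i)))"
      by (auto simp: E_def split: if_splits)
    also have "\<dots> \<in> sets (M i)"
    proof (cases "J = {}")
      case False
      show ?thesis
        by (intro sets.Int sets.finite_INT that False sets.top)
          (use measurable_sets[OF Tm D] in auto)
    qed simp
    finally show ?thesis .
  qed
  define q where "q i = (\<lambda>(J, K). measure (M i) (E i J K))" for i
  have "countable {J :: 'g set. finite J}"
    using countable_Collect_finite_subset[OF cnt] by simp
  then have cS: "countable ({J :: 'g set. finite J} \<times> {J :: 'g set. finite J})" by auto
  have bound: "norm (q i z) \<le> 1" for i z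
    using prob_space.prob_le_1[OF G_systemD(1)[OF G]] by (auto simp: q_def case_prod_unfold)
  obtain k :: "nat \<Rightarrow> nat" where k: "strict_mono k"
    and cv: "\<And>z. z \<in> {J :: 'g set. finite J} \<times> {J :: 'g set. finite J} \<Longrightarrow> \<exists>l. (\<lambda>n. q (k n) z) \<longlonglongrightarrow> l"
    using function_convergent_subsequence[OF cS, of q 1] bound by blast
  define p where "p J K = (if finite J \<and> finite K then lim (\<lambda>n. q (k n) (J, K)) else 0)" for J K
  have lm: "(\<lambda>n. q (k n) (J, K)) \<longlonglongrightarrow> p J K" if "finite J" "finite K" for J K
    using cv[of "(J, K)"] that by (auto simp: p_def convergent_def convergent_LIMSEQ_iff[symmetric])
  have p0: "p J K \<ge> 0" for J K
  proof (cases "finite J \<and> finite K")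
    case True
    then show ?thesis
      by (intro LIMSEQ_le_const[OF lm]) (auto simp: q_def intro!: exI[of _ 0])
  qed (auto simp: p_def)
  have p1: "p {} {} = 1"
  proof -
    have "q i ({}, {}) = 1" for i
      using prob_space.prob_space[OF G_systemD(1)[OF G[of i]]] by (simp add: q_def E_def)
    then have "(\<lambda>n. q (k n) ({}, {})) \<longlonglongrightarrow> 1" by simp
    then show ?thesis using LIMSEQ_unique lm[of "{}" "{}"] by auto
  qed
  have p2: "p J K = (\<Sum>K'\<in>{K'\<in>Pow H. K' \<inter> J = K}. p H K')" if H: "finite H" and JH: "J \<subseteq> H" and K: "K \<subseteq> J" for H J K
  proof -
    have fin: "finite J" "finite K" using H JH K finite_subset by metis+
    have "q i (J, K) = (\<Sum>K'\<in>{K'\<in>Pow H. K' \<inter> J = K}. q i (H, K'))" for i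
    proof -
      interpret prob_space "M i" by (rule G_systemD(1)[OF G])
      have "E i J K = (\<Union>K'\<in>{K'\<in>Pow H. K' \<inter> J = K}. E i H K')"
      proof (intro equalityI subsetI)
        fix x assume "x \<in> E i J K"
        then show "x \<in> (\<Union>K'\<in>{K'\<in>Pow H. K' \<inter> J = K}. E i H K')"
          using JH K by (intro UN_I[of "{g\<in>H. T i g x \<in> D i}"]) (auto simp: E_def)
      qed (use JH in \<open>auto simp: E_def\<close>)
      moreover have "finite {K'\<in>Pow H. K' \<inter> J = K}" using H by simp
      moreover have "E i H ` {K'\<in>Pow H. K' \<inter> J = K} \<subseteq> events" using Es[OF H] by blast
      moreover have "disjoint_family_on (E i H) {K'\<in>Pow H. K' \<inter> J = K}"
        unfolding disjoint_family_on_def E_def by blast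
      ultimately show ?thesis
        using finite_measure_finite_Union[of "{K'\<in>Pow H. K' \<inter> J = K}" "E i H"]
        by (simp only: q_def prod.case)
    qed
    then have "(\<lambda>n. q (k n) (J, K)) \<longlonglongrightarrow> (\<Sum>K'\<in>{K'\<in>Pow H. K' \<inter> J = K}. p H K')"
      using H by (auto intro!: tendsto_sum lm finite_subset[OF _ H])
    then show ?thesis using LIMSEQ_unique lm[OF fin] by blast
  qed
  have p3: "p ((\<lambda>g. g + h) ` J) ((\<lambda>g. g + h) ` K) = p J K" if J: "finite J" and K: "K \<subseteq> J" for J K h
  proof -
    have fin: "finite J" "finite K" using J K finite_subset by auto
    have "q i ((\<lambda>g. g + h) ` J, (\<lambda>g. g + h) ` K) = q i (J, K)" for i
    proof -
      have "E i ((\<lambda>g. g + h) ` J) ((\<lambda>g. g + h) ` K) = T i h -` E i J K \<inter> space (M i)"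
        using G_systemD(4)[OF G] G_systemD(5)[OF G] by (auto simp: E_def)
      moreover have "measure (M i) (T i h -` E i J K \<inter> space (M i)) = measure (distr (M i) (M i) (T i h)) (E i J K)"
        by (rule measure_distr[symmetric]) (use Es[OF J] Tm in auto)
      ultimately show ?thesis by (simp add: q_def G_system_distr[OF G])
    qed
    then have "(\<lambda>n. q (k n) (J, K)) \<longlonglongrightarrow> p ((\<lambda>g. g + h) ` J) ((\<lambda>g. g + h) ` K)"
      using lm[of "(\<lambda>g. g + h) ` J" "(\<lambda>g. g + h) ` K"] fin by simp
    then show ?thesis using LIMSEQ_unique lm[OF fin] by blast
  qed
  have "\<exists>(N :: ('g \<Rightarrow> real) measure) U B. G_system N U \<and> B \<in> sets N \<and> measure N B = p {0} {0} \<and>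
     (\<forall>g. measure N (B \<inter> U g ` B) = p {0, -g} {0, -g})"
    by (rule stationary_process_exists) (fact p0 p1 p2 p3)+
  then obtain N :: "('g \<Rightarrow> real) measure" and U B where N: "G_system N U" "B \<in> sets N" "measure N B = p {0} {0}"
    "\<And>g. measure N (B \<inter> U g ` B) = p {0, -g} {0, -g}"
    by blast
  have q1: "q i ({0}, {0}) = measure (M i) (D i)" for i
  proof -
    have "E i {0} {0} = D i"
      using G_systemD(3)[OF G[of i]] sets.sets_into_space[OF D[of i]] by (auto simp: E_def)
    then show ?thesis by (simp add: q_def)
  qed
  have q2: "q i ({0, -g}, {0, -g}) = measure (M i) (D i \<inter> T i g ` D i)" for i g
  proof -
    have "E i {0, -g} {0, -g} = D i \<inter> T i g ` D i"
      unfolding G_system_image(1)[OF G D]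
      using G_systemD(3)[OF G[of i]] sets.sets_into_space[OF D[of i]] by (auto simp: E_def)
    then show ?thesis by (simp add: q_def)
  qed
  have "measure N B \<ge> \<delta>" unfolding N(3)
    by (rule LIMSEQ_le_const[OF lm]) (use mD in \<open>auto simp: q1\<close>)
  then obtain g where g: "g \<in> R" "measure N (B \<inter> U g ` B) > 0"
    using recurrent_at_all_types[OF R N(1,2)] by blast
  obtain n where n: "en n = g" using en by blast
  have "q (k j) ({0, -g}, {0, -g}) = 0" if "j > n" for j
  proof -
    have "k j > n" using that seq_suble[OF k, of j] by simp
    then have "g \<in> Rn (k j)" using n g(1) by (auto simp: Rn_def)
    then show ?thesis using null by (simp add: q2)
  qed
  then have "eventually (\<lambda>j. q (k j) ({0, -g}, {0, -g}) = 0) sequentially"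
    by (auto simp: eventually_sequentially intro!: exI[of _ "Suc n"])
  then have "(\<lambda>j. q (k j) ({0, -g}, {0, -g})) \<longlonglongrightarrow> 0" by (rule tendsto_eventually)
  then have "p {0, -g} {0, -g} = 0" using LIMSEQ_unique lm[of "{0, -g}" "{0, -g}"] by auto
  then show False using g(2) N(4)[of g] by simp
qed

section \<open>Rigid measure expanding subsets\<close>

lemma translate_translate: "translate (translate R a) b = translate R (a + b)"
  by (auto simp: translate_def add.assoc image_image)

lemma translate_0 [simp]: "translate R 0 = R"
  by (simp add: translate_def)

lemma char_avg_near:
  assumes \<phi>s: "\<phi>s \<noteq> []" and ch: "\<And>\<phi>. \<phi> \<in> set \<phi>s \<Longrightarrow> character \<phi>"
    and near: "\<And>\<phi>. \<phi> \<in> set \<phi>s \<Longrightarrow> norm (\<phi> (s - b) - 1) \<le> \<epsilon>"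
  shows "char_avg \<phi>s b - \<epsilon> \<le> char_avg \<phi>s s"
proof -
  have "Re (\<phi> b) - \<epsilon> \<le> Re (\<phi> s)" if \<phi>: "\<phi> \<in> set \<phi>s" for \<phi>
  proof -
    have "\<phi> s = \<phi> ((s - b) + b)" by simp
    then have "\<phi> s - \<phi> b = (\<phi> (s - b) - 1) * \<phi> b"
      by (simp only: characterD(5)[OF ch[OF \<phi>]] left_diff_distrib mult_1)
    then have "norm (\<phi> s - \<phi> b) \<le> \<epsilon>" using near[OF \<phi>] by (simp add: norm_mult characterD(4)[OF ch[OF \<phi>]])
    then have "\<bar>Re (\<phi> s - \<phi> b)\<bar> \<le> \<epsilon>" by (rule order_trans[OF abs_Re_le_cmod])
    then show ?thesis unfolding minus_complex.sel by linarith
  qed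
  then have "(\<Sum>\<phi>\<leftarrow>\<phi>s. Re (\<phi> b) - \<epsilon>) \<le> (\<Sum>\<phi>\<leftarrow>\<phi>s. Re (\<phi> s))" by (intro sum_list_mono)
  then have "(\<Sum>\<phi>\<leftarrow>\<phi>s. Re (\<phi> b)) - \<epsilon> * length \<phi>s \<le> (\<Sum>\<phi>\<leftarrow>\<phi>s. Re (\<phi> s))"
    by (simp add: sum_list_subtractf sum_list_triv mult.commute)
  then have "((\<Sum>\<phi>\<leftarrow>\<phi>s. Re (\<phi> b)) - \<epsilon> * length \<phi>s) / length \<phi>s \<le> (\<Sum>\<phi>\<leftarrow>\<phi>s. Re (\<phi> s)) / length \<phi>s"
    by (rule divide_right_mono) simp
  then show ?thesis using \<phi>s by (simp add: char_avg_def diff_divide_distrib)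
qed

text \<open>
  By \<open>box_recurrence\<close> and \<open>recurrence_near\<close>, the part of \<open>S\<close> where the new average is near \<open>1\<close> has a
  recurrent translate by \<open>h\<close>; by compactness so has a finite subset of this part.
\<close>

lemma recurrence_step:
  fixes S F :: "'g::ab_group_add set"
  assumes cnt: "countable (UNIV :: 'g set)" and rich: "rich \<Gamma>" and S: "measure_expanding S"
    and \<phi>s: "\<phi>s \<noteq> []" "set \<phi>s \<subseteq> \<Gamma>" and F: "finite F" and \<tau>: "\<tau> > 0" and \<epsilon>: "\<epsilon> > 0" and \<delta>: "\<delta> > 0"
  shows "\<exists>\<phi>s' R. \<phi>s' \<noteq> [] \<and> set \<phi>s' \<subseteq> \<Gamma> \<and> (\<forall>k\<in>F. \<bar>char_avg \<phi>s' k - char_avg \<phi>s k\<bar> \<le> \<tau>) \<and>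
    R \<subseteq> S \<and> finite R \<and> (\<forall>s\<in>R. char_avg \<phi>s' s \<ge> 1 - \<epsilon>) \<and> recurrent_at \<delta> (translate R h)"
proof -
  have e16: "\<epsilon> / 2 / 8 > 0" "\<epsilon> / 2 > 0" using \<epsilon> by auto
  from box_shift_almost_fixed[OF \<delta> e16(1)] obtain K L where KL: "K > 1"
    and box0: "\<forall>A \<subseteq> {..<K} \<rightarrow>\<^sub>E {..<L}. \<delta> * real L ^ K \<le> card A \<longrightarrow>
      (\<exists>a\<in>A. \<exists>b\<in>A. real (card {i\<in>{..<K}. a i \<noteq> b i + 1}) \<le> \<epsilon> / 2 / 8 * K)"
    by (elim exE conjE)
  note box = box0[rule_format]
  from hamming_step[OF rich \<phi>s F \<tau> e16(2) KL, of L h] obtain \<phi>s' e where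
    \<phi>s': "\<phi>s' \<noteq> []" "set \<phi>s' \<subseteq> \<Gamma>" and close: "\<forall>k\<in>F. \<bar>char_avg \<phi>s' k - char_avg \<phi>s k\<bar> \<le> \<tau>"
    and good: "\<forall>a\<in>{..<K} \<rightarrow>\<^sub>E {..<L}. \<forall>b\<in>{..<K} \<rightarrow>\<^sub>E {..<L}. real (card {i\<in>{..<K}. a i \<noteq> b i + 1}) \<le> \<epsilon> / 2 / 8 * K \<longrightarrow>
      char_avg \<phi>s' (box_vec K e a - box_vec K e b - h) \<ge> 1 - \<epsilon> / 2" by blast
  have ch: "\<phi> \<in> set \<phi>s' \<Longrightarrow> character \<phi>" for \<phi> using \<phi>s'(2) richD(1)[OF rich] by blast
  define S1 where "S1 = {s\<in>S. char_avg \<phi>s' s \<ge> 1 - \<epsilon>}"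
  have "recurrent_at \<delta> (translate S1 h)"
    unfolding recurrent_at_def
  proof (intro allI impI)
    fix M :: "('g \<Rightarrow> bool) measure" and T :: "'g \<Rightarrow> ('g \<Rightarrow> bool) \<Rightarrow> 'g \<Rightarrow> bool" and D
    assume M: "G_system M T" and D: "D \<in> sets M" and mD: "measure M D \<ge> \<delta>"
    have "\<exists>b. char_avg \<phi>s' b \<ge> 1 - \<epsilon> / 2 \<and> measure M (D \<inter> T (b + h) ` D) > 0"
    proof (rule box_recurrence[OF cnt M D mD])
      fix A assume A: "A \<subseteq> {..<K} \<rightarrow>\<^sub>E {..<L}" "\<delta> * real L ^ K \<le> card A"
      from box[OF this] good A(1)
      show "\<exists>a\<in>A. \<exists>b\<in>A. char_avg \<phi>s' (box_vec K e a - box_vec K e b - h) \<ge> 1 - \<epsilon> / 2" by blast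
    qed
    then obtain b where b: "char_avg \<phi>s' b \<ge> 1 - \<epsilon> / 2" "measure M (D \<inter> T (b + h) ` D) > 0" by blast
    obtain s where s: "s \<in> S" "\<forall>\<xi>\<in>set \<phi>s'. norm (\<xi> (s - b) - 1) < \<epsilon> / 2" "measure M (D \<inter> T (s + h) ` D) > 0"
      using recurrence_near[OF S finite_set ch e16(2) M D b(2)] by blast
    have "char_avg \<phi>s' b - \<epsilon> / 2 \<le> char_avg \<phi>s' s"
      by (rule char_avg_near[OF \<phi>s'(1) ch]) (use s(2) in \<open>auto intro: less_imp_le\<close>)
    then have "s \<in> S1" using b(1) s(1) by (simp add: S1_def)
    then show "\<exists>g\<in>translate S1 h. measure M (D \<inter> T g ` D) > 0" using s(3) by (auto simp: translate_def)
  qed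
  then obtain R0 where R0: "R0 \<subseteq> translate S1 h" "finite R0" "recurrent_at \<delta> R0"
    using recurrent_at_finite_subset[OF cnt] by blast
  define R where "R = translate R0 (- h)"
  have "translate R h = R0" by (simp add: R_def translate_translate)
  moreover have "R \<subseteq> S1"
  proof -
    have "R \<subseteq> translate (translate S1 h) (- h)" using R0(1) unfolding R_def by (auto simp: translate_def)
    then show ?thesis by (simp add: translate_translate)
  qed
  moreover have "finite R" using R0(2) by (simp add: R_def translate_def)
  ultimately show ?thesis
    using \<phi>s' close R0(3) by (intro exI[of _ \<phi>s'] exI[of _ R]) (auto simp: S1_def)
qed

text \<open>
  The last conclusion speaks of all functions close to the new average on a finite set, because it
  is needed for the limit of the whole construction, of which later stages guarantee only this
  closeness.
\<close>

lemma construction_step: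
  fixes S F :: "'g::ab_group_add set"
  assumes cnt: "countable (UNIV :: 'g set)" and rich: "rich \<Gamma>" and S: "measure_expanding S"
    and \<phi>s: "\<phi>s \<noteq> []" "set \<phi>s \<subseteq> \<Gamma>" and F: "finite F" and \<tau>: "\<tau> > 0" and \<epsilon>: "\<epsilon> > 0" and \<delta>: "\<delta> > 0"
  shows "\<exists>\<phi>s' F' \<tau>' e R. (\<phi>s' \<noteq> [] \<and> set \<phi>s' \<subseteq> \<Gamma> \<and> finite F' \<and> 0 < \<tau>') \<and> F \<subseteq> F' \<and> g \<in> F' \<and> \<tau>' \<le> \<tau> / 2 \<and>
    R \<subseteq> S \<and> finite R \<and> recurrent_at \<delta> (translate R h) \<and>
    (\<forall>k\<in>F. \<bar>char_avg \<phi>s' k - char_avg \<phi>s k\<bar> \<le> \<tau> / 2) \<and>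
    (\<forall>f. (\<forall>k\<in>F'. \<bar>f k - char_avg \<phi>s' k\<bar> \<le> \<tau>') \<longrightarrow>
       (\<forall>k\<in>F. \<bar>f (e + k)\<bar> \<le> \<epsilon>) \<and> (\<forall>s\<in>R. f s \<ge> 1 - \<epsilon>) \<and> ((\<exists>\<phi>\<in>\<Gamma>. \<phi> g \<noteq> 1) \<longrightarrow> f g < 1))"
proof -
  have \<tau>6: "\<tau> / 6 > 0" using \<tau> by simp
  obtain \<phi>s1 where \<phi>s1: "\<phi>s1 \<noteq> []" "set \<phi>s1 \<subseteq> \<Gamma>" "\<And>k. \<bar>char_avg \<phi>s1 k - char_avg \<phi>s k\<bar> \<le> \<tau> / 6"
    "(\<exists>\<phi>\<in>\<Gamma>. \<phi> g \<noteq> 1) \<Longrightarrow> char_avg \<phi>s1 g < 1"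
  proof (cases "\<exists>\<phi>\<in>\<Gamma>. \<phi> g \<noteq> 1")
    case True
    then obtain \<phi>0 where "\<phi>0 \<in> \<Gamma>" "\<phi>0 g \<noteq> 1" by blast
    from freeness_step[where g = g, OF rich \<phi>s this \<tau>6] show ?thesis using that by blast
  next
    case False
    then show ?thesis using that[of \<phi>s] \<phi>s \<tau> by simp
  qed
  define \<eta> where "\<eta> = (if \<exists>\<phi>\<in>\<Gamma>. \<phi> g \<noteq> 1 then 1 - char_avg \<phi>s1 g else 1)"
  have \<eta>: "\<eta> > 0" using \<phi>s1(4) by (simp add: \<eta>_def)
  \<comment> \<open>The two later modifications and the final tolerance move values by at most \<open>\<sigma>\<close> each:
    \<open>3 \<sigma> < \<eta>\<close> preserves freeness at \<open>g\<close>, \<open>\<epsilon> / 3 + 2 \<sigma> \<le> \<epsilon>\<close> the other two estimates, and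
    \<open>\<tau> / 6 + 2 \<sigma> \<le> \<tau> / 2\<close> bounds the total change on \<open>F\<close>.\<close>
  define \<sigma> where "\<sigma> = min (\<tau> / 6) (min (\<eta> / 4) (\<epsilon> / 3))"
  have \<sigma>: "\<sigma> > 0" "\<sigma> \<le> \<tau> / 6" "\<sigma> \<le> \<eta> / 4" "\<sigma> \<le> \<epsilon> / 3" using \<tau> \<eta> \<epsilon> by (auto simp: \<sigma>_def)
  have \<epsilon>3: "\<epsilon> / 3 > 0" using \<epsilon> by simp
  have F1: "finite (insert g F)" using F by simp
  from mixing_step[OF rich \<phi>s1(1,2) F1 \<sigma>(1) \<epsilon>3] obtain \<phi>s2 e where \<phi>s2: "\<phi>s2 \<noteq> []" "set \<phi>s2 \<subseteq> \<Gamma>"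
    "\<forall>k\<in>insert g F. \<bar>char_avg \<phi>s2 k - char_avg \<phi>s1 k\<bar> \<le> \<sigma>" "\<forall>k\<in>insert g F. \<bar>char_avg \<phi>s2 (e + k)\<bar> \<le> \<epsilon> / 3"
    by blast
  \<comment> \<open>Protecting \<open>e + F\<close> in the last modification preserves what the mixing step achieved.\<close>
  define F2 where "F2 = insert g F \<union> (\<lambda>k. e + k) ` F"
  have F2: "finite F2" using F by (simp add: F2_def)
  from recurrence_step[OF cnt rich S \<phi>s2(1,2) F2 \<sigma>(1) \<epsilon>3 \<delta>, of h] obtain \<phi>s3 R where \<phi>s3: "\<phi>s3 \<noteq> []" "set \<phi>s3 \<subseteq> \<Gamma>"
    "\<forall>k\<in>F2. \<bar>char_avg \<phi>s3 k - char_avg \<phi>s2 k\<bar> \<le> \<sigma>"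
    and R: "R \<subseteq> S" "finite R" "\<forall>s\<in>R. char_avg \<phi>s3 s \<ge> 1 - \<epsilon> / 3" "recurrent_at \<delta> (translate R h)" by blast
  show ?thesis
  proof (rule exI[of _ \<phi>s3], rule exI[of _ "F2 \<union> R"], rule exI[of _ \<sigma>], rule exI[of _ e], rule exI[of _ R],
      intro conjI ballI allI impI)
    show "finite (F2 \<union> R)" using F2 R by simp
    show "\<sigma> \<le> \<tau> / 2" using \<sigma> \<tau> by simp
    show "\<bar>char_avg \<phi>s3 k - char_avg \<phi>s k\<bar> \<le> \<tau> / 2" if "k \<in> F" for k
    proof -
      have "\<bar>char_avg \<phi>s2 k - char_avg \<phi>s1 k\<bar> \<le> \<sigma>" "\<bar>char_avg \<phi>s3 k - char_avg \<phi>s2 k\<bar> \<le> \<sigma>"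
        using \<phi>s2(3) \<phi>s3(3) that by (auto simp: F2_def)
      then show ?thesis using \<phi>s1(3)[of k] \<sigma>(2) by linarith
    qed
    fix f assume f: "\<forall>k\<in>F2 \<union> R. \<bar>f k - char_avg \<phi>s3 k\<bar> \<le> \<sigma>"
    show "\<bar>f (e + k)\<bar> \<le> \<epsilon>" if "k \<in> F" for k
    proof -
      have "\<bar>f (e + k) - char_avg \<phi>s3 (e + k)\<bar> \<le> \<sigma>" "\<bar>char_avg \<phi>s3 (e + k) - char_avg \<phi>s2 (e + k)\<bar> \<le> \<sigma>"
        "\<bar>char_avg \<phi>s2 (e + k)\<bar> \<le> \<epsilon> / 3"
        using f \<phi>s3(3) \<phi>s2(4) that by (auto simp: F2_def)
      then show ?thesis using \<sigma>(4) by linarith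
    qed
    show "f s \<ge> 1 - \<epsilon>" if "s \<in> R" for s
    proof -
      have "\<bar>f s - char_avg \<phi>s3 s\<bar> \<le> \<sigma>" "char_avg \<phi>s3 s \<ge> 1 - \<epsilon> / 3" using f R(3) that by auto
      then show ?thesis using \<sigma>(4) \<epsilon> by linarith
    qed
    show "f g < 1" if "\<exists>\<phi>\<in>\<Gamma>. \<phi> g \<noteq> 1"
    proof -
      have "\<bar>f g - char_avg \<phi>s3 g\<bar> \<le> \<sigma>" "\<bar>char_avg \<phi>s3 g - char_avg \<phi>s2 g\<bar> \<le> \<sigma>"
        "\<bar>char_avg \<phi>s2 g - char_avg \<phi>s1 g\<bar> \<le> \<sigma>"
        using f \<phi>s3(3) \<phi>s2(3) by (auto simp: F2_def)
      moreover have "\<eta> = 1 - char_avg \<phi>s1 g" using that by (simp add: \<eta>_def)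
      ultimately show ?thesis using \<sigma>(3) \<eta> by linarith
    qed
  qed (use \<phi>s3 R \<sigma> in \<open>auto simp: F2_def\<close>)
qed

definition positive_definite :: "('g::ab_group_add \<Rightarrow> real) \<Rightarrow> bool" where
  "positive_definite C \<longleftrightarrow> (\<forall>g. C (- g) = C g) \<and>
     (\<forall>J c. finite J \<longrightarrow> (\<Sum>g\<in>J. \<Sum>h\<in>J. c g * c h * C (g - h)) \<ge> 0)"

text \<open>
  The quadratic form is the squared modulus of \<open>\<Sum>g. c g * \<phi> g\<close>.
\<close>

lemma character_Re_psd:
  assumes \<phi>: "character \<phi>"
  shows "(\<Sum>g\<in>J. \<Sum>h\<in>J. c g * c h * Re (\<phi> (g - h))) \<ge> 0"
proof -
  define z where "z = (\<Sum>g\<in>J. of_real (c g) * \<phi> g)"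
  have "z * cnj z = (\<Sum>g\<in>J. \<Sum>h\<in>J. (of_real (c g) * \<phi> g) * (of_real (c h) * cnj (\<phi> h)))"
    unfolding z_def by (simp add: sum_product)
  then have "Re (z * cnj z) = (\<Sum>g\<in>J. \<Sum>h\<in>J. Re ((of_real (c g) * \<phi> g) * (of_real (c h) * cnj (\<phi> h))))"
    by simp
  also have "\<dots> = (\<Sum>g\<in>J. \<Sum>h\<in>J. c g * c h * Re (\<phi> (g - h)))"
    by (intro sum.cong refl) (simp add: characterD(3)[OF \<phi>] algebra_simps)
  finally have "(\<Sum>g\<in>J. \<Sum>h\<in>J. c g * c h * Re (\<phi> (g - h))) = Re (z * cnj z)" by simp
  also have "\<dots> \<ge> 0" by simp
  finally show ?thesis .
qed

lemma char_avg_positive_definite: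
  assumes "\<And>\<phi>. \<phi> \<in> set \<phi>s \<Longrightarrow> character \<phi>"
  shows "positive_definite (char_avg \<phi>s)"
  unfolding positive_definite_def
proof (intro conjI allI impI)
  fix g
  have "(\<Sum>\<phi>\<leftarrow>\<phi>s. Re (\<phi> (- g))) = (\<Sum>\<phi>\<leftarrow>\<phi>s. Re (\<phi> g))"
    using assms by (intro arg_cong[where f=sum_list] map_cong) (auto simp: characterD(6))
  then show "char_avg \<phi>s (- g) = char_avg \<phi>s g" by (simp add: char_avg_def)
next
  fix J :: "'a set" and c :: "'a \<Rightarrow> real" assume "finite J"
  have "(\<Sum>g\<in>J. \<Sum>h\<in>J. c g * c h * (\<Sum>\<phi>\<leftarrow>\<phi>s. Re (\<phi> (g - h)))) \<ge> 0"
    using assms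
  proof (induction \<phi>s)
    case (Cons \<phi> \<phi>s)
    have "(\<Sum>g\<in>J. \<Sum>h\<in>J. c g * c h * (\<Sum>\<phi>\<leftarrow>\<phi> # \<phi>s. Re (\<phi> (g - h))))
      = (\<Sum>g\<in>J. \<Sum>h\<in>J. c g * c h * Re (\<phi> (g - h))) + (\<Sum>g\<in>J. \<Sum>h\<in>J. c g * c h * (\<Sum>\<phi>\<leftarrow>\<phi>s. Re (\<phi> (g - h))))"
      by (simp add: distrib_left sum.distrib)
    then show ?case using Cons character_Re_psd[of \<phi> c J] by simp
  qed simp
  then have "(\<Sum>g\<in>J. \<Sum>h\<in>J. c g * c h * (\<Sum>\<phi>\<leftarrow>\<phi>s. Re (\<phi> (g - h)))) / length \<phi>s \<ge> 0" by simp
  then show "(\<Sum>g\<in>J. \<Sum>h\<in>J. c g * c h * char_avg \<phi>s (g - h)) \<ge> 0"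
    by (simp add: char_avg_def sum_divide_distrib)
qed

lemma positive_definite_limit:
  assumes "\<And>n. positive_definite (Cn n)" "\<And>g. (\<lambda>n. Cn n g) \<longlonglongrightarrow> C g"
  shows "positive_definite C"
  unfolding positive_definite_def
proof (intro conjI allI impI)
  fix g
  have "(\<lambda>n. Cn n (- g)) = (\<lambda>n. Cn n g)" using assms(1) by (simp add: positive_definite_def)
  then show "C (- g) = C g" using assms(2)[of g] assms(2)[of "- g"] LIMSEQ_unique by metis
next
  fix J :: "'a set" and c :: "'a \<Rightarrow> real" assume J: "finite J"
  have "(\<lambda>n. \<Sum>g\<in>J. \<Sum>h\<in>J. c g * c h * Cn n (g - h)) \<longlonglongrightarrow> (\<Sum>g\<in>J. \<Sum>h\<in>J. c g * c h * C (g - h))"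
    by (intro tendsto_intros assms(2))
  then show "(\<Sum>g\<in>J. \<Sum>h\<in>J. c g * c h * C (g - h)) \<ge> 0"
    by (rule LIMSEQ_le_const) (use assms(1) J in \<open>auto simp: positive_definite_def\<close>)
qed

text \<open>
  The construction step is iterated with tolerances that are halved at each stage, so that the
  averages converge and the limit \<open>C\<close> stays within the tolerance \<open>\<tau> n\<close> of the \<open>n\<close>-th average on
  \<open>F n\<close>. Stage \<open>n\<close> takes care of the group element \<open>en n\<close> and, with \<open>n\<close> decoded as a pair, of one
  translation \<open>hn n\<close> and one lower bound \<open>\<delta>n n\<close> for the measure.
\<close>

theorem rigid_measure_expanding_subset:
  fixes S :: "'g::ab_group_add set"
  assumes cnt: "countable (UNIV :: 'g set)" and rich: "rich \<Gamma>" and S: "measure_expanding S"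
  shows "\<exists>S' C e. S' \<subseteq> S \<and> measure_expanding S' \<and> positive_definite C \<and> C 0 = 1 \<and>
    (\<forall>\<epsilon>>0. finite {s\<in>S'. C s < 1 - \<epsilon>}) \<and> (\<forall>k. (\<lambda>n. C (e n + k)) \<longlonglongrightarrow> 0) \<and>
    (\<forall>g. (\<exists>\<phi>\<in>\<Gamma>. \<phi> g \<noteq> 1) \<longrightarrow> C g < 1)"
proof -
  define en where "en = from_nat_into (UNIV :: 'g set)"
  have en: "\<exists>n. en n = g" for g
    using from_nat_into_surj[OF cnt, of g] by (auto simp: en_def)
  define hn where "hn n = en (fst (prod_decode n))" for n
  define \<delta>n where "\<delta>n n = 1 / real (Suc (snd (prod_decode n)))" for n
  define \<epsilon>n where "\<epsilon>n n = 1 / real (Suc n)" for n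
  define P where "P = (\<lambda>(n::nat) (\<phi>s, F, \<tau>, (e::'g), (R::'g set)). \<phi>s \<noteq> [] \<and> set \<phi>s \<subseteq> \<Gamma> \<and> finite (F :: 'g set) \<and> 0 < (\<tau>::real))"
  define Q where "Q = (\<lambda>(n::nat) (\<phi>s, F, \<tau>, (e0::'g), (R0::'g set)) (\<phi>s', F', \<tau>', e, R).
    F \<subseteq> F' \<and> en n \<in> F' \<and> \<tau>' \<le> \<tau> / 2 \<and>
    R \<subseteq> S \<and> finite R \<and> recurrent_at (\<delta>n n) (translate R (hn n)) \<and>
    (\<forall>k\<in>F. \<bar>char_avg \<phi>s' k - char_avg \<phi>s k\<bar> \<le> \<tau> / 2) \<and>
    (\<forall>f. (\<forall>k\<in>F'. \<bar>f k - char_avg \<phi>s' k\<bar> \<le> \<tau>') \<longrightarrow>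
       (\<forall>k\<in>F. \<bar>f (e + k)\<bar> \<le> \<epsilon>n n) \<and> (\<forall>s\<in>R. f s \<ge> 1 - \<epsilon>n n) \<and> ((\<exists>\<phi>\<in>\<Gamma>. \<phi> (en n) \<noteq> 1) \<longrightarrow> f (en n) < 1)))"
  have "\<exists>x. \<forall>n. P n (x n) \<and> Q n (x n) (x (Suc n))"
  proof (rule dependent_nat_choice)
    obtain \<phi>0 where "\<phi>0 \<in> \<Gamma>" using richD(3)[OF rich] by blast
    then have "P 0 ([\<phi>0], {}, 1, 0, {})" by (simp add: P_def)
    then show "\<exists>x. P 0 x" by blast
    fix x n assume x: "P n x"
    obtain \<phi>s F \<tau> e0 R0 where xe: "x = (\<phi>s, F, \<tau>, e0, R0)" by (cases x) auto
    then have h: "\<phi>s \<noteq> []" "set \<phi>s \<subseteq> \<Gamma>" "finite F" "\<tau> > 0" using x by (auto simp: P_def)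
    have "\<epsilon>n n > 0" "\<delta>n n > 0" by (auto simp: \<epsilon>n_def \<delta>n_def)
    then have "\<exists>\<phi>s' F' \<tau>' e R. P (Suc n) (\<phi>s', F', \<tau>', e, R) \<and> Q n x (\<phi>s', F', \<tau>', e, R)"
      unfolding P_def Q_def xe prod.case by (rule construction_step[OF cnt rich S h])
    then show "\<exists>y. P (Suc n) y \<and> Q n x y" by blast
  qed
  then obtain x where x: "\<forall>n. P n (x n) \<and> Q n (x n) (x (Suc n))" ..
  define \<phi>s where "\<phi>s n = fst (x n)" for n
  define F where "F n = fst (snd (x n))" for n
  define \<tau> where "\<tau> n = fst (snd (snd (x n)))" for n
  define e where "e n = fst (snd (snd (snd (x (Suc n)))))" for n
  define R where "R n = snd (snd (snd (snd (x (Suc n)))))" for n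
  have Pn: "\<phi>s n \<noteq> []" "set (\<phi>s n) \<subseteq> \<Gamma>" "\<tau> n > 0" for n
    using x[rule_format, of n] by (auto simp: P_def \<phi>s_def \<tau>_def case_prod_unfold)
  have Qn: "F n \<subseteq> F (Suc n) \<and> en n \<in> F (Suc n) \<and> \<tau> (Suc n) \<le> \<tau> n / 2 \<and>
    R n \<subseteq> S \<and> finite (R n) \<and> recurrent_at (\<delta>n n) (translate (R n) (hn n)) \<and>
    (\<forall>k\<in>F n. \<bar>char_avg (\<phi>s (Suc n)) k - char_avg (\<phi>s n) k\<bar> \<le> \<tau> n / 2) \<and>
    (\<forall>f. (\<forall>k\<in>F (Suc n). \<bar>f k - char_avg (\<phi>s (Suc n)) k\<bar> \<le> \<tau> (Suc n)) \<longrightarrow>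
       (\<forall>k\<in>F n. \<bar>f (e n + k)\<bar> \<le> \<epsilon>n n) \<and> (\<forall>s\<in>R n. f s \<ge> 1 - \<epsilon>n n) \<and> ((\<exists>\<phi>\<in>\<Gamma>. \<phi> (en n) \<noteq> 1) \<longrightarrow> f (en n) < 1))" for n
    using x[rule_format, of n, THEN conjunct2]
    unfolding Q_def case_prod_unfold \<phi>s_def F_def \<tau>_def e_def R_def .
  note FS = Qn[THEN conjunct1] and Q1 = Qn[THEN conjunct2]
  note enF = Q1[THEN conjunct1] and Q2 = Q1[THEN conjunct2]
  note \<tau>S = Q2[THEN conjunct1] and Q3 = Q2[THEN conjunct2]
  note R1 = Q3[THEN conjunct1] and Q4 = Q3[THEN conjunct2]
  note R2 = Q4[THEN conjunct1] and Q5 = Q4[THEN conjunct2]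
  note R3 = Q5[THEN conjunct1] and Q6 = Q5[THEN conjunct2]
  note avgS = Q6[THEN conjunct1]
  have Fmono: "F m \<subseteq> F n" if "m \<le> n" for m n by (rule lift_Suc_mono_le[of F, OF FS that])
  have ch: "\<phi> \<in> set (\<phi>s n) \<Longrightarrow> character \<phi>" for \<phi> n using Pn(2)[of n] richD(1)[OF rich] by blast
  define Cn where "Cn n = char_avg (\<phi>s n)" for n
  have step: "\<bar>Cn m k - Cn n k\<bar> \<le> \<tau> n - \<tau> m" if k: "k \<in> F n" and "n \<le> m" for k n m
    using that(2)
  proof (induction m rule: dec_induct)
    case (step m)
    have "k \<in> F m" using Fmono[OF step(1)] k by blast
    then have "\<bar>Cn (Suc m) k - Cn m k\<bar> \<le> \<tau> m / 2" using avgS[of m] by (simp add: Cn_def)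
    moreover have "\<tau> (Suc m) \<le> \<tau> m / 2" by (rule \<tau>S)
    ultimately show ?case using step by linarith
  qed simp
  have \<tau>pow: "\<tau> n \<le> \<tau> 0 / 2 ^ n" for n
  proof (induction n)
    case (Suc n)
    have "\<tau> (Suc n) \<le> \<tau> n / 2" by (rule \<tau>S)
    also have "\<dots> \<le> (\<tau> 0 / 2 ^ n) / 2" using Suc by simp
    finally show ?case by simp
  qed simp
  have "(\<lambda>n. \<tau> 0 / 2 ^ n) \<longlonglongrightarrow> 0" by (intro LIMSEQ_divide_realpow_zero) simp
  then have \<tau>0: "\<tau> \<longlonglongrightarrow> 0"
    by (rule tendsto_sandwich[OF _ _ tendsto_const, rotated 2]) (auto simp: \<tau>pow less_imp_le[OF Pn(3)])
  have inF: "\<exists>n. k \<in> F n" for k using en[of k] enF by blast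
  have cau: "\<exists>l. (\<lambda>n. Cn n k) \<longlonglongrightarrow> l" for k
  proof -
    obtain n0 where n0: "k \<in> F n0" using inF by blast
    have "Cauchy (\<lambda>n. Cn n k)"
    proof (rule metric_CauchyI)
      fix \<epsilon> :: real assume "\<epsilon> > 0"
      then have "eventually (\<lambda>n. \<tau> n < \<epsilon> / 2) sequentially"
        using order_tendstoD(2)[OF \<tau>0, of "\<epsilon> / 2"] by simp
      then obtain N where N: "\<And>n. n \<ge> N \<Longrightarrow> \<tau> n < \<epsilon> / 2" by (auto simp: eventually_sequentially)
      define n1 where "n1 = max n0 N"
      have k: "k \<in> F n1" using Fmono[of n0 n1] n0 by (auto simp: n1_def)
      have "\<bar>Cn m k - Cn n1 k\<bar> < \<epsilon> / 2" if "m \<ge> n1" for m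
        using step[OF k that] Pn(3)[of m] N[of n1] by (simp add: n1_def)
      then show "\<exists>M. \<forall>m\<ge>M. \<forall>n\<ge>M. dist (Cn m k) (Cn n k) < \<epsilon>"
        unfolding dist_real_def by (intro exI[of _ n1]) (smt (verit) field_sum_of_halves)
    qed
    then show ?thesis by (simp add: Cauchy_convergent_iff convergent_def)
  qed
  define C where "C k = lim (\<lambda>n. Cn n k)" for k
  have Clim: "(\<lambda>n. Cn n k) \<longlonglongrightarrow> C k" for k
    using cau[of k] unfolding C_def by (auto simp: limI)
  have Cclose: "\<bar>C k - Cn n k\<bar> \<le> \<tau> n" if k: "k \<in> F n" for k n
  proof (rule LIMSEQ_le_const2)
    show "(\<lambda>m. \<bar>Cn m k - Cn n k\<bar>) \<longlonglongrightarrow> \<bar>C k - Cn n k\<bar>" by (intro tendsto_intros Clim)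
    show "\<exists>N. \<forall>m\<ge>N. \<bar>Cn m k - Cn n k\<bar> \<le> \<tau> n"
      using step[OF k] Pn(3) by (intro exI[of _ n]) (smt (verit))
  qed
  have Cprop: "(\<forall>k\<in>F n. \<bar>C (e n + k)\<bar> \<le> \<epsilon>n n) \<and> (\<forall>s\<in>R n. C s \<ge> 1 - \<epsilon>n n) \<and>
      ((\<exists>\<phi>\<in>\<Gamma>. \<phi> (en n) \<noteq> 1) \<longrightarrow> C (en n) < 1)" for n
    by (rule Q6[THEN conjunct2, THEN spec, THEN mp]) (intro ballI Cclose[unfolded Cn_def])
  define S' where "S' = (\<Union>n. R n)"
  have small: "\<exists>N. \<forall>n\<ge>N. \<epsilon>n n < \<epsilon>" if "\<epsilon> > 0" for \<epsilon>
  proof -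
    obtain N :: nat where N: "N > 1 / \<epsilon>" using reals_Archimedean2 by blast
    have "\<epsilon>n n < \<epsilon>" if "n \<ge> N" for n
    proof -
      have "real (Suc n) > 1 / \<epsilon>" using N that by linarith
      then show ?thesis using \<open>\<epsilon> > 0\<close> by (simp add: \<epsilon>n_def field_simps)
    qed
    then show ?thesis by blast
  qed
  show ?thesis
  proof (rule exI[of _ S'], rule exI[of _ C], rule exI[of _ e], intro conjI allI impI)
    show "S' \<subseteq> S" using R1 by (auto simp: S'_def)
    show "measure_expanding S'"
      unfolding measure_expanding_def set_of_recurrence_def recurrence_on_def
    proof (intro allI impI)
      fix h and M :: "('g \<Rightarrow> bool) measure" and T :: "'g \<Rightarrow> ('g \<Rightarrow> bool) \<Rightarrow> 'g \<Rightarrow> bool" and D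
      assume M: "G_system M T" and D: "D \<in> sets M" and pos: "measure M D > 0"
      obtain i where i: "en i = h" using en by blast
      obtain j where j: "inverse (real (Suc j)) < measure M D" using reals_Archimedean[OF pos] by blast
      define n where "n = prod_encode (i, j)"
      have "hn n = h" "\<delta>n n \<le> measure M D" using i j by (auto simp: hn_def \<delta>n_def n_def inverse_eq_divide)
      moreover have "recurrent_at (\<delta>n n) (translate (R n) (hn n))" by (rule R3)
      ultimately obtain g where "g \<in> translate (R n) h" "measure M (D \<inter> T g ` D) > 0"
        using M D unfolding recurrent_at_def by blast
      then show "\<exists>g\<in>translate S' h. measure M (D \<inter> T g ` D) > 0" by (auto simp: translate_def S'_def)
    qed
    show "positive_definite C"
      by (rule positive_definite_limit[OF _ Clim]) (auto simp: Cn_def intro: char_avg_positive_definite ch)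
    have "Cn n 0 = 1" for n
    proof -
      have "(\<Sum>\<phi>\<leftarrow>\<phi>s n. Re (\<phi> 0)) = (\<Sum>\<phi>\<leftarrow>\<phi>s n. 1)"
        by (intro arg_cong[where f=sum_list] map_cong) (auto simp: characterD(1)[OF ch])
      then show ?thesis using Pn(1)[of n] by (simp add: Cn_def char_avg_def sum_list_triv)
    qed
    then show "C 0 = 1" using Clim[of 0] by (simp add: LIMSEQ_const_iff)
    show "finite {s\<in>S'. C s < 1 - \<epsilon>}" if \<epsilon>: "\<epsilon> > 0" for \<epsilon>
    proof -
      obtain N where N: "\<forall>n\<ge>N. \<epsilon>n n < \<epsilon>" using small[OF \<epsilon>] by blast
      have "{s\<in>S'. C s < 1 - \<epsilon>} \<subseteq> (\<Union>n<N. R n)"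
      proof
        fix s assume s: "s \<in> {s\<in>S'. C s < 1 - \<epsilon>}"
        then obtain n where n: "s \<in> R n" by (auto simp: S'_def)
        then have "C s \<ge> 1 - \<epsilon>n n" using Cprop by blast
        then have "\<not> \<epsilon>n n < \<epsilon>" using s by auto
        then have "n < N" using N by (meson not_le)
        then show "s \<in> (\<Union>n<N. R n)" using n by blast
      qed
      moreover have "finite (\<Union>n<N. R n)" using R2 by blast
      ultimately show ?thesis by (rule finite_subset)
    qed
    show "(\<lambda>n. C (e n + k)) \<longlonglongrightarrow> 0" for k
    proof (rule LIMSEQ_I)
      fix r :: real assume r: "r > 0"
      obtain N where N: "\<forall>n\<ge>N. \<epsilon>n n < r" using small[OF r] by blast
      obtain n0 where n0: "k \<in> F n0" using inF by blast
      have "norm (C (e n + k) - 0) < r" if "n \<ge> max N n0" for n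
      proof -
        have "k \<in> F n" using Fmono[of n0 n] n0 that by auto
        then have "\<bar>C (e n + k)\<bar> \<le> \<epsilon>n n" using Cprop by blast
        moreover have "\<epsilon>n n < r" using N that by simp
        ultimately show ?thesis by simp
      qed
      then show "\<exists>no. \<forall>n\<ge>no. norm (C (e n + k) - 0) < r" by blast
    qed
    show "C g < 1" if "\<exists>\<phi>\<in>\<Gamma>. \<phi> g \<noteq> 1" for g
      using en[of g] Cprop that by blast
  qed
qed

section \<open>Existence of stationary Gaussian laws\<close>

lemma sum_group_weights:
  fixes f :: "'b \<Rightarrow> real"
  assumes "finite I"
  shows "(\<Sum>i\<in>I. t i * f (v i)) = (\<Sum>g\<in>v ` I. (\<Sum>i\<in>{i\<in>I. v i = g}. t i) * f g)"
  unfolding sum.image_gen[OF assms, of _ v] by (simp add: sum_distrib_right)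

text \<open>
  Indices with the same image under \<open>v\<close> are merged and their coefficients added, which reduces forms
  in families with repetitions to forms in sets.
\<close>

lemma quadratic_form_group_weights:
  fixes K :: "'b \<Rightarrow> 'b \<Rightarrow> real" and t :: "'a \<Rightarrow> real" and v :: "'a \<Rightarrow> 'b"
  assumes I: "finite I"
  defines "t' \<equiv> \<lambda>g. \<Sum>i\<in>{i\<in>I. v i = g}. t i"
  shows "(\<Sum>i\<in>I. \<Sum>j\<in>I. t i * t j * K (v i) (v j)) = (\<Sum>g\<in>v ` I. \<Sum>h\<in>v ` I. t' g * t' h * K g h)"
proof -
  have "(\<Sum>i\<in>I. \<Sum>j\<in>I. t i * t j * K (v i) (v j)) = (\<Sum>i\<in>I. t i * (\<Sum>j\<in>I. t j * K (v i) (v j)))"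
    by (simp add: sum_distrib_left mult.assoc)
  also have "\<dots> = (\<Sum>i\<in>I. t i * (\<Sum>h\<in>v ` I. t' h * K (v i) h))"
    unfolding t'_def by (intro sum.cong refl arg_cong2[where f = "(*)"] sum_group_weights[OF I])
  also have "\<dots> = (\<Sum>g\<in>v ` I. t' g * (\<Sum>h\<in>v ` I. t' h * K g h))"
    unfolding t'_def by (rule sum_group_weights[OF I])
  finally show ?thesis by (simp add: sum_distrib_left mult.assoc)
qed

definition psd_kernel :: "('i \<Rightarrow> 'i \<Rightarrow> real) \<Rightarrow> bool" where
  "psd_kernel K \<longleftrightarrow> (\<forall>i j. K i j = K j i) \<and> (\<forall>J c. finite J \<longrightarrow> (\<Sum>i\<in>J. \<Sum>j\<in>J. c i * c j * K i j) \<ge> 0)"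

lemma psd_kernelD:
  assumes "psd_kernel K"
  shows "K i j = K j i" "finite J \<Longrightarrow> (\<Sum>i\<in>J. \<Sum>j\<in>J. c i * c j * K i j) \<ge> 0" "K i i \<ge> 0"
proof -
  show "K i j = K j i" and *: "finite J \<Longrightarrow> (\<Sum>i\<in>J. \<Sum>j\<in>J. c i * c j * K i j) \<ge> 0" for i j J c
    using assms by (auto simp: psd_kernel_def)
  show "K i i \<ge> 0" using *[of "{i}" "\<lambda>_. 1"] by simp
qed

text \<open>
  Otherwise the form would be unbounded below in the coefficient at \<open>k\<close>, on which it depends
  linearly.
\<close>

lemma psd_kernel_zero_diag:
  assumes K: "psd_kernel K" and k: "K k k = 0"
  shows "K k j = 0"
proof (rule ccontr)
  assume n: "K k j \<noteq> 0"
  then have kj: "k \<noteq> j" using k by auto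
  define t where "t = - (K j j + 1) / (2 * K k j)"
  have "(\<Sum>i\<in>{k, j}. \<Sum>l\<in>{k, j}. (if i = k then t else 1) * (if l = k then t else 1) * K i l) \<ge> 0"
    by (rule psd_kernelD(2)[OF K]) simp
  then have "2 * t * K k j + K j j \<ge> 0" using kj k psd_kernelD(1)[OF K, of j k] by (simp add: algebra_simps)
  moreover have "2 * t * K k j = - (K j j + 1)" using n by (simp add: t_def)
  ultimately show False by simp
qed

text \<open>
  If the pivot \<open>K k k\<close> of a positive semidefinite kernel is \<open>0\<close>, then so is the whole row, and
  division by zero makes the Schur complement equal to \<open>K\<close>, as it should be.
\<close>

definition schur :: "('i \<Rightarrow> 'i \<Rightarrow> real) \<Rightarrow> 'i \<Rightarrow> 'i \<Rightarrow> 'i \<Rightarrow> real" where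
  "schur K k i j = K i j - K i k * K j k / K k k"

text \<open>
  The form of the Schur complement is the minimum of the form of \<open>K\<close> over the coefficient at \<open>k\<close>.
\<close>

lemma psd_kernel_schur:
  fixes K :: "'i \<Rightarrow> 'i \<Rightarrow> real"
  assumes K: "psd_kernel K"
  shows "psd_kernel (schur K k)"
proof (cases "K k k = 0")
  case True
  then have "schur K k = K" by (simp add: schur_def fun_eq_iff)
  then show ?thesis using K by simp
next
  case False
  then have pos: "K k k > 0" using psd_kernelD(3)[OF K, of k] by simp
  show ?thesis unfolding psd_kernel_def
  proof (intro conjI allI impI)
    show "schur K k i j = schur K k j i" for i j using psd_kernelD(1)[OF K, of i j] by (simp add: schur_def mult.commute)
    fix J :: "'i set" and c :: "'i \<Rightarrow> real" assume J: "finite J"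
    \<comment> \<open>The coefficient \<open>d = - S / K k k\<close> at \<open>k\<close>, added to the one given by \<open>c\<close>, minimizes the
      form.\<close>
    define S where "S = (\<Sum>j\<in>J. c j * K j k)"
    define d where "d = - S / K k k"
    define J' where "J' = insert k J"
    have J': "finite J'" using J by (simp add: J'_def)
    define c0 where "c0 i = (if i \<in> J then c i else 0)" for i
    define c1 where "c1 i = (if i = k then d else 0)" for i
    have s0: "(\<Sum>i\<in>J'. c0 i * f i) = (\<Sum>i\<in>J. c i * f i)" for f
      unfolding c0_def by (rule sum.mono_neutral_cong_right) (use J in \<open>auto simp: J'_def\<close>)
    have s1: "(\<Sum>i\<in>J'. c1 i * f i) = d * f k" for f
    proof -
      have "(\<Sum>i\<in>J'. c1 i * f i) = (\<Sum>i\<in>J'. if i = k then d * f i else 0)" by (intro sum.cong) (auto simp: c1_def)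
      also have "\<dots> = d * f k" using J' by (simp add: J'_def)
      finally show ?thesis .
    qed
    have ss: "(\<Sum>j\<in>J'. (c0 j + c1 j) * f j) = (\<Sum>j\<in>J. c j * f j) + d * f k" for f
      by (simp add: distrib_right sum.distrib s0 s1)
    have "0 \<le> (\<Sum>i\<in>J'. \<Sum>j\<in>J'. (c0 i + c1 i) * (c0 j + c1 j) * K i j)"
      by (rule psd_kernelD(2)[OF K J'])
    also have "\<dots> = (\<Sum>i\<in>J'. (c0 i + c1 i) * (\<Sum>j\<in>J'. (c0 j + c1 j) * K i j))"
      by (simp add: sum_distrib_left mult.assoc)
    also have "\<dots> = (\<Sum>i\<in>J. c i * ((\<Sum>j\<in>J. c j * K i j) + d * K i k)) + d * ((\<Sum>j\<in>J. c j * K k j) + d * K k k)"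
      by (simp only: ss)
    also have "(\<Sum>j\<in>J. c j * K k j) = S" unfolding S_def by (simp add: psd_kernelD(1)[OF K, of k])
    also have "(\<Sum>i\<in>J. c i * ((\<Sum>j\<in>J. c j * K i j) + d * K i k)) = (\<Sum>i\<in>J. c i * (\<Sum>j\<in>J. c j * K i j)) + d * S"
      by (simp add: S_def distrib_left sum.distrib sum_distrib_left mult_ac)
    also have "\<dots> + d * (S + d * K k k) = (\<Sum>i\<in>J. c i * (\<Sum>j\<in>J. c j * K i j)) - S * S / K k k"
      using pos by (simp add: d_def field_simps)
    also have "\<dots> = (\<Sum>i\<in>J. \<Sum>j\<in>J. c i * c j * schur K k i j)"
    proof -
      have "S * S = (\<Sum>i\<in>J. \<Sum>j\<in>J. c i * c j * (K i k * K j k))"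
        unfolding S_def sum_product by (intro sum.cong refl) (simp add: mult_ac)
      then have "S * S / K k k = (\<Sum>i\<in>J. \<Sum>j\<in>J. c i * c j * (K i k * K j k / K k k))"
        by (simp add: sum_divide_distrib)
      then show ?thesis
        by (simp add: schur_def sum_distrib_left sum_subtractf right_diff_distrib mult_ac)
    qed
    finally show "(\<Sum>i\<in>J. \<Sum>j\<in>J. c i * c j * schur K k i j) \<ge> 0" .
  qed
qed

text \<open>
  The rows and columns of \<open>K\<close> are eliminated by repeated Schur complements; the columns of \<open>a\<close>
  record the rank-one kernels that are split off.
\<close>

lemma cholesky:
  fixes K :: "nat \<Rightarrow> nat \<Rightarrow> real"
  assumes K: "psd_kernel K"
  shows "\<exists>a. (\<forall>i k. i < k \<longrightarrow> a i k = 0) \<and> (\<forall>i j n. i < n \<longrightarrow> K i j = (\<Sum>k<n. a i k * a j k))"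
proof -
  define S where "S = rec_nat K (\<lambda>k L. schur L k)"
  have S0: "S 0 = K" and SS: "S (Suc k) = schur (S k) k" for k by (simp_all add: S_def)
  have psd: "psd_kernel (S k)" for k by (induction k) (simp_all add: S0 SS K psd_kernel_schur)
  have zero: "S k i j = 0" if "i < k" for i j k
    using that
  proof (induction k arbitrary: i j)
    case (Suc k)
    show ?case
    proof (cases "i < k")
      case True
      then show ?thesis using Suc.IH by (simp add: SS schur_def)
    next
      case False
      then have i: "i = k" using Suc.prems by simp
      show ?thesis
        using psd_kernel_zero_diag[OF psd[of k], of k j] psd_kernelD(1)[OF psd[of k], of k j]
        by (cases "S k k k = 0") (simp_all add: SS schur_def i)
    qed
  qed simp
  define a where "a i k = S k i k / sqrt (S k k k)" for i k
  have step: "S k i j = a i k * a j k + S (Suc k) i j" for i j k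
    using psd_kernelD(3)[OF psd[of k], of k] by (simp add: SS schur_def a_def)
  have tel: "K i j = (\<Sum>k<n. a i k * a j k) + S n i j" for i j n
  proof (induction n)
    case (Suc n)
    then show ?case using step[of n i j] by simp
  qed (simp add: S0)
  show ?thesis
  proof (intro exI[of _ a] conjI allI impI)
    show "a i k = 0" if "i < k" for i k using zero[OF that] by (simp add: a_def)
    show "K i j = (\<Sum>k<n. a i k * a j k)" if "i < n" for i j n using tel[of i j n] zero[OF that] by simp
  qed
qed

lemma std_normal_prob: "prob_space std_normal_distribution"
  using real_dist_normal_dist by (simp add: real_distribution_def)

lemma iid_normal_cf:
  defines "\<Omega> \<equiv> PiM UNIV (\<lambda>_::nat. std_normal_distribution)"
  shows "(CLINT \<omega>|\<Omega>. cis (\<Sum>k<n. b k * \<omega> k)) = of_real (exp (- (\<Sum>k<n. (b k)\<^sup>2) / 2))"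
proof -
  interpret N: prob_space std_normal_distribution by (rule std_normal_prob)
  interpret prod: product_prob_space "\<lambda>_::nat. std_normal_distribution" UNIV by unfold_locales
  interpret O: prob_space \<Omega> unfolding \<Omega>_def by (intro prob_space_PiM std_normal_prob)
  have sO: "sets \<Omega> = sets (PiM UNIV (\<lambda>_. borel))" unfolding \<Omega>_def by (intro sets_PiM_cong) auto
  have comp [measurable]: "(\<lambda>\<omega>. \<omega> k) \<in> borel_measurable \<Omega>" for k
    unfolding measurable_cong_sets[OF sO refl] by simp
  have dk: "distr \<Omega> borel (\<lambda>\<omega>. \<omega> k) = std_normal_distribution" for k
  proof -
    have "distr \<Omega> borel (\<lambda>\<omega>. \<omega> k) = distr \<Omega> std_normal_distribution (\<lambda>\<omega>. \<omega> k)"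
      by (rule distr_cong) auto
    also have "\<dots> = std_normal_distribution" unfolding \<Omega>_def
      by (rule distr_PiM_component) (auto intro: std_normal_prob)
    finally show ?thesis .
  qed
  have ind: "O.indep_vars (\<lambda>_. borel) (\<lambda>k \<omega>. \<omega> k) UNIV"
  proof (subst O.indep_vars_iff_distr_eq_PiM)
    have "distr \<Omega> (PiM UNIV (\<lambda>_. borel)) (\<lambda>x. \<lambda>i\<in>UNIV. x i) = distr \<Omega> \<Omega> (\<lambda>x. x)"
      by (rule distr_cong) (auto simp: sO)
    also have "\<dots> = PiM UNIV (\<lambda>i. distr \<Omega> borel (\<lambda>\<omega>. \<omega> i))" by (simp add: dk) (simp add: \<Omega>_def)
    finally show "distr \<Omega> (PiM UNIV (\<lambda>_. borel)) (\<lambda>x. \<lambda>i\<in>UNIV. x i) = PiM UNIV (\<lambda>i. distr \<Omega> borel (\<lambda>\<omega>. \<omega> i))" .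
  qed auto
  have ind': "O.indep_vars (\<lambda>_. borel) (\<lambda>k \<omega>. b k * \<omega> k) {..<n}"
    by (rule O.indep_vars_subset[OF O.indep_vars_compose2[OF ind, of "\<lambda>k x. b k * x"]]) auto
  have ch: "char (distr \<Omega> borel (\<lambda>\<omega>. b k * \<omega> k)) 1 = of_real (exp (- (b k)\<^sup>2 / 2))" for k
  proof -
    have "char (distr \<Omega> borel (\<lambda>\<omega>. b k * \<omega> k)) 1 = (CLINT \<omega>|\<Omega>. iexp (1 * (b k * \<omega> k)))"
      unfolding char_def by (rule integral_distr) auto
    also have "\<dots> = (CLINT \<omega>|\<Omega>. iexp (b k * \<omega> k))" by simp
    also have "\<dots> = char (distr \<Omega> borel (\<lambda>\<omega>. \<omega> k)) (b k)"
      unfolding char_def by (rule integral_distr[symmetric]) auto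
    also have "\<dots> = of_real (exp (- (b k)\<^sup>2 / 2))" by (simp add: dk char_std_normal_distribution)
    finally show ?thesis .
  qed
  have "(CLINT \<omega>|\<Omega>. cis (\<Sum>k<n. b k * \<omega> k)) = char (distr \<Omega> borel (\<lambda>\<omega>. \<Sum>k<n. b k * \<omega> k)) 1"
    unfolding char_def by (subst integral_distr) (auto simp: cis_conv_exp)
  also have "\<dots> = (\<Prod>k<n. char (distr \<Omega> borel (\<lambda>\<omega>. b k * \<omega> k)) 1)"
    by (rule O.char_distr_sum[OF ind'])
  also have "\<dots> = (\<Prod>k<n. of_real (exp (- (b k)\<^sup>2 / 2)))" by (simp only: ch)
  also have "\<dots> = of_real (exp (\<Sum>k<n. - (b k)\<^sup>2 / 2))" by (simp add: exp_sum)
  also have "(\<Sum>k<n. - (b k)\<^sup>2 / 2) = - (\<Sum>k<n. (b k)\<^sup>2) / 2" by (simp add: sum_negf sum_divide_distrib)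
  finally show ?thesis .
qed

text \<open>
  The law of the centred Gaussian process in which the values at \<open>g\<close> and \<open>h\<close> have covariance
  \<open>C (g - h)\<close>, given by the characteristic functions of its finite-dimensional distributions.
\<close>

definition gaussian_law :: "('g::ab_group_add \<Rightarrow> real) \<Rightarrow> ('g \<Rightarrow> real) measure \<Rightarrow> bool" where
  "gaussian_law C M \<longleftrightarrow> prob_space M \<and> sets M = sets (PiM UNIV (\<lambda>_. borel)) \<and>
     (\<forall>J t. finite J \<longrightarrow> (CLINT w|M. cis (\<Sum>g\<in>J. t g * w g)) =
        of_real (exp (- (\<Sum>g\<in>J. \<Sum>h\<in>J. t g * t h * C (g - h)) / 2)))"

text \<open>
  The Cholesky factor of the covariance, taken along an enumeration of the group, expresses the
  process by independent standard normal variables. As the factor is triangular, each coordinate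
  involves finitely many of them.
\<close>

lemma gaussian_law_exists:
  fixes C :: "'g::ab_group_add \<Rightarrow> real"
  assumes cnt: "countable (UNIV :: 'g set)" and C: "positive_definite C"
  shows "\<exists>M. gaussian_law C M"
proof -
  define en where "en = from_nat_into (UNIV :: 'g set)"
  define idx where "idx = to_nat_on (UNIV :: 'g set)"
  have en: "en (idx g) = g" for g using cnt by (simp add: en_def idx_def)
  define K where "K i j = C (en i - en j)" for i j
  have K: "psd_kernel K" unfolding psd_kernel_def
  proof (intro conjI allI impI)
    fix i j
    show "K i j = K j i" using C minus_diff_eq[of "en i" "en j"] unfolding positive_definite_def K_def by metis
  next
    fix J :: "nat set" and c :: "nat \<Rightarrow> real" assume J: "finite J"
    show "(\<Sum>i\<in>J. \<Sum>j\<in>J. c i * c j * K i j) \<ge> 0"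
      using C J unfolding K_def quadratic_form_group_weights[OF J, of c "\<lambda>g h. C (g - h)" en]
      by (simp add: positive_definite_def)
  qed
  obtain a where a: "\<And>i k. i < k \<Longrightarrow> a i k = 0" "\<And>i j n. i < n \<Longrightarrow> K i j = (\<Sum>k<n. a i k * a j k)"
    using cholesky[OF K] by blast
  define \<Omega> where "\<Omega> = PiM UNIV (\<lambda>_::nat. std_normal_distribution)"
  define Z where "Z \<omega> g = (\<Sum>k<Suc (idx g). a (idx g) k * \<omega> k)" for \<omega> g
  have pO: "prob_space \<Omega>" unfolding \<Omega>_def by (intro prob_space_PiM std_normal_prob)
  have sO: "sets \<Omega> = sets (PiM UNIV (\<lambda>_. borel))" unfolding \<Omega>_def by (intro sets_PiM_cong) auto
  have comp [measurable]: "(\<lambda>\<omega>. \<omega> k) \<in> borel_measurable \<Omega>" for k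
    unfolding measurable_cong_sets[OF sO refl] by simp
  have Zm: "Z \<in> \<Omega> \<rightarrow>\<^sub>M PiM UNIV (\<lambda>_. borel)"
    unfolding Z_def by (rule measurable_PiM_single') (auto simp: space_PiM)
  define M where "M = distr \<Omega> (PiM UNIV (\<lambda>_. borel)) Z"
  have "gaussian_law C M" unfolding gaussian_law_def
  proof (intro conjI allI impI)
    show "prob_space M" unfolding M_def by (rule prob_space.prob_space_distr[OF pO Zm])
    show "sets M = sets (PiM UNIV (\<lambda>_. borel))" by (simp add: M_def)
    fix J :: "'g set" and t assume J: "finite J"
    obtain n where n: "\<And>g. g \<in> J \<Longrightarrow> idx g < n"
      using finite_nat_set_iff_bounded[of "idx ` J"] J by auto
    define b where "b k = (\<Sum>g\<in>J. t g * a (idx g) k)" for k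
    have Zn: "Z \<omega> g = (\<Sum>k<n. a (idx g) k * \<omega> k)" if "g \<in> J" for \<omega> g
      unfolding Z_def by (rule sum.mono_neutral_left) (use n[OF that] a(1) in \<open>auto simp: not_less\<close>)
    have lin: "(\<Sum>g\<in>J. t g * Z \<omega> g) = (\<Sum>k<n. b k * \<omega> k)" for \<omega>
    proof -
      have "(\<Sum>g\<in>J. t g * Z \<omega> g) = (\<Sum>g\<in>J. \<Sum>k<n. t g * a (idx g) k * \<omega> k)"
        by (intro sum.cong refl) (simp add: Zn sum_distrib_left mult.assoc)
      also have "\<dots> = (\<Sum>k<n. \<Sum>g\<in>J. t g * a (idx g) k * \<omega> k)" by (rule sum.swap)
      also have "\<dots> = (\<Sum>k<n. b k * \<omega> k)" by (simp add: b_def sum_distrib_right)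
      finally show ?thesis .
    qed
    have "(\<Sum>k<n. (b k)\<^sup>2) = (\<Sum>k<n. \<Sum>g\<in>J. \<Sum>h\<in>J. t g * t h * (a (idx g) k * a (idx h) k))"
      unfolding b_def power2_eq_square sum_product by (simp add: mult_ac)
    also have "\<dots> = (\<Sum>g\<in>J. \<Sum>k<n. \<Sum>h\<in>J. t g * t h * (a (idx g) k * a (idx h) k))" by (rule sum.swap)
    also have "\<dots> = (\<Sum>g\<in>J. \<Sum>h\<in>J. \<Sum>k<n. t g * t h * (a (idx g) k * a (idx h) k))"
      by (intro sum.cong refl) (rule sum.swap)
    also have "\<dots> = (\<Sum>g\<in>J. \<Sum>h\<in>J. t g * t h * C (g - h))"
    proof (intro sum.cong refl)
      fix g h assume "g \<in> J"
      then have "C (g - h) = (\<Sum>k<n. a (idx g) k * a (idx h) k)"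
        using a(2)[OF n, of g "idx h"] by (simp add: K_def en)
      then show "(\<Sum>k<n. t g * t h * (a (idx g) k * a (idx h) k)) = t g * t h * C (g - h)"
        by (simp add: sum_distrib_left)
    qed
    finally have var: "(\<Sum>k<n. (b k)\<^sup>2) = (\<Sum>g\<in>J. \<Sum>h\<in>J. t g * t h * C (g - h))" .
    have "(CLINT w|M. cis (\<Sum>g\<in>J. t g * w g)) = (CLINT \<omega>|\<Omega>. cis (\<Sum>g\<in>J. t g * Z \<omega> g))"
      unfolding M_def
    proof (rule integral_distr[OF Zm])
      have "(\<lambda>w. \<Sum>g\<in>J. t g * w g) \<in> borel_measurable (PiM UNIV (\<lambda>_. borel))" by measurable
      moreover have "cis \<in> borel_measurable borel" by (intro borel_measurable_continuous_onI continuous_intros)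
      ultimately show "(\<lambda>w. cis (\<Sum>g\<in>J. t g * w g)) \<in> borel_measurable (PiM UNIV (\<lambda>_. borel))"
        by (rule measurable_compose)
    qed
    also have "\<dots> = (CLINT \<omega>|\<Omega>. cis (\<Sum>k<n. b k * \<omega> k))" by (simp only: lin)
    also have "\<dots> = of_real (exp (- (\<Sum>g\<in>J. \<Sum>h\<in>J. t g * t h * C (g - h)) / 2))"
      unfolding \<Omega>_def iid_normal_cf var ..
    finally show "(CLINT w|M. cis (\<Sum>g\<in>J. t g * w g)) = of_real (exp (- (\<Sum>g\<in>J. \<Sum>h\<in>J. t g * t h * C (g - h)) / 2))" .
  qed
  then show ?thesis by blast
qed

section \<open>Convergence of orthant probabilities\<close>

lemma borel_measurable_cis [measurable]: "cis \<in> borel_measurable borel"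
  by (intro borel_measurable_continuous_onI continuous_intros)

text \<open>
  The law of \<open>Y\<close> under the measure with density proportional to \<open>u\<close>. Its characteristic and
  distribution functions are weighted integrals, to which theorems on laws on the line become
  applicable; the lower bound on \<open>u\<close> keeps the normalizing constant away from \<open>0\<close>.
\<close>

lemma tilted_law_exists:
  fixes N :: "'c measure"
  assumes N: "prob_space N" and u [measurable]: "u \<in> borel_measurable N" and Y [measurable]: "Y \<in> borel_measurable N"
    and ub: "\<And>x. 1 \<le> u x \<and> u x \<le> (3::real)"
  shows "\<exists>\<nu>. real_distribution \<nu> \<and> (\<forall>s. char \<nu> s = (CLINT x|N. of_real (u x) * cis (s * Y x)) / of_real (LINT x|N. u x)) \<and>
      (\<forall>c. cdf \<nu> c = (LINT x|N. u x * (if Y x \<le> c then 1 else 0)) / (LINT x|N. u x)) \<and> (LINT x|N. u x) \<ge> 1 \<and>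
      (\<forall>c. measure N {x\<in>space N. Y x = c} = 0 \<longrightarrow> measure \<nu> {c} = 0)"
proof -
  interpret N: prob_space N by fact
  have iu: "integrable N u"
  proof (rule N.integrable_const_bound[of _ 3])
    have "\<bar>u x\<bar> \<le> 3" for x using ub[of x] by linarith
    then show "AE x in N. norm (u x) \<le> 3" by simp
  qed simp
  define c0 where "c0 = (LINT x|N. u x)"
  have "(LINT x|N. 1) \<le> c0" unfolding c0_def by (intro integral_mono iu) (use ub in auto)
  then have c0: "c0 \<ge> 1" by (simp add: N.prob_space)
  define D where "D = density N (\<lambda>x. ennreal (u x / c0))"
  have un: "0 \<le> u x / c0" for x using ub[of x] c0 by (intro divide_nonneg_nonneg) auto
  have iuc: "integrable N (\<lambda>x. u x / c0)" using iu by simp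
  have pD: "prob_space D"
  proof
    have "emeasure D (space D) = (\<integral>\<^sup>+x. ennreal (u x / c0) \<partial>N)"
      unfolding D_def by (subst emeasure_density) (auto intro!: nn_integral_cong)
    also have "\<dots> = ennreal (LINT x|N. u x / c0)" by (rule nn_integral_eq_integral[OF iuc]) (use un in auto)
    also have "(LINT x|N. u x / c0) = 1" using c0 by (simp add: c0_def)
    finally show "emeasure D (space D) = 1" by simp
  qed
  have YD [measurable]: "Y \<in> borel_measurable D" by (simp add: D_def)
  define \<nu> where "\<nu> = distr D borel Y"
  have "real_distribution \<nu>" unfolding \<nu>_def
    using prob_space.prob_space_distr[OF pD YD] by (simp add: real_distribution_def real_distribution_axioms_def)
  moreover have "char \<nu> s = (CLINT x|N. of_real (u x) * cis (s * Y x)) / of_real c0" for s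
  proof -
    have "char \<nu> s = (CLINT x|D. cis (s * Y x))"
      unfolding char_def \<nu>_def by (subst integral_distr) (auto simp: cis_conv_exp)
    also have "\<dots> = (CLINT x|N. (u x / c0) *\<^sub>R cis (s * Y x))"
      unfolding D_def by (rule integral_density) (use un in auto)
    also have "\<dots> = (CLINT x|N. of_real (u x) * cis (s * Y x) / of_real c0)"
      by (simp add: scaleR_conv_of_real)
    also have "\<dots> = (CLINT x|N. of_real (u x) * cis (s * Y x)) / of_real c0" by simp
    finally show ?thesis .
  qed
  moreover have cdf: "measure \<nu> A = (LINT x|N. u x * indicator A (Y x)) / c0" if A: "A \<in> sets borel" for A
  proof -
    interpret D: prob_space D by (rule pD)
    have "measure \<nu> A = measure D (Y -` A \<inter> space D)" unfolding \<nu>_def by (rule measure_distr) (use A in auto)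
    also have "\<dots> = (LINT x|D. indicator (Y -` A \<inter> space D) x)" by simp
    also have "\<dots> = (LINT x|D. indicator A (Y x))"
      by (intro Bochner_Integration.integral_cong) (auto simp: indicator_def)
    also have "\<dots> = (LINT x|N. (u x / c0) *\<^sub>R indicator A (Y x))"
      unfolding D_def by (rule integral_density) (use un A in auto)
    also have "\<dots> = (LINT x|N. u x * indicator A (Y x) / c0)" by (simp add: mult.commute)
    also have "\<dots> = (LINT x|N. u x * indicator A (Y x)) / c0" by simp
    finally show ?thesis .
  qed
  moreover have "cdf \<nu> c = (LINT x|N. u x * (if Y x \<le> c then 1 else 0)) / c0" for c
  proof -
    have "cdf \<nu> c = (LINT x|N. u x * indicator {..c} (Y x)) / c0" unfolding cdf_def by (rule cdf) simp
    also have "(\<lambda>x. u x * indicator {..c} (Y x)) = (\<lambda>x. u x * (if Y x \<le> c then 1 else 0))"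
      by (auto simp: indicator_def)
    finally show ?thesis .
  qed
  moreover have "measure \<nu> {c} = 0" if "measure N {x\<in>space N. Y x = c} = 0" for c
  proof -
    have "AE x in N. Y x \<noteq> c"
      using that by (subst AE_iff_measurable[OF _ refl]) (auto simp: N.emeasure_eq_measure)
    then have "(LINT x|N. u x * indicator {c} (Y x)) = (LINT x|N. 0)"
      by (intro integral_cong_AE) auto
    then show ?thesis using cdf[of "{c}"] by simp
  qed
  ultimately show ?thesis using c0 by (intro exI[of _ \<nu>]) (simp add: c0_def)
qed

text \<open>
  Levy's continuity theorem for the laws tilted by the weights; the total masses converge by the
  case \<open>s = 0\<close>.
\<close>

lemma weighted_cdf_convergence_pos:
  fixes P :: "'a measure" and Q :: "'b measure"
  assumes P: "prob_space P" and Q: "prob_space Q"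
    and wn [measurable]: "\<And>n. wn n \<in> borel_measurable P" and w [measurable]: "w \<in> borel_measurable Q"
    and Zn [measurable]: "\<And>n. Zn n \<in> borel_measurable P" and Z [measurable]: "Z \<in> borel_measurable Q"
    and bn: "\<And>n x. 1 \<le> wn n x \<and> wn n x \<le> (3::real)" and b: "\<And>x. 1 \<le> w x \<and> w x \<le> (3::real)"
    and cv: "\<And>s. (\<lambda>n. CLINT x|P. of_real (wn n x) * cis (s * Zn n x)) \<longlonglongrightarrow> (CLINT x|Q. of_real (w x) * cis (s * Z x))"
    and atom: "measure Q {x\<in>space Q. Z x = a} = 0"
  shows "(\<lambda>n. LINT x|P. wn n x * (if Zn n x \<le> a then 1 else 0)) \<longlonglongrightarrow> (LINT x|Q. w x * (if Z x \<le> a then 1 else 0))"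
proof -
  interpret P: prob_space P by fact
  interpret Q: prob_space Q by fact
  have "\<exists>\<nu>. real_distribution \<nu> \<and> (\<forall>s. char \<nu> s = (CLINT x|P. of_real (wn n x) * cis (s * Zn n x)) / of_real (LINT x|P. wn n x)) \<and>
      (\<forall>c. cdf \<nu> c = (LINT x|P. wn n x * (if Zn n x \<le> c then 1 else 0)) / (LINT x|P. wn n x)) \<and> (LINT x|P. wn n x) \<ge> 1" for n
    using tilted_law_exists[OF P wn Zn bn, of n n] by blast
  then obtain \<nu>n where \<nu>n: "\<And>n. real_distribution (\<nu>n n)"
    "\<And>n s. char (\<nu>n n) s = (CLINT x|P. of_real (wn n x) * cis (s * Zn n x)) / of_real (LINT x|P. wn n x)"
    "\<And>n c. cdf (\<nu>n n) c = (LINT x|P. wn n x * (if Zn n x \<le> c then 1 else 0)) / (LINT x|P. wn n x)"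
    "\<And>n. (LINT x|P. wn n x) \<ge> 1" by metis
  obtain \<nu> where \<nu>: "real_distribution \<nu>"
    "\<And>s. char \<nu> s = (CLINT x|Q. of_real (w x) * cis (s * Z x)) / of_real (LINT x|Q. w x)"
    "\<And>c. cdf \<nu> c = (LINT x|Q. w x * (if Z x \<le> c then 1 else 0)) / (LINT x|Q. w x)" "(LINT x|Q. w x) \<ge> 1"
    "\<And>c. measure Q {x\<in>space Q. Z x = c} = 0 \<Longrightarrow> measure \<nu> {c} = 0"
    using tilted_law_exists[OF Q w Z b] by blast
  have "(\<lambda>n. Re (CLINT x|P. of_real (wn n x) * cis (0 * Zn n x))) \<longlonglongrightarrow> Re (CLINT x|Q. of_real (w x) * cis (0 * Z x))"
    by (intro tendsto_Re cv)
  then have mass: "(\<lambda>n. LINT x|P. wn n x) \<longlonglongrightarrow> (LINT x|Q. w x)"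
    by simp
  have "(\<lambda>n. char (\<nu>n n) s) \<longlonglongrightarrow> char \<nu> s" for s
    unfolding \<nu>n(2) \<nu>(2) using \<nu>(4) by (intro tendsto_divide cv tendsto_of_real mass) auto
  then have "weak_conv_m \<nu>n \<nu>" by (rule levy_continuity[OF \<nu>n(1) \<nu>(1)])
  moreover have "isCont (cdf \<nu>) a"
  proof -
    interpret real_distribution \<nu> by (rule \<nu>(1))
    show ?thesis using \<nu>(5)[OF atom] by (simp add: isCont_cdf)
  qed
  ultimately have "(\<lambda>n. cdf (\<nu>n n) a) \<longlonglongrightarrow> cdf \<nu> a" by (simp add: weak_conv_m_def weak_conv_def)
  then have "(\<lambda>n. cdf (\<nu>n n) a * (LINT x|P. wn n x)) \<longlonglongrightarrow> cdf \<nu> a * (LINT x|Q. w x)"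
    by (rule tendsto_mult[OF _ mass])
  moreover have "cdf (\<nu>n n) a * (LINT x|P. wn n x) = (LINT x|P. wn n x * (if Zn n x \<le> a then 1 else 0))" for n
    using \<nu>n(4)[of n] by (simp add: \<nu>n(3))
  moreover have "cdf \<nu> a * (LINT x|Q. w x) = (LINT x|Q. w x * (if Z x \<le> a then 1 else 0))"
    using \<nu>(4) by (simp add: \<nu>(3))
  ultimately show ?thesis by simp
qed

text \<open>
  Weights of arbitrary sign are reduced to positive ones by taking the difference of the statements
  for \<open>2 + W\<close> and for \<open>2\<close>.
\<close>

lemma weighted_cdf_convergence:
  fixes P :: "'a measure" and Q :: "'b measure"
  assumes P: "prob_space P" and Q: "prob_space Q"
    and Wn [measurable]: "\<And>n. Wn n \<in> borel_measurable P" and W [measurable]: "W \<in> borel_measurable Q"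
    and Zn [measurable]: "\<And>n. Zn n \<in> borel_measurable P" and Z [measurable]: "Z \<in> borel_measurable Q"
    and bn: "\<And>n x. \<bar>Wn n x\<bar> \<le> (1::real)" and b: "\<And>x. \<bar>W x\<bar> \<le> (1::real)"
    and cvW: "\<And>s. (\<lambda>n. CLINT x|P. of_real (Wn n x) * cis (s * Zn n x)) \<longlonglongrightarrow> (CLINT x|Q. of_real (W x) * cis (s * Z x))"
    and cv: "\<And>s. (\<lambda>n. CLINT x|P. cis (s * Zn n x)) \<longlonglongrightarrow> (CLINT x|Q. cis (s * Z x))"
    and atom: "measure Q {x\<in>space Q. Z x = a} = 0"
  shows "(\<lambda>n. LINT x|P. Wn n x * (if Zn n x \<le> a then 1 else 0)) \<longlonglongrightarrow> (LINT x|Q. W x * (if Z x \<le> a then 1 else 0))"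
proof -
  interpret P: prob_space P by fact
  interpret Q: prob_space Q by fact
  have iP: "integrable P (\<lambda>x. of_real (Wn n x) * cis (s * Zn n x))" "integrable P (\<lambda>x. cis (s * Zn n x))" for n s
    by (rule P.integrable_const_bound[of _ 1]; use bn in \<open>auto simp: norm_mult\<close>)+
  have iQ: "integrable Q (\<lambda>x. of_real (W x) * cis (s * Z x))" "integrable Q (\<lambda>x. cis (s * Z x))" for s
    by (rule Q.integrable_const_bound[of _ 1]; use b in \<open>auto simp: norm_mult\<close>)+
  have jP: "integrable P (\<lambda>x. Wn n x * (if Zn n x \<le> a then 1 else 0))" "integrable P (\<lambda>x. if Zn n x \<le> a then 1 else 0 :: real)" for n
    by (rule P.integrable_const_bound[of _ 1]; use bn in \<open>auto\<close>)+
  have jQ: "integrable Q (\<lambda>x. W x * (if Z x \<le> a then 1 else 0))" "integrable Q (\<lambda>x. if Z x \<le> a then 1 else 0 :: real)"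
    by (rule Q.integrable_const_bound[of _ 1]; use b in \<open>auto\<close>)+
  have eP: "(CLINT x|P. of_real (2 + Wn n x) * cis (s * Zn n x)) = 2 * (CLINT x|P. cis (s * Zn n x)) + (CLINT x|P. of_real (Wn n x) * cis (s * Zn n x))" for n s
    by (simp add: distrib_right iP)
  have eQ: "(CLINT x|Q. of_real (2 + W x) * cis (s * Z x)) = 2 * (CLINT x|Q. cis (s * Z x)) + (CLINT x|Q. of_real (W x) * cis (s * Z x))" for s
    by (simp add: distrib_right iQ)
  have "(\<lambda>n. LINT x|P. (2 + Wn n x) * (if Zn n x \<le> a then 1 else 0)) \<longlonglongrightarrow> (LINT x|Q. (2 + W x) * (if Z x \<le> a then 1 else 0))"
  proof (rule weighted_cdf_convergence_pos[OF P Q _ _ Zn Z _ _ _ atom])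
    show "(\<lambda>n. CLINT x|P. of_real (2 + Wn n x) * cis (s * Zn n x)) \<longlonglongrightarrow> (CLINT x|Q. of_real (2 + W x) * cis (s * Z x))" for s
      unfolding eP eQ by (intro tendsto_intros cvW cv)
    show "1 \<le> 2 + Wn n x \<and> 2 + Wn n x \<le> 3" for n x using bn[of n x] by linarith
    show "1 \<le> 2 + W x \<and> 2 + W x \<le> 3" for x using b[of x] by linarith
  qed auto
  moreover have "(\<lambda>n. LINT x|P. (2::real) * (if Zn n x \<le> a then 1 else 0)) \<longlonglongrightarrow> (LINT x|Q. (2::real) * (if Z x \<le> a then 1 else 0))"
  proof (rule weighted_cdf_convergence_pos[OF P Q _ _ Zn Z _ _ _ atom])
    show "(\<lambda>n. CLINT x|P. of_real 2 * cis (s * Zn n x)) \<longlonglongrightarrow> (CLINT x|Q. of_real 2 * cis (s * Z x))" for s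
      using cv[of s] by (simp add: tendsto_mult_left)
  qed auto
  ultimately have "(\<lambda>n. (LINT x|P. (2 + Wn n x) * (if Zn n x \<le> a then 1 else 0)) - (LINT x|P. (2::real) * (if Zn n x \<le> a then 1 else 0)))
      \<longlonglongrightarrow> (LINT x|Q. (2 + W x) * (if Z x \<le> a then 1 else 0)) - (LINT x|Q. (2::real) * (if Z x \<le> a then 1 else 0))"
    by (rule tendsto_diff)
  moreover have "(LINT x|P. (2 + Wn n x) * (if Zn n x \<le> a then 1 else 0)) - (LINT x|P. (2::real) * (if Zn n x \<le> a then 1 else 0))
      = (LINT x|P. Wn n x * (if Zn n x \<le> a then 1 else 0))" for n
    unfolding distrib_right by (simp add: jP)
  moreover have "(LINT x|Q. (2 + W x) * (if Z x \<le> a then 1 else 0)) - (LINT x|Q. (2::real) * (if Z x \<le> a then 1 else 0))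
      = (LINT x|Q. W x * (if Z x \<le> a then 1 else 0))"
    unfolding distrib_right by (simp add: jQ)
  ultimately show ?thesis by simp
qed

text \<open>
  A multidimensional continuity theorem, obtained from the one-dimensional one by treating the
  coordinates one at a time. The induction inserts the indicator functions of more and more
  coordinates into the integrals of \<open>cis (\<Sum>i. t i * X i)\<close>: for the next coordinate, the real and
  imaginary parts are weighted distribution functions, with the indicators already present times a
  cosine or sine as weights.
\<close>

lemma orthant_convergence:
  fixes P :: "'a measure" and Q :: "'b measure" and X :: "nat \<Rightarrow> 'i \<Rightarrow> 'a \<Rightarrow> real" and Y :: "'i \<Rightarrow> 'b \<Rightarrow> real"
  assumes P: "prob_space P" and Q: "prob_space Q" and I: "finite I"
    and X [measurable]: "\<And>n i. X n i \<in> borel_measurable P" and Y [measurable]: "\<And>i. Y i \<in> borel_measurable Q"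
    and cf: "\<And>t. (\<lambda>n. CLINT x|P. cis (\<Sum>i\<in>I. t i * X n i x)) \<longlonglongrightarrow> (CLINT x|Q. cis (\<Sum>i\<in>I. t i * Y i x))"
    and atom: "\<And>i. i \<in> I \<Longrightarrow> measure Q {x\<in>space Q. Y i x = a i} = 0"
  shows "(\<lambda>n. measure P {x\<in>space P. \<forall>i\<in>I. X n i x \<le> a i}) \<longlonglongrightarrow> measure Q {x\<in>space Q. \<forall>i\<in>I. Y i x \<le> a i}"
proof -
  interpret P: prob_space P by fact
  interpret Q: prob_space Q by fact
  define IX where "IX n K x = (\<Prod>i\<in>K. if X n i x \<le> a i then 1 else 0 :: real)" for n K x
  define IY where "IY K x = (\<Prod>i\<in>K. if Y i x \<le> a i then 1 else 0 :: real)" for K x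
  define lX where "lX t n x = (\<Sum>i\<in>I. t i * X n i x)" for t n x
  define lY where "lY t x = (\<Sum>i\<in>I. t i * Y i x)" for t x
  have [measurable]: "IX n K \<in> borel_measurable P" for n K unfolding IX_def by measurable
  have [measurable]: "IY K \<in> borel_measurable Q" for K unfolding IY_def by measurable
  have [measurable]: "lX t n \<in> borel_measurable P" for t n unfolding lX_def by measurable
  have [measurable]: "lY t \<in> borel_measurable Q" for t unfolding lY_def by measurable
  have IXb: "\<bar>IX n K x\<bar> \<le> 1" "0 \<le> IX n K x" for n K x
    unfolding IX_def abs_prod by (auto intro!: prod_le_1 prod_nonneg)
  have IYb: "\<bar>IY K x\<bar> \<le> 1" "0 \<le> IY K x" for K x
    unfolding IY_def abs_prod by (auto intro!: prod_le_1 prod_nonneg)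
  have key: "(\<lambda>n. CLINT x|P. of_real (IX n K x) * cis (lX t n x)) \<longlonglongrightarrow> (CLINT x|Q. of_real (IY K x) * cis (lY t x))"
    if "K \<subseteq> I" for K t
    using finite_subset[OF that I] that
  proof (induction K arbitrary: t rule: finite_induct)
    case empty
    then show ?case using cf[of t] by (simp add: IX_def IY_def lX_def lY_def)
  next
    case (insert k K)
    have k: "k \<in> I" and KI: "K \<subseteq> I" using insert.prems by auto
    have IH: "(\<lambda>n. CLINT x|P. of_real (IX n K x) * cis (lX t n x)) \<longlonglongrightarrow> (CLINT x|Q. of_real (IY K x) * cis (lY t x))" for t
      by (rule insert.IH[OF KI])
    \<comment> \<open>The frequency vectors \<open>\<sigma> t + s k\<close>, with \<open>k\<close> standing for the unit vector, express the
      product of a cosine or sine of \<open>lX t\<close> with \<open>cis (s * X k)\<close> by two exponentials with signs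
      \<open>\<sigma> = 1\<close> and \<open>\<sigma> = - 1\<close>.\<close>
    define e where "e \<sigma> s i = \<sigma> * t i + (if i = k then s else 0)" for \<sigma> s :: real and i
    have lXe: "lX (e \<sigma> s) n x = \<sigma> * lX t n x + s * X n k x" for \<sigma> s n x
    proof -
      have "lX (e \<sigma> s) n x = (\<Sum>i\<in>I. \<sigma> * (t i * X n i x) + (if i = k then s * X n i x else 0))"
        unfolding lX_def e_def by (intro sum.cong) (auto simp: algebra_simps)
      also have "\<dots> = \<sigma> * lX t n x + s * X n k x"
        using I k by (simp add: sum.distrib lX_def sum_distrib_left)
      finally show ?thesis .
    qed
    have lYe: "lY (e \<sigma> s) x = \<sigma> * lY t x + s * Y k x" for \<sigma> s x
    proof -
      have "lY (e \<sigma> s) x = (\<Sum>i\<in>I. \<sigma> * (t i * Y i x) + (if i = k then s * Y i x else 0))"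
        unfolding lY_def e_def by (intro sum.cong) (auto simp: algebra_simps)
      also have "\<dots> = \<sigma> * lY t x + s * Y k x"
        using I k by (simp add: sum.distrib lY_def sum_distrib_left)
      finally show ?thesis .
    qed
    have plain: "(\<lambda>n. CLINT x|P. cis (s * X n k x)) \<longlonglongrightarrow> (CLINT x|Q. cis (s * Y k x))" for s
      using cf[of "e 0 s"] unfolding lX_def[symmetric] lY_def[symmetric] lXe lYe by simp
    have ccos: "of_real (cos \<theta>) * cis \<phi> = (cis (1 * \<theta> + \<phi>) + cis (- 1 * \<theta> + \<phi>)) / 2" for \<theta> \<phi>
      by (simp add: complex_eq_iff cos_add sin_add cos_diff sin_diff)
    have csin: "of_real (sin \<theta>) * cis \<phi> = (cis (1 * \<theta> + \<phi>) - cis (- 1 * \<theta> + \<phi>)) * (- \<i> / 2)" for \<theta> \<phi>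
      by (simp add: complex_eq_iff cos_add sin_add cos_diff sin_diff)
    have iP: "integrable P (\<lambda>x. of_real (IX n L x) * cis (lX t n x))" for n L t
      by (rule P.integrable_const_bound[of _ 1]) (use IXb in \<open>auto simp: norm_mult\<close>)
    have iQ: "integrable Q (\<lambda>x. of_real (IY L x) * cis (lY t x))" for L t
      by (rule Q.integrable_const_bound[of _ 1]) (use IYb in \<open>auto simp: norm_mult\<close>)
    have cvc: "(\<lambda>n. CLINT x|P. of_real (IX n K x * cos (lX t n x)) * cis (s * X n k x))
        \<longlonglongrightarrow> (CLINT x|Q. of_real (IY K x * cos (lY t x)) * cis (s * Y k x))" for s
    proof -
      have "(CLINT x|P. of_real (IX n K x * cos (lX t n x)) * cis (s * X n k x))
          = ((CLINT x|P. of_real (IX n K x) * cis (lX (e 1 s) n x)) + (CLINT x|P. of_real (IX n K x) * cis (lX (e (-1) s) n x))) / 2" for n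
      proof -
        have pw: "of_real (IX n K x * cos (lX t n x)) * cis (s * X n k x)
          = (of_real (IX n K x) * cis (lX (e 1 s) n x) + of_real (IX n K x) * cis (lX (e (-1) s) n x)) / 2" for x
          unfolding lXe lYe of_real_mult mult.assoc ccos by (simp only: distrib_left times_divide_eq_right)
        show ?thesis unfolding pw by (simp add: iP)
      qed
      moreover have "(CLINT x|Q. of_real (IY K x * cos (lY t x)) * cis (s * Y k x))
          = ((CLINT x|Q. of_real (IY K x) * cis (lY (e 1 s) x)) + (CLINT x|Q. of_real (IY K x) * cis (lY (e (-1) s) x))) / 2"
      proof -
        have pw: "of_real (IY K x * cos (lY t x)) * cis (s * Y k x)
          = (of_real (IY K x) * cis (lY (e 1 s) x) + of_real (IY K x) * cis (lY (e (-1) s) x)) / 2" for x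
          unfolding lXe lYe of_real_mult mult.assoc ccos by (simp only: distrib_left times_divide_eq_right)
        show ?thesis unfolding pw by (simp add: iQ)
      qed
      ultimately show ?thesis by (simp only:) (intro tendsto_intros IH, simp)
    qed
    have cvs: "(\<lambda>n. CLINT x|P. of_real (IX n K x * sin (lX t n x)) * cis (s * X n k x))
        \<longlonglongrightarrow> (CLINT x|Q. of_real (IY K x * sin (lY t x)) * cis (s * Y k x))" for s
    proof -
      have "(CLINT x|P. of_real (IX n K x * sin (lX t n x)) * cis (s * X n k x))
          = ((CLINT x|P. of_real (IX n K x) * cis (lX (e 1 s) n x)) - (CLINT x|P. of_real (IX n K x) * cis (lX (e (-1) s) n x))) * (- \<i> / 2)" for n
      proof -
        have pw: "of_real (IX n K x * sin (lX t n x)) * cis (s * X n k x)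
          = (of_real (IX n K x) * cis (lX (e 1 s) n x) - of_real (IX n K x) * cis (lX (e (-1) s) n x)) * (- \<i> / 2)" for x
          unfolding lXe lYe of_real_mult mult.assoc csin by (simp only: left_diff_distrib right_diff_distrib mult.assoc)
        show ?thesis unfolding pw by (simp add: iP)
      qed
      moreover have "(CLINT x|Q. of_real (IY K x * sin (lY t x)) * cis (s * Y k x))
          = ((CLINT x|Q. of_real (IY K x) * cis (lY (e 1 s) x)) - (CLINT x|Q. of_real (IY K x) * cis (lY (e (-1) s) x))) * (- \<i> / 2)"
      proof -
        have pw: "of_real (IY K x * sin (lY t x)) * cis (s * Y k x)
          = (of_real (IY K x) * cis (lY (e 1 s) x) - of_real (IY K x) * cis (lY (e (-1) s) x)) * (- \<i> / 2)" for x
          unfolding lXe lYe of_real_mult mult.assoc csin by (simp only: left_diff_distrib right_diff_distrib mult.assoc)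
        show ?thesis unfolding pw by (simp add: iQ)
      qed
      ultimately show ?thesis by (simp only:) (intro tendsto_intros IH)
    qed
    have bb: "\<bar>IX n K x * cos \<theta>\<bar> \<le> 1" "\<bar>IX n K x * sin \<theta>\<bar> \<le> 1" "\<bar>IY K y * cos \<theta>\<bar> \<le> 1" "\<bar>IY K y * sin \<theta>\<bar> \<le> 1" for n x y \<theta>
      using IXb[of n K x] IYb[of K y] by (auto simp: abs_mult intro!: mult_le_one)
    have rc: "(\<lambda>n. LINT x|P. IX n K x * cos (lX t n x) * (if X n k x \<le> a k then 1 else 0))
        \<longlonglongrightarrow> (LINT x|Q. IY K x * cos (lY t x) * (if Y k x \<le> a k then 1 else 0))"
      by (rule weighted_cdf_convergence[OF P Q _ _ X Y _ _ cvc plain atom[OF k]]) (use bb in auto)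
    have rs: "(\<lambda>n. LINT x|P. IX n K x * sin (lX t n x) * (if X n k x \<le> a k then 1 else 0))
        \<longlonglongrightarrow> (LINT x|Q. IY K x * sin (lY t x) * (if Y k x \<le> a k then 1 else 0))"
      by (rule weighted_cdf_convergence[OF P Q _ _ X Y _ _ cvs plain atom[OF k]]) (use bb in auto)
    have insX: "IX n (insert k K) x = IX n K x * (if X n k x \<le> a k then 1 else 0)" for n x
      unfolding IX_def prod.insert[OF insert.hyps] by (rule mult.commute)
    have insY: "IY (insert k K) x = IY K x * (if Y k x \<le> a k then 1 else 0)" for x
      unfolding IY_def prod.insert[OF insert.hyps] by (rule mult.commute)
    have sX: "(CLINT x|P. of_real (IX n (insert k K) x) * cis (lX t n x))
       = Complex (LINT x|P. IX n K x * cos (lX t n x) * (if X n k x \<le> a k then 1 else 0)) (LINT x|P. IX n K x * sin (lX t n x) * (if X n k x \<le> a k then 1 else 0))" for n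
    proof -
      have "Re (CLINT x|P. of_real (IX n (insert k K) x) * cis (lX t n x)) = (LINT x|P. Re (of_real (IX n (insert k K) x) * cis (lX t n x)))"
        by (rule integral_Re[OF iP, symmetric])
      moreover have "Im (CLINT x|P. of_real (IX n (insert k K) x) * cis (lX t n x)) = (LINT x|P. Im (of_real (IX n (insert k K) x) * cis (lX t n x)))"
        by (rule integral_Im[OF iP, symmetric])
      ultimately show ?thesis by (simp add: complex_eq_iff insX mult_ac)
    qed
    have sY: "(CLINT x|Q. of_real (IY (insert k K) x) * cis (lY t x))
       = Complex (LINT x|Q. IY K x * cos (lY t x) * (if Y k x \<le> a k then 1 else 0)) (LINT x|Q. IY K x * sin (lY t x) * (if Y k x \<le> a k then 1 else 0))"
    proof -
      have "Re (CLINT x|Q. of_real (IY (insert k K) x) * cis (lY t x)) = (LINT x|Q. Re (of_real (IY (insert k K) x) * cis (lY t x)))"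
        by (rule integral_Re[OF iQ, symmetric])
      moreover have "Im (CLINT x|Q. of_real (IY (insert k K) x) * cis (lY t x)) = (LINT x|Q. Im (of_real (IY (insert k K) x) * cis (lY t x)))"
        by (rule integral_Im[OF iQ, symmetric])
      ultimately show ?thesis by (simp add: complex_eq_iff insY mult_ac)
    qed
    show ?case unfolding sX sY by (rule tendsto_Complex[OF rc rs])
  qed
  have IXi: "IX n I x = indicator {x\<in>space P. \<forall>i\<in>I. X n i x \<le> a i} x" if "x \<in> space P" for n x
    using that I by (auto simp: IX_def indicator_def)
  have IYi: "IY I x = indicator {x\<in>space Q. \<forall>i\<in>I. Y i x \<le> a i} x" if "x \<in> space Q" for x
    using that I by (auto simp: IY_def indicator_def)
  have "(\<lambda>n. Re (CLINT x|P. of_real (IX n I x) * cis (lX (\<lambda>_. 0) n x))) \<longlonglongrightarrow> Re (CLINT x|Q. of_real (IY I x) * cis (lY (\<lambda>_. 0) x))"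
    by (intro tendsto_Re key subset_refl)
  then have "(\<lambda>n. LINT x|P. IX n I x) \<longlonglongrightarrow> (LINT x|Q. IY I x)" by (simp add: lX_def lY_def)
  moreover have "(LINT x|P. IX n I x) = measure P {x\<in>space P. \<forall>i\<in>I. X n i x \<le> a i}" for n
  proof -
    have "(LINT x|P. IX n I x) = (LINT x|P. indicator {x\<in>space P. \<forall>i\<in>I. X n i x \<le> a i} x)"
      by (rule Bochner_Integration.integral_cong[OF refl IXi])
    then show ?thesis by (simp add: Int_def conj_commute cong: conj_cong)
  qed
  moreover have "(LINT x|Q. IY I x) = measure Q {x\<in>space Q. \<forall>i\<in>I. Y i x \<le> a i}"
  proof -
    have "(LINT x|Q. IY I x) = (LINT x|Q. indicator {x\<in>space Q. \<forall>i\<in>I. Y i x \<le> a i} x)"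
      by (rule Bochner_Integration.integral_cong[OF refl IYi])
    then show ?thesis by (simp add: Int_def conj_commute cong: conj_cong)
  qed
  ultimately show ?thesis by simp
qed

section \<open>Weak mixing from a generator\<close>

text \<open>
  The sets \<open>A\<close> with this convergence form a Dynkin system; for disjoint unions, limit and sum are
  interchanged by Tannery's theorem.
\<close>

lemma mixing_dynkin:
  assumes N: "prob_space N" and E: "Int_stable E" "E \<subseteq> Pow (space N)" "sets N = sigma_sets (space N) E"
    and B: "\<And>n. B n \<in> sets N" "\<And>n. measure N (B n) = b"
    and basic: "\<And>A. A \<in> E \<Longrightarrow> (\<lambda>n. measure N (A \<inter> B n)) \<longlonglongrightarrow> measure N A * b"
    and A: "A \<in> sets N"
  shows "(\<lambda>n. measure N (A \<inter> B n)) \<longlonglongrightarrow> measure N A * b"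
proof -
  interpret N: prob_space N by fact
  have "A \<in> sigma_sets (space N) E" using A E(3) by simp
  from E(1,2) this show ?thesis
  proof (induction rule: sigma_sets_induct_disjoint)
    case (basic A)
    then show ?case by (rule assms(7))
  next
    case (compl A)
    have As: "A \<in> sets N" using compl(1) E(3) by simp
    have "measure N ((space N - A) \<inter> B n) = b - measure N (A \<inter> B n)" for n
    proof -
      have "(space N - A) \<inter> B n = B n - (A \<inter> B n)" using sets.sets_into_space[OF B(1)[of n]] by auto
      then show ?thesis using N.finite_measure_Diff[of "B n" "A \<inter> B n"] As B by simp
    qed
    moreover have "measure N (space N - A) * b = b - measure N A * b"
      using N.prob_compl[OF As] by (simp add: left_diff_distrib)
    ultimately show ?case using compl(2) by (simp add: tendsto_diff)
  next
    case (union A)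
    have As: "A i \<in> sets N" for i using union(2) E(3) by auto
    have s: "(\<lambda>i. measure N (A i)) sums measure N (\<Union>i. A i)"
      by (rule N.finite_measure_UNION) (use As union(1) in auto)
    have sB: "(\<lambda>i. measure N (A i \<inter> B n)) sums measure N ((\<Union>i. A i) \<inter> B n)" for n
    proof -
      have "disjoint_family (\<lambda>i. A i \<inter> B n)" using union(1) by (auto simp: disjoint_family_on_def)
      then have "(\<lambda>i. measure N (A i \<inter> B n)) sums measure N (\<Union>i. A i \<inter> B n)"
        by (intro N.finite_measure_UNION) (use As B in auto)
      then show ?thesis by (simp add: Int_UN_distrib2)
    qed
    have "(\<lambda>n. \<Sum>i. measure N (A i \<inter> B n)) \<longlonglongrightarrow> (\<Sum>i. measure N (A i) * b)"
    proof (rule tannerys_theorem[THEN conjunct2, THEN conjunct2])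
      show "(\<lambda>n. measure N (A i \<inter> B n)) \<longlonglongrightarrow> measure N (A i) * b" for i by (rule union(3))
      show "eventually (\<lambda>(i, n). norm (measure N (A i \<inter> B n)) \<le> measure N (A i)) (at_top \<times>\<^sub>F sequentially)"
        using As B by (intro always_eventually) (auto intro!: N.finite_measure_mono)
      show "summable (\<lambda>i. measure N (A i))" using s by (rule sums_summable)
    qed simp
    moreover have "(\<Sum>i. measure N (A i) * b) = measure N (\<Union>i. A i) * b"
      using sums_mult2[OF s, of b] by (rule sums_unique[symmetric])
    moreover have "(\<Sum>i. measure N (A i \<inter> B n)) = measure N ((\<Union>i. A i) \<inter> B n)" for n
      using sB[of n] by (rule sums_unique[symmetric])
    ultimately show ?case by simp
  qed simp
qed

lemma measure_inter_image:
  assumes M: "G_system M T" and A: "A \<in> sets M" and B: "B \<in> sets M"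
  shows "measure M (A \<inter> T g ` B) = measure M (B \<inter> T (- g) ` A)"
proof -
  have C: "A \<inter> T g ` B \<in> sets M" using A G_system_image(2)[OF M B] by auto
  have sp: "A \<subseteq> space M" "B \<subseteq> space M" using A B sets.sets_into_space by auto
  have inv: "T g (T (- g) x) = x" "T (- g) (T g x) = x" if "x \<in> space M" for x
    using G_systemD(6)[OF M that, of "- g"] G_systemD(6)[OF M that, of g] by simp_all
  have "T (- g) ` (A \<inter> T g ` B) = B \<inter> T (- g) ` A"
  proof (intro equalityI subsetI)
    fix x assume "x \<in> T (- g) ` (A \<inter> T g ` B)"
    then obtain y where "y \<in> B" "T g y \<in> A" "x = T (- g) (T g y)" by auto
    then show "x \<in> B \<inter> T (- g) ` A" using inv(2)[of y] sp by auto
  next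
    fix x assume "x \<in> B \<inter> T (- g) ` A"
    then obtain y where "x \<in> B" "y \<in> A" "x = T (- g) y" by auto
    moreover then have "y = T g x" using inv(1)[of y] sp by auto
    ultimately show "x \<in> T (- g) ` (A \<inter> T g ` B)" by blast
  qed
  then show ?thesis using G_systemD(7)[OF M C, of "- g"] by simp
qed

text \<open>
  The Dynkin argument extends the first set while the second is in the generator; by invariance the
  roles of the sets can be exchanged, and the argument extends the other one.
\<close>

lemma mixing_from_generator:
  fixes T :: "'g::ab_group_add \<Rightarrow> 'x \<Rightarrow> 'x"
  assumes M: "G_system M T" and E: "Int_stable E" "E \<subseteq> Pow (space M)" "sets M = sigma_sets (space M) E"
    and mix: "\<And>A B. A \<in> E \<Longrightarrow> B \<in> E \<Longrightarrow> (\<lambda>n. measure M (A \<inter> T (e n) ` B)) \<longlonglongrightarrow> measure M A * measure M B"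
    and A: "A \<in> sets M" and B: "B \<in> sets M"
  shows "(\<lambda>n. measure M (A \<inter> T (e n) ` B)) \<longlonglongrightarrow> measure M A * measure M B"
proof -
  have Es: "X \<in> sets M" if "X \<in> E" for X using that E(3) by (simp add: sigma_sets.Basic)
  have pM: "prob_space M" by (rule G_systemD[OF M])
  have 1: "(\<lambda>n. measure M (A \<inter> T (e n) ` B)) \<longlonglongrightarrow> measure M A * measure M B" if "B \<in> E" "A \<in> sets M" for A B
    by (rule mixing_dynkin[OF pM E]) (use that Es mix G_system_image(2)[OF M] G_systemD(7)[OF M] in auto)
  have "(\<lambda>n. measure M (B \<inter> T (- e n) ` A)) \<longlonglongrightarrow> measure M B * measure M A"
  proof (rule mixing_dynkin[OF pM E _ _ _ B])
    show "T (- e n) ` A \<in> sets M" for n by (rule G_system_image(2)[OF M A])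
    show "measure M (T (- e n) ` A) = measure M A" for n by (rule G_systemD(7)[OF M A])
    show "(\<lambda>n. measure M (C \<inter> T (- e n) ` A)) \<longlonglongrightarrow> measure M C * measure M A" if "C \<in> E" for C
      using 1[OF that A] measure_inter_image[OF M A Es[OF that]] by (simp add: mult.commute)
  qed
  then show ?thesis using measure_inter_image[OF M A B] by (simp add: mult.commute)
qed

text \<open>
  Mixing along one sequence passes to the product system, where rectangles form the generator. An
  invariant set \<open>D\<close> of a system that is mixing along a sequence has measure equal to its own square.
\<close>

lemma weak_mixing_from_generator:
  fixes T :: "'g::ab_group_add \<Rightarrow> 'x \<Rightarrow> 'x"
  assumes M: "G_system M T" and E: "Int_stable E" "E \<subseteq> Pow (space M)" "sets M = sigma_sets (space M) E"
    and mix: "\<And>A B. A \<in> E \<Longrightarrow> B \<in> E \<Longrightarrow> (\<lambda>n. measure M (A \<inter> T (e n) ` B)) \<longlonglongrightarrow> measure M A * measure M B"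
  shows "weak_mixing M T"
proof -
  note mixM = mixing_from_generator[OF M E mix]
  let ?N = "M \<Otimes>\<^sub>M M" and ?U = "\<lambda>g. map_prod (T g) (T g)"
  interpret M: prob_space M by (rule G_systemD[OF M])
  have N: "G_system ?N ?U" by (rule G_system_prod[OF M])
  have rect: "measure ?N (A \<times> B) = measure M A * measure M B" if "A \<in> sets M" "B \<in> sets M" for A B
    using that by (simp add: measure_def M.emeasure_pair_measure_Times enn2real_mult)
  let ?E = "{a \<times> b | a b. a \<in> sets M \<and> b \<in> sets M}"
  have mixN: "(\<lambda>n. measure ?N (A \<inter> ?U (e n) ` B)) \<longlonglongrightarrow> measure ?N A * measure ?N B"
    if "A \<in> sets ?N" "B \<in> sets ?N" for A B
  proof (rule mixing_from_generator[OF N, where E = ?E])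
    show "Int_stable ?E" by (rule Int_stable_pair_measure_generator)
    show "?E \<subseteq> Pow (space ?N)" using sets.sets_into_space by (auto simp: space_pair_measure)
    show "sets ?N = sigma_sets (space ?N) ?E" unfolding sets_pair_measure space_pair_measure ..
    fix X Y assume "X \<in> ?E" "Y \<in> ?E"
    then obtain a b c d where X: "X = a \<times> b" "a \<in> sets M" "b \<in> sets M" and Y: "Y = c \<times> d" "c \<in> sets M" "d \<in> sets M" by blast
    have im: "X \<inter> ?U (e n) ` Y = (a \<inter> T (e n) ` c) \<times> (b \<inter> T (e n) ` d)" for n by (auto simp: X Y)
    have "measure ?N (X \<inter> ?U (e n) ` Y) = measure M (a \<inter> T (e n) ` c) * measure M (b \<inter> T (e n) ` d)" for n
      unfolding im by (rule rect) (use X Y G_system_image(2)[OF M] in auto)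
    moreover have "(\<lambda>n. measure M (a \<inter> T (e n) ` c) * measure M (b \<inter> T (e n) ` d)) \<longlonglongrightarrow> (measure M a * measure M c) * (measure M b * measure M d)"
      by (intro tendsto_mult mixM X Y)
    ultimately show "(\<lambda>n. measure ?N (X \<inter> ?U (e n) ` Y)) \<longlonglongrightarrow> measure ?N X * measure ?N Y"
      by (simp add: X Y rect mult_ac)
  qed (use that in auto)
  show ?thesis unfolding weak_mixing_def ergodic_def
  proof (intro ballI impI)
    interpret N: prob_space ?N by (rule G_systemD[OF N])
    fix D assume D: "D \<in> sets ?N" and inv: "\<forall>g. measure ?N (sym_diff D (?U g ` D)) = 0"
    have "measure ?N (D \<inter> ?U g ` D) = measure ?N D" for g
    proof -
      have UD: "?U g ` D \<in> sets ?N" by (rule G_system_image(2)[OF N D])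
      have "measure ?N (D - ?U g ` D) \<le> measure ?N (sym_diff D (?U g ` D))"
        by (rule N.finite_measure_mono) (use D UD in auto)
      then have "measure ?N (D - ?U g ` D) = 0" using inv measure_nonneg[of ?N "D - ?U g ` D"] by simp
      moreover have "measure ?N D = measure ?N (D - ?U g ` D) + measure ?N (D \<inter> ?U g ` D)"
      proof -
        have "(D - ?U g ` D) \<inter> (D \<inter> ?U g ` D) = {}" by blast
        then show ?thesis
          using N.finite_measure_Union[of "D - ?U g ` D" "D \<inter> ?U g ` D"] D UD
          by (simp add: Un_Diff_Int)
      qed
      ultimately show ?thesis by simp
    qed
    then have "(\<lambda>n. measure ?N D) \<longlonglongrightarrow> measure ?N D * measure ?N D" using mixN[OF D D] by simp
    then have "measure ?N D = measure ?N D * measure ?N D" by (simp add: LIMSEQ_const_iff)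
    then show "measure ?N D \<in> {0, 1}" by auto
  qed
qed

section \<open>Gaussian systems\<close>

definition orthant :: "'g set \<Rightarrow> ('g \<Rightarrow> real) \<Rightarrow> ('g \<Rightarrow> real) set" where
  "orthant J a = {w. \<forall>g\<in>J. w g \<le> a g}"

definition orthants :: "('g \<Rightarrow> real) set set" where
  "orthants = {orthant J a | J a. finite J}"

lemma Int_stable_orthants: "Int_stable orthants"
proof (rule Int_stableI)
  fix A B :: "('g \<Rightarrow> real) set" assume "A \<in> orthants" "B \<in> orthants"
  then obtain J a K b where AB: "A = orthant J a" "B = orthant K b" "finite J" "finite K" by (auto simp: orthants_def)
  have "A \<inter> B = orthant (J \<union> K) (\<lambda>g. if g \<in> J then if g \<in> K then min (a g) (b g) else a g else b g)"
    by (auto simp: AB orthant_def split: if_splits)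
  then show "A \<inter> B \<in> orthants" using AB by (auto simp: orthants_def)
qed

lemma sets_PiM_orthants: "sets (PiM UNIV (\<lambda>_::'g. borel :: real measure)) = sigma_sets UNIV orthants"
proof
  interpret S: sigma_algebra UNIV "sigma_sets UNIV (orthants :: ('g \<Rightarrow> real) set set)"
    by (rule sigma_algebra_sigma_sets) simp
  define \<Sigma> where "\<Sigma> = sigma UNIV (orthants :: ('g \<Rightarrow> real) set set)"
  have [simp]: "sets \<Sigma> = sigma_sets UNIV orthants" "space \<Sigma> = UNIV" by (auto simp: \<Sigma>_def)
  have meas: "(\<lambda>w. w i) \<in> borel_measurable \<Sigma>" for i :: 'g
    unfolding borel_measurable_iff_le
  proof
    fix c :: real
    have "{w \<in> space \<Sigma>. w i \<le> c} = orthant {i} (\<lambda>_. c)" by (auto simp: orthant_def)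
    then show "{w \<in> space \<Sigma>. w i \<le> c} \<in> sets \<Sigma>" by (auto simp: orthants_def intro!: sigma_sets.Basic)
  qed
  show "sets (PiM UNIV (\<lambda>_::'g. borel :: real measure)) \<subseteq> sigma_sets UNIV orthants"
    unfolding sets_PiM_single
  proof (simp, rule S.sigma_sets_subset, safe)
    fix i :: 'g and A :: "real set" assume "A \<in> sets borel"
    then show "{f. f i \<in> A} \<in> sigma_sets UNIV orthants"
      using measurable_sets[OF meas[of i], of A] by (simp add: vimage_def)
  qed
  show "sigma_sets UNIV orthants \<subseteq> sets (PiM UNIV (\<lambda>_::'g. borel :: real measure))"
  proof -
    have "orthants \<subseteq> sets (PiM UNIV (\<lambda>_::'g. borel :: real measure))"
    proof
      fix A :: "('g \<Rightarrow> real) set" assume "A \<in> orthants"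
      then obtain J a where A: "A = orthant J a" "finite J" by (auto simp: orthants_def)
      have "{w \<in> space (PiM UNIV (\<lambda>_::'g. borel :: real measure)). \<forall>g\<in>J. w g \<le> a g} \<in> sets (PiM UNIV (\<lambda>_::'g. borel :: real measure))"
        using A(2) by (intro sets.sets_Collect_finite_All) (auto intro!: borel_measurable_le)
      then show "A \<in> sets (PiM UNIV (\<lambda>_::'g. borel :: real measure))" by (simp add: A orthant_def space_PiM)
    qed
    from sets.sigma_sets_subset[OF this] show ?thesis by (simp add: space_PiM)
  qed
qed

locale gaussian =
  fixes C :: "'g::ab_group_add \<Rightarrow> real" and M :: "('g \<Rightarrow> real) measure"
  assumes law: "gaussian_law C M" and C0: "C 0 = 1" and pd: "positive_definite C"
begin

sublocale prob_space M using law by (simp add: gaussian_law_def)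

lemma sets_M: "sets M = sets (PiM UNIV (\<lambda>_. borel))" using law by (simp add: gaussian_law_def)

lemma space_M [simp]: "space M = UNIV"
  using sets_eq_imp_space_eq[OF sets_M] by (simp add: space_PiM)

lemma coord [measurable]: "(\<lambda>w. w g) \<in> borel_measurable M"
  unfolding measurable_cong_sets[OF sets_M refl] by simp

lemma C_minus: "C (g - h) = C (h - g)"
  using pd minus_diff_eq[of g h] unfolding positive_definite_def by metis

lemma cf_family:
  assumes I: "finite I"
  shows "(CLINT w|M. cis (\<Sum>i\<in>I. t i * w (v i))) = of_real (exp (- (\<Sum>i\<in>I. \<Sum>j\<in>I. t i * t j * C (v i - v j)) / 2))"
proof -
  have "(CLINT w|M. cis (\<Sum>i\<in>I. t i * w (v i)))
      = (CLINT w|M. cis (\<Sum>g\<in>v ` I. (\<Sum>i\<in>{i\<in>I. v i = g}. t i) * w g))"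
    by (simp only: sum_group_weights[OF I])
  then show ?thesis
    unfolding quadratic_form_group_weights[OF I, of t "\<lambda>g h. C (g - h)" v]
    using law I unfolding gaussian_law_def by simp
qed

lemma normal_law:
  assumes X [measurable]: "X \<in> borel_measurable M"
    and cf: "\<And>s. (CLINT w|M. cis (s * X w)) = of_real (exp (- (s\<^sup>2 * v) / 2))" and v: "v \<ge> 0"
  shows "distr M borel X = distr std_normal_distribution borel (\<lambda>x. sqrt v * x)"
proof (rule Levy_uniqueness)
  interpret N: prob_space std_normal_distribution by (rule std_normal_prob)
  show "real_distribution (distr M borel X)"
    using prob_space_distr[OF X] by (simp add: real_distribution_def real_distribution_axioms_def)
  have m: "(\<lambda>x. sqrt v * x) \<in> borel_measurable std_normal_distribution" by simp
  show "real_distribution (distr std_normal_distribution borel (\<lambda>x. sqrt v * x))"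
    using N.prob_space_distr[OF m] by (simp add: real_distribution_def real_distribution_axioms_def)
  show "char (distr M borel X) = char (distr std_normal_distribution borel (\<lambda>x. sqrt v * x))"
  proof
    fix s
    have "char (distr M borel X) s = (CLINT w|M. cis (s * X w))"
      unfolding char_def by (subst integral_distr) (auto simp: cis_conv_exp)
    also have "\<dots> = char std_normal_distribution (s * sqrt v)"
      using v by (simp add: cf char_std_normal_distribution power_mult_distrib)
    also have "\<dots> = char (distr std_normal_distribution borel (\<lambda>x. sqrt v * x)) s"
      unfolding char_def by (subst integral_distr) (auto simp: mult.assoc)
    finally show "char (distr M borel X) s = char (distr std_normal_distribution borel (\<lambda>x. sqrt v * x)) s" .
  qed
qed

lemma coord_law: "distr M borel (\<lambda>w. w g) = std_normal_distribution"
proof -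
  have "(CLINT w|M. cis (s * w g)) = of_real (exp (- (s\<^sup>2 * 1) / 2))" for s
    using cf_family[of "{()}" "\<lambda>_. s" "\<lambda>_. g"] C0 by (simp add: power2_eq_square)
  from normal_law[OF coord this] have "distr M borel (\<lambda>w. w g) = distr std_normal_distribution borel (\<lambda>x. x)" by simp
  also have "\<dots> = std_normal_distribution" by (rule distr_id2) simp
  finally show ?thesis .
qed

lemma diff_law: "distr M borel (\<lambda>w. w g - w h) = distr std_normal_distribution borel (\<lambda>x. sqrt (2 - 2 * C (g - h)) * x)"
  and C_le_1: "C (g - h) \<le> 1"
proof -
  show le: "C (g - h) \<le> 1"
  proof (cases "g = h")
    case False
    have "(\<Sum>x\<in>{g, h}. \<Sum>y\<in>{g, h}. (if x = g then 1 else -1) * (if y = g then 1 else -1) * C (x - y)) \<ge> 0"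
      by (rule pd[unfolded positive_definite_def, THEN conjunct2, rule_format]) simp
    then show ?thesis using False C0 C_minus[of h g] by simp
  qed (simp add: C0)
  have "(CLINT w|M. cis (s * (w g - w h))) = of_real (exp (- (s\<^sup>2 * (2 - 2 * C (g - h))) / 2))" for s
  proof -
    have "(\<Sum>i\<in>UNIV. (if i then s else - s) * w (if i then g else h)) = s * (w g - w h)" for w :: "'g \<Rightarrow> real"
      by (simp add: UNIV_bool algebra_simps)
    moreover have "(\<Sum>i\<in>UNIV. \<Sum>j\<in>UNIV. (if i then s else - s) * (if j then s else - s) * C ((if i then g else h) - (if j then g else h)))
       = s\<^sup>2 * (2 - 2 * C (g - h))"
      using C_minus[of h g] C0 by (simp add: UNIV_bool algebra_simps power2_eq_square)
    ultimately show ?thesis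
      using cf_family[of "UNIV :: bool set" "\<lambda>i. if i then s else - s" "\<lambda>i. if i then g else h"] by simp
  qed
  from normal_law[OF _ this] show "distr M borel (\<lambda>w. w g - w h) = distr std_normal_distribution borel (\<lambda>x. sqrt (2 - 2 * C (g - h)) * x)"
    using le by simp
qed

lemma std_normal_null: "emeasure lborel A = 0 \<Longrightarrow> A \<in> sets borel \<Longrightarrow> measure std_normal_distribution A = 0"
proof -
  assume A: "emeasure lborel A = 0" "A \<in> sets borel"
  then have "A \<in> null_sets lborel" by (simp add: null_sets_def)
  then have "A \<in> null_sets (density lborel std_normal_density)"
    using A(2) by (subst null_sets_density_iff) (auto dest: AE_not_in)
  then show ?thesis by (simp add: measure_def null_sets_def)
qed

lemma coord_atomless: "measure M {w \<in> space M. w g = a} = 0"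
proof -
  have "measure M ((\<lambda>w. w g) -` {a} \<inter> space M) = measure (distr M borel (\<lambda>w. w g)) {a}"
    by (rule measure_distr[symmetric]) auto
  also have "\<dots> = 0" unfolding coord_law by (rule std_normal_null) auto
  finally show ?thesis by (simp add: vimage_def Int_def)
qed

definition shift :: "'g \<Rightarrow> ('g \<Rightarrow> real) \<Rightarrow> 'g \<Rightarrow> real" where "shift h w = (\<lambda>g. w (g + h))"

lemma shift_measurable [measurable]: "shift h \<in> measurable M M"
proof -
  have "shift h \<in> PiM UNIV (\<lambda>_. borel) \<rightarrow>\<^sub>M PiM UNIV (\<lambda>_. borel)"
    unfolding shift_def by (rule measurable_PiM_single') (auto simp: space_PiM)
  then show ?thesis by (simp add: measurable_cong_sets[OF sets_M sets_M])
qed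

lemma orthant_sets: "finite J \<Longrightarrow> orthant J a \<in> sets M"
  unfolding sets_M sets_PiM_orthants by (auto simp: orthants_def intro!: sigma_sets.Basic)

text \<open>
  Characteristic functions depend on differences of indices only, and they determine the
  probabilities of orthants; the latter is the case of constant sequences of \<open>orthant_convergence\<close>.
\<close>

lemma G_system_shift: "G_system M shift"
proof (rule G_systemI)
  show "prob_space M" by (rule prob_space_axioms)
  fix h
  show "distr M M (shift h) = M"
  proof (rule measure_eqI_generator_eq[where E = orthants and \<Omega> = UNIV and A = "\<lambda>_. UNIV"])
    show "Int_stable orthants" by (rule Int_stable_orthants)
    show "sets (distr M M (shift h)) = sigma_sets UNIV orthants" "sets M = sigma_sets UNIV orthants"
      by (simp_all add: sets_M sets_PiM_orthants)
    have "UNIV = orthant {} (\<lambda>_. 0)" by (simp add: orthant_def)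
    then show "range (\<lambda>_::nat. UNIV) \<subseteq> orthants" by (auto simp: orthants_def)
    show "emeasure (distr M M (shift h)) UNIV \<noteq> \<infinity>"
      using prob_space.emeasure_space_1[OF prob_space_distr[OF shift_measurable[of h]]] by simp
    fix X :: "('g \<Rightarrow> real) set" assume "X \<in> orthants"
    then obtain J a where X: "X = orthant J a" "finite J" by (auto simp: orthants_def)
    have "(\<lambda>n::nat. measure M {w\<in>space M. \<forall>g\<in>J. w (g + h) \<le> a g}) \<longlonglongrightarrow> measure M {w\<in>space M. \<forall>g\<in>J. w g \<le> a g}"
    proof (rule orthant_convergence[OF prob_space_axioms prob_space_axioms X(2)])
      show "(\<lambda>n. CLINT w|M. cis (\<Sum>g\<in>J. t g * w (g + h))) \<longlonglongrightarrow> (CLINT w|M. cis (\<Sum>g\<in>J. t g * w g))" for t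
        using cf_family[OF X(2), of t "\<lambda>g. g + h"] cf_family[OF X(2), of t "\<lambda>g. g"] by simp
    qed (use coord_atomless in auto)
    then have "measure M {w. \<forall>g\<in>J. w (g + h) \<le> a g} = measure M X" by (simp add: LIMSEQ_const_iff X orthant_def)
    moreover have "shift h -` X \<inter> space M = {w. \<forall>g\<in>J. w (g + h) \<le> a g}" by (auto simp: X orthant_def shift_def)
    ultimately show "emeasure (distr M M (shift h)) X = emeasure M X"
      using orthant_sets[OF X(2), of a] by (simp add: emeasure_distr emeasure_eq_measure X)
  qed auto
qed (auto simp: shift_def add.assoc)

text \<open>
  The covariances between coordinates in \<open>J\<close> and coordinates in \<open>K - e n\<close> tend to \<open>0\<close>, so that the
  joint characteristic functions converge to those of two independent copies of the process. The
  disjoint sum of \<open>J\<close> and \<open>K\<close> serves as index set for both sides.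
\<close>

lemma weak_mixing_shift:
  assumes e: "\<And>k. (\<lambda>n. C (e n + k)) \<longlonglongrightarrow> 0"
  shows "weak_mixing M shift"
proof (rule weak_mixing_from_generator[OF G_system_shift, where E = orthants and e = e])
  show "Int_stable orthants" by (rule Int_stable_orthants)
  show "sets M = sigma_sets (space M) orthants" by (simp add: sets_M sets_PiM_orthants)
  fix A B :: "('g \<Rightarrow> real) set" assume "A \<in> orthants" "B \<in> orthants"
  then obtain J a K b where A: "A = orthant J a" "finite J" and B: "B = orthant K b" "finite K"
    by (auto simp: orthants_def)
  define I where "I = J <+> K"
  have I: "finite I" using A B by (simp add: I_def)
  have ball_Plus: "(\<forall>i\<in>J <+> K. R i) \<longleftrightarrow> (\<forall>j\<in>J. R (Inl j)) \<and> (\<forall>k\<in>K. R (Inr k))" for R by auto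
  interpret MM: pair_prob_space M M ..
  define v where "v n i = (case i of Inl j \<Rightarrow> j | Inr k \<Rightarrow> k - e n)" for n and i :: "'g + 'g"
  define Y :: "'g + 'g \<Rightarrow> ('g \<Rightarrow> real) \<times> ('g \<Rightarrow> real) \<Rightarrow> real" where "Y i = (case i of Inl j \<Rightarrow> (\<lambda>z. fst z j) | Inr k \<Rightarrow> (\<lambda>z. snd z k))" for i :: "'g + 'g"
  define c where "c i = (case i of Inl j \<Rightarrow> a j | Inr k \<Rightarrow> b k)" for i :: "'g + 'g"
  have Ym [measurable]: "Y i \<in> borel_measurable (M \<Otimes>\<^sub>M M)" for i
    unfolding Y_def by (cases i) (auto intro!: measurable_compose[OF measurable_fst coord] measurable_compose[OF measurable_snd coord])
  have rect: "measure (M \<Otimes>\<^sub>M M) (X \<times> Z) = measure M X * measure M Z" if "X \<in> sets M" "Z \<in> sets M" for X Z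
    using that by (simp add: measure_def emeasure_pair_measure_Times enn2real_mult)
  have "(\<lambda>n. measure M {w\<in>space M. \<forall>i\<in>I. w (v n i) \<le> c i}) \<longlonglongrightarrow> measure (M \<Otimes>\<^sub>M M) {z\<in>space (M \<Otimes>\<^sub>M M). \<forall>i\<in>I. Y i z \<le> c i}"
  proof (rule orthant_convergence[OF prob_space_axioms MM.prob_space_axioms I])
    fix t :: "'g + 'g \<Rightarrow> real"
    define QJ where "QJ = (\<Sum>j\<in>J. \<Sum>j'\<in>J. t (Inl j) * t (Inl j') * C (j - j'))"
    define QK where "QK = (\<Sum>k\<in>K. \<Sum>k'\<in>K. t (Inr k) * t (Inr k') * C (k - k'))"
    define X where "X n = (\<Sum>j\<in>J. \<Sum>k\<in>K. t (Inl j) * t (Inr k) * C (e n + (j - k)))" for n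
    have X0: "X \<longlonglongrightarrow> 0"
      unfolding X_def by (intro tendsto_null_sum tendsto_mult_right_zero e)
    have q: "(\<Sum>i\<in>I. \<Sum>i'\<in>I. t i * t i' * C (v n i - v n i')) = QJ + 2 * X n + QK" for n
    proof -
      have "(\<Sum>k\<in>K. \<Sum>j\<in>J. t (Inr k) * t (Inl j) * C (k - e n - j)) = X n"
      proof -
        have "C (k - e n - j) = C (e n + (j - k))" for j k
          using C_minus[of "k - e n" j] by (simp add: algebra_simps)
        then show ?thesis unfolding X_def by (subst sum.swap) (simp add: mult_ac)
      qed
      moreover have "(\<Sum>j\<in>J. \<Sum>k\<in>K. t (Inl j) * t (Inr k) * C (j - (k - e n))) = X n"
        unfolding X_def by (intro sum.cong refl) (simp add: algebra_simps)
      ultimately show ?thesis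
        using A(2) B(2) by (simp add: I_def sum.Plus v_def sum.distrib QJ_def QK_def)
    qed
    have "(\<lambda>n. exp (- (QJ + 2 * X n + QK) / 2)) \<longlonglongrightarrow> exp (- (QJ + 2 * 0 + QK) / 2)"
      by (intro tendsto_intros X0) simp
    then have l: "(\<lambda>n. CLINT w|M. cis (\<Sum>i\<in>I. t i * w (v n i))) \<longlonglongrightarrow> of_real (exp (- (QJ + QK) / 2))"
      unfolding cf_family[OF I] q by (intro tendsto_of_real) simp
    define f where "f w = cis (\<Sum>j\<in>J. t (Inl j) * w j)" for w :: "'g \<Rightarrow> real"
    define g where "g w = cis (\<Sum>k\<in>K. t (Inr k) * w k)" for w :: "'g \<Rightarrow> real"
    have [measurable]: "f \<in> borel_measurable M" "g \<in> borel_measurable M" unfolding f_def g_def by measurable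
    have int: "integrable (M \<Otimes>\<^sub>M M) (\<lambda>z. f (fst z) * g (snd z))"
      by (rule MM.integrable_const_bound[of _ 1]) (auto simp: f_def g_def norm_mult)
    have "(CLINT z|M \<Otimes>\<^sub>M M. cis (\<Sum>i\<in>I. t i * Y i z)) = (CLINT z|M \<Otimes>\<^sub>M M. f (fst z) * g (snd z))"
      using A(2) B(2) by (simp add: I_def sum.Plus Y_def f_def g_def cis_mult)
    also have "\<dots> = (CLINT x|M. CLINT y|M. f x * g y)" using MM.integral_fst'[OF int] by simp
    also have "\<dots> = (CLINT x|M. f x) * (CLINT y|M. g y)" by simp
    also have "\<dots> = of_real (exp (- (QJ + QK) / 2))"
      using cf_family[OF A(2), of "\<lambda>j. t (Inl j)" "\<lambda>j. j"] cf_family[OF B(2), of "\<lambda>k. t (Inr k)" "\<lambda>k. k"]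
      by (simp add: f_def g_def QJ_def QK_def exp_add[symmetric] of_real_mult[symmetric] add_divide_distrib diff_divide_distrib del: of_real_mult)
    finally show "(\<lambda>n. CLINT w|M. cis (\<Sum>i\<in>I. t i * w (v n i))) \<longlonglongrightarrow> (CLINT z|M \<Otimes>\<^sub>M M. cis (\<Sum>i\<in>I. t i * Y i z))"
      using l by simp
  next
    fix i assume "i \<in> I"
    show "measure (M \<Otimes>\<^sub>M M) {z\<in>space (M \<Otimes>\<^sub>M M). Y i z = c i} = 0"
    proof (cases i)
      case (Inl j)
      have eq: "{z\<in>space (M \<Otimes>\<^sub>M M). Y i z = c i} = {w\<in>space M. w j = a j} \<times> space M" by (auto simp: Y_def c_def Inl space_pair_measure)
      have "measure (M \<Otimes>\<^sub>M M) ({w\<in>space M. w j = a j} \<times> space M) = measure M {w\<in>space M. w j = a j} * measure M (space M)"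
        by (rule rect) measurable
      then show ?thesis unfolding eq coord_atomless by simp
    next
      case (Inr k)
      have eq: "{z\<in>space (M \<Otimes>\<^sub>M M). Y i z = c i} = space M \<times> {w\<in>space M. w k = b k}" by (auto simp: Y_def c_def Inr space_pair_measure)
      have "measure (M \<Otimes>\<^sub>M M) (space M \<times> {w\<in>space M. w k = b k}) = measure M (space M) * measure M {w\<in>space M. w k = b k}"
        by (rule rect) measurable
      then show ?thesis unfolding eq coord_atomless by simp
    qed
  qed auto
  moreover have "{w\<in>space M. \<forall>i\<in>I. w (v n i) \<le> c i} = A \<inter> shift (e n) ` B" for n
  proof -
    have "shift (e n) ` B = shift (- e n) -` B \<inter> space M"
      by (rule G_system_image(1)[OF G_system_shift]) (simp add: B orthant_sets)
    then show ?thesis unfolding I_def ball_Plus by (auto simp: A B orthant_def shift_def v_def c_def)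
  qed
  moreover have "{z\<in>space (M \<Otimes>\<^sub>M M). \<forall>i\<in>I. Y i z \<le> c i} = A \<times> B"
    unfolding I_def ball_Plus by (auto simp: A B orthant_def Y_def c_def space_pair_measure)
  ultimately show "(\<lambda>n. measure M (A \<inter> shift (e n) ` B)) \<longlonglongrightarrow> measure M A * measure M B"
    by (simp add: rect A B orthant_sets)
qed auto

lemma diff_large_prob_le:
  assumes \<eta>: "\<eta> > 0"
  shows "measure M {w. \<bar>w g - w h\<bar> \<ge> \<eta>} \<le> (2 - 2 * C (g - h)) / \<eta>\<^sup>2"
proof -
  interpret N: prob_space std_normal_distribution by (rule std_normal_prob)
  define v where "v = 2 - 2 * C (g - h)"
  have v: "v \<ge> 0" using C_le_1[of g h] by (simp add: v_def)
  have sq: "integrable std_normal_distribution (\<lambda>x. x\<^sup>2)" "(LINT x|std_normal_distribution. x\<^sup>2) = 1"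
    using std_normal_distribution_even_moments[of 1] by (auto simp: has_bochner_integral_iff)
  have "measure M ((\<lambda>w. w g - w h) -` {y. \<bar>y\<bar> \<ge> \<eta>} \<inter> space M) = measure (distr M borel (\<lambda>w. w g - w h)) {y. \<bar>y\<bar> \<ge> \<eta>}"
    by (rule measure_distr[symmetric]) auto
  also have "\<dots> = measure (distr std_normal_distribution borel (\<lambda>x. sqrt v * x)) {y. \<bar>y\<bar> \<ge> \<eta>}"
    unfolding diff_law v_def ..
  also have "\<dots> = measure std_normal_distribution {x\<in>space std_normal_distribution. \<eta>\<^sup>2 \<le> v * x\<^sup>2}"
  proof -
    have "\<bar>sqrt v * x\<bar> \<ge> \<eta> \<longleftrightarrow> \<eta>\<^sup>2 \<le> v * x\<^sup>2" for x
    proof -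
      have "\<eta> \<le> \<bar>sqrt v * x\<bar> \<longleftrightarrow> \<eta>\<^sup>2 \<le> \<bar>sqrt v * x\<bar>\<^sup>2"
        using \<eta> by (simp add: abs_le_square_iff[symmetric])
      then show ?thesis using v by (simp add: power_mult_distrib)
    qed
    then show ?thesis by (subst measure_distr) (auto simp: vimage_def intro!: arg_cong2[where f = measure])
  qed
  also have "\<dots> \<le> (LINT x|std_normal_distribution. v * x\<^sup>2) / \<eta>\<^sup>2"
    by (rule integral_Markov_inequality_measure[where A = UNIV]) (use sq v \<eta> in auto)
  also have "\<dots> = v / \<eta>\<^sup>2" using sq by simp
  finally show ?thesis by (simp add: v_def vimage_def)
qed

text \<open>
  If no level \<open>q\<close> separated the two coordinates in this order with positive probability, the
  rational levels would show that \<open>w g \<le> w h\<close> almost surely, whereas \<open>w g - w h\<close> is a nondegenerate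
  centred normal variable.
\<close>

lemma level_crossing_pos:
  assumes C: "C (g - h) < 1"
  shows "\<exists>q. measure M {w. w g > q \<and> w h \<le> q} > 0"
proof (rule ccontr)
  assume no: "\<not> ?thesis"
  define v where "v = 2 - 2 * C (g - h)"
  have v: "v > 0" using C by (simp add: v_def)
  have null: "{w. w g > q \<and> w h \<le> q} \<in> null_sets M" for q
  proof -
    have "measure M {w. w g > q \<and> w h \<le> q} = 0"
    proof -
      have "\<not> measure M {w. w g > q \<and> w h \<le> q} > 0" using no by blast
      then show ?thesis using measure_nonneg[of M "{w. w g > q \<and> w h \<le> q}"] by linarith
    qed
    moreover have "{w\<in>space M. w g > q \<and> w h \<le> q} \<in> sets M" by measurable
    ultimately show ?thesis by (simp add: emeasure_eq_measure null_setsI)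
  qed
  have "(\<Union>q\<in>\<rat>. {w. w g > q \<and> w h \<le> q}) \<in> null_sets M"
    by (rule null_sets_UN') (use null countable_rat in auto)
  moreover have "{w :: 'g \<Rightarrow> real. w g - w h > 0} \<subseteq> (\<Union>q\<in>\<rat>. {w. w g > q \<and> w h \<le> q})"
  proof
    fix w :: "'g \<Rightarrow> real" assume "w \<in> {w. w g - w h > 0}"
    then obtain q where "q \<in> \<rat>" "w h < q" "q < w g" using Rats_dense_in_real[of "w h" "w g"] by auto
    then show "w \<in> (\<Union>q\<in>\<rat>. {w. w g > q \<and> w h \<le> q})" by (auto intro: less_imp_le)
  qed
  moreover have "{w\<in>space M. w g - w h > 0} \<in> sets M" by measurable
  ultimately have "{w :: 'g \<Rightarrow> real. w g - w h > 0} \<in> null_sets M" by (auto intro: null_sets_subset)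
  then have "0 = measure M ((\<lambda>w. w g - w h) -` {0<..} \<inter> space M)" by (simp add: measure_def vimage_def null_sets_def)
  also have "\<dots> = measure (distr M borel (\<lambda>w. w g - w h)) {0<..}" by (rule measure_distr[symmetric]) auto
  also have "\<dots> = measure (distr std_normal_distribution borel (\<lambda>x. sqrt v * x)) {0<..}"
    unfolding diff_law v_def ..
  also have "\<dots> = measure std_normal_distribution {0<..}"
    using v by (subst measure_distr) (auto simp: vimage_def zero_less_mult_iff greaterThan_def)
  finally have "measure std_normal_distribution {0<..} = 0" by simp
  interpret N: prob_space std_normal_distribution by (rule std_normal_prob)
  have "{0<..} \<in> null_sets std_normal_distribution"
    using \<open>measure std_normal_distribution {0<..} = 0\<close> by (intro null_setsI) (auto simp: N.emeasure_eq_measure)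
  then have "AE x in lborel. x \<in> {0<..} \<longrightarrow> ennreal (std_normal_density x) = 0"
    by (subst (asm) null_sets_density_iff) auto
  then have "AE x in lborel. \<not> x \<in> {0<..(1::real)}"
  proof (rule AE_mp, intro AE_I2 impI)
    fix x :: real assume "x \<in> {0<..} \<longrightarrow> ennreal (std_normal_density x) = 0"
    moreover have "std_normal_density x > 0" by (rule normal_density_pos) simp
    ultimately show "\<not> x \<in> {0<..1}" by auto
  qed
  then have "emeasure lborel {x\<in>space lborel. \<not> x \<notin> {0<..(1::real)}} = 0"
    by (subst (asm) AE_iff_measurable[OF _ refl]) auto
  moreover have "{x\<in>space lborel. \<not> x \<notin> {0<..(1::real)}} = {0<..1}" by auto
  ultimately have "emeasure lborel {0<..(1::real)} = 0" by simp
  moreover have "emeasure lborel {0<..(1::real)} = 1" by simp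
  ultimately show False by simp
qed

text \<open>
  A level \<open>q\<close> crossed between \<open>0\<close> and \<open>- g\<close> defines \<open>D\<close>. A point of \<open>D \<inter> shift (s + g) ` D\<close>
  satisfies \<open>w (- g) \<le> q < w (- g - s)\<close>. So either \<open>w (- g)\<close> is near \<open>q\<close>, which is unlikely as the
  law of a coordinate has no atoms, or \<open>w (- g)\<close> and \<open>w (- g - s)\<close> are far apart, which is unlikely
  if \<open>C s\<close> is near \<open>1\<close>.
\<close>

lemma rigid_no_recurrence:
  assumes g: "C g < 1"
  shows "\<exists>D\<in>sets M. measure M D > 0 \<and>
    (\<forall>c>0. \<exists>\<kappa>>0. \<forall>s. C s \<ge> 1 - \<kappa> \<longrightarrow> measure M (D \<inter> shift (s + g) ` D) \<le> c)"
proof -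
  have "C (0 - (- g)) < 1" using g by simp
  from level_crossing_pos[OF this] obtain q where q: "measure M {w. w 0 > q \<and> w (- g) \<le> q} > 0" by blast
  define D where "D = {w. w 0 > q \<and> w (- g) \<le> q}"
  have "{w\<in>space M. w 0 > q \<and> w (- g) \<le> q} \<in> sets M" by measurable
  then have D: "D \<in> sets M" by (simp add: D_def)
  show ?thesis
  proof (intro bexI[OF _ D] conjI allI impI)
    show "measure M D > 0" using q by (simp add: D_def)
    fix c :: real assume c: "c > 0"
    define B where "B n = {w\<in>space M. \<bar>w (- g) - q\<bar> \<le> inverse (real (Suc n))}" for n
    have Bs: "B n \<in> sets M" for n unfolding B_def by measurable
    have "decseq B"
    proof (rule decseq_SucI, rule subsetI)
      fix n w assume "w \<in> B (Suc n)"
      moreover have "inverse (real (Suc (Suc n))) \<le> inverse (real (Suc n))" by (intro le_imp_inverse_le) auto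
      ultimately show "w \<in> B n" unfolding B_def by (auto intro: order_trans)
    qed
    then have "(\<lambda>n. measure M (B n)) \<longlonglongrightarrow> measure M (\<Inter>n. B n)" using Bs by (intro finite_Lim_measure_decseq) auto
    moreover have "(\<Inter>n. B n) = {w\<in>space M. w (- g) = q}"
    proof (intro equalityI subsetI)
      fix w assume w: "w \<in> (\<Inter>n. B n)"
      have "\<bar>w (- g) - q\<bar> \<le> 0"
      proof (rule ccontr)
        assume "\<not> ?thesis"
        then obtain n where "inverse (real (Suc n)) < \<bar>w (- g) - q\<bar>" using reals_Archimedean[of "\<bar>w (- g) - q\<bar>"] by auto
        then show False using w by (auto simp: B_def not_le[symmetric])
      qed
      then show "w \<in> {w\<in>space M. w (- g) = q}" by simp
    qed (auto simp: B_def)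
    ultimately have "(\<lambda>n. measure M (B n)) \<longlonglongrightarrow> 0" using coord_atomless by simp
    then have "eventually (\<lambda>n. measure M (B n) < c / 2) sequentially" using c by (intro order_tendstoD) auto
    then obtain n where n: "measure M (B n) < c / 2" by (auto simp: eventually_sequentially)
    define \<eta> where "\<eta> = inverse (real (Suc n))"
    have \<eta>: "\<eta> > 0" by (simp add: \<eta>_def)
    \<comment> \<open>Chebyshev's inequality then bounds the probability of a difference of at least \<open>\<eta>\<close> by
      \<open>2 \<kappa> / \<eta>\<^sup>2 = c / 2\<close>.\<close>
    define \<kappa> where "\<kappa> = c * \<eta>\<^sup>2 / 4"
    have \<kappa>: "\<kappa> > 0" using c \<eta> by (simp add: \<kappa>_def)
    show "\<exists>\<kappa>>0. \<forall>s. C s \<ge> 1 - \<kappa> \<longrightarrow> measure M (D \<inter> shift (s + g) ` D) \<le> c"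
    proof (rule exI[of _ \<kappa>], intro conjI \<kappa> allI impI)
      fix s assume s: "C s \<ge> 1 - \<kappa>"
      define E where "E = {w. \<bar>w (- g) - w (- g - s)\<bar> \<ge> \<eta>}"
      have "{w\<in>space M. \<bar>w (- g) - w (- g - s)\<bar> \<ge> \<eta>} \<in> sets M" by measurable
      then have Es: "E \<in> sets M" by (simp add: E_def)
      have "D \<inter> shift (s + g) ` D \<subseteq> B n \<union> E"
      proof
        fix w assume "w \<in> D \<inter> shift (s + g) ` D"
        then have w: "w (- g) \<le> q" "w (- g - s) > q"
          unfolding G_system_image(1)[OF G_system_shift D] by (auto simp: D_def shift_def algebra_simps)
        show "w \<in> B n \<union> E"
        proof (cases "w (- g) \<ge> q - \<eta>")
          case True
          then have "\<bar>w (- g) - q\<bar> \<le> \<eta>" using w \<eta> by linarith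
          then have "w \<in> B n" unfolding B_def \<eta>_def by simp
          then show ?thesis ..
        next
          case False
          then show ?thesis using w by (simp add: E_def)
        qed
      qed
      then have "measure M (D \<inter> shift (s + g) ` D) \<le> measure M (B n \<union> E)"
        by (rule finite_measure_mono) (use Bs Es in auto)
      also have "\<dots> \<le> measure M (B n) + measure M E" by (rule measure_Un_le) (use Bs Es in auto)
      also have "measure M E \<le> (2 - 2 * C s) / \<eta>\<^sup>2"
        using diff_large_prob_le[OF \<eta>, of "- g" "- g - s"] by (simp add: E_def)
      also have "\<dots> \<le> (2 * \<kappa>) / \<eta>\<^sup>2" using s by (intro divide_right_mono) auto
      also have "\<dots> = c / 2" using \<eta> by (simp add: \<kappa>_def)
      finally show "measure M (D \<inter> shift (s + g) ` D) \<le> c" using n by simp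
    qed
  qed
qed

end

section \<open>Translates of rigid sets\<close>

text \<open>
  The Gaussian system with covariance \<open>C\<close> is weak mixing; for the set \<open>D\<close> of \<open>rigid_no_recurrence\<close>
  and every bound \<open>c\<close>, the returns of measure more than \<open>c\<close> happen at translates of finitely many
  elements of \<open>R\<close>.
\<close>

lemma rigid_translate_not_strongly_recurrent:
  fixes C :: "'g::ab_group_add \<Rightarrow> real"
  assumes cnt: "countable (UNIV :: 'g set)" and C: "positive_definite C" "C 0 = 1"
    and e: "\<And>k. (\<lambda>n. C (e n + k)) \<longlonglongrightarrow> 0" and k: "C k < 1"
    and R: "\<And>\<epsilon>. \<epsilon> > 0 \<Longrightarrow> finite {s\<in>R. C s < 1 - \<epsilon>}"
  shows "\<not> set_of_strong_recurrence_weak_mixing (translate R k)"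
proof
  assume "set_of_strong_recurrence_weak_mixing (translate R k)"
  then have sr: "strong_recurrence_weak_mixing_on TYPE('g \<Rightarrow> real) (translate R k)"
    by (rule set_of_strong_recurrence_weak_mixing_all_types)
  obtain M where "gaussian_law C M" using gaussian_law_exists[OF cnt C(1)] by blast
  then interpret gaussian C M using C by unfold_locales
  obtain D where D: "D \<in> sets M" "measure M D > 0"
    and small: "\<And>c. c > 0 \<Longrightarrow> \<exists>\<kappa>>0. \<forall>s. C s \<ge> 1 - \<kappa> \<longrightarrow> measure M (D \<inter> shift (s + k) ` D) \<le> c"
    using rigid_no_recurrence[OF k] by blast
  obtain c where c: "c > 0" "infinite {g\<in>translate R k. measure M (D \<inter> shift g ` D) > c}"
    using sr G_system_shift weak_mixing_shift[OF e] D unfolding strong_recurrence_weak_mixing_on_def by blast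
  obtain \<kappa> where \<kappa>: "\<kappa> > 0" "\<And>s. C s \<ge> 1 - \<kappa> \<Longrightarrow> measure M (D \<inter> shift (s + k) ` D) \<le> c"
    using small[OF c(1)] by blast
  have "{g\<in>translate R k. measure M (D \<inter> shift g ` D) > c} \<subseteq> (\<lambda>s. s + k) ` {s\<in>R. C s < 1 - \<kappa>}"
    using \<kappa>(2) by (force simp: translate_def not_le[symmetric])
  then show False using c(2) R[OF \<kappa>(1)] finite_subset by blast
qed

lemma strong_recurrence_imp_weak_mixing:
  "set_of_strong_recurrence S \<Longrightarrow> set_of_strong_recurrence_weak_mixing S"
  unfolding set_of_strong_recurrence_def set_of_strong_recurrence_weak_mixing_def
    strong_recurrence_on_def strong_recurrence_weak_mixing_on_def by blast

lemma measure_expanding_translate: "measure_expanding S \<Longrightarrow> measure_expanding (translate S h)"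
  by (simp add: measure_expanding_def translate_translate)

theorem corollary1p4:
  fixes S :: "'g::ab_group_add set"
  assumes "countable (UNIV :: 'g set)" and "infinite (UNIV :: 'g set)"
    and "measure_expanding S"
  shows "\<exists>S'. S' \<subseteq> S \<and> measure_expanding S' \<and>
    (\<forall>g. \<not> set_of_strong_recurrence_weak_mixing (translate S' g)) \<and>
    (\<forall>g. \<not> set_of_strong_recurrence (translate S' g))"
proof -
  obtain \<Gamma> :: "('g \<Rightarrow> complex) set" where rich: "rich \<Gamma>" using rich_exists[OF assms(1,2)] by blast
  obtain \<xi> h where \<xi>: "\<xi> \<in> \<Gamma>" "\<xi> h \<noteq> 1" using richD(3)[OF rich] by blast
  obtain S1 C1 e1 where S1: "S1 \<subseteq> S" "measure_expanding S1" and C1: "positive_definite C1" "C1 0 = 1"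
    "\<forall>\<epsilon>>0. finite {s\<in>S1. C1 s < 1 - \<epsilon>}" "\<forall>k. (\<lambda>n. C1 (e1 n + k)) \<longlonglongrightarrow> 0"
    "\<forall>g. (\<exists>\<phi>\<in>\<Gamma>. \<phi> g \<noteq> 1) \<longrightarrow> C1 g < 1"
    using rigid_measure_expanding_subset[OF assms(1) rich assms(3)] by (elim exE conjE)
  obtain S2 C2 e2 where S2: "S2 \<subseteq> translate S1 (- h)" "measure_expanding S2" and C2: "positive_definite C2" "C2 0 = 1"
    "\<forall>\<epsilon>>0. finite {s\<in>S2. C2 s < 1 - \<epsilon>}" "\<forall>k. (\<lambda>n. C2 (e2 n + k)) \<longlonglongrightarrow> 0"
    "\<forall>g. (\<exists>\<phi>\<in>\<Gamma>. \<phi> g \<noteq> 1) \<longrightarrow> C2 g < 1"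
    using rigid_measure_expanding_subset[OF assms(1) rich measure_expanding_translate[OF S1(2), of "- h"]]
    by (elim exE conjE)
  define S' where "S' = translate S2 h"
  have sub: "S' \<subseteq> S1"
  proof -
    have "S' \<subseteq> translate (translate S1 (- h)) h" using S2(1) unfolding S'_def by (auto simp: translate_def)
    then show ?thesis by (simp add: translate_translate)
  qed
  have main: "\<not> set_of_strong_recurrence_weak_mixing (translate S' g)" for g
  proof (cases "\<exists>\<phi>\<in>\<Gamma>. \<phi> g \<noteq> 1")
    case True
    \<comment> \<open>The first system covers all \<open>g\<close> at which some character in \<open>\<Gamma>\<close> is nontrivial, since
      \<open>S' \<subseteq> S1\<close>.\<close>
    show ?thesis
    proof (rule rigid_translate_not_strongly_recurrent[OF assms(1) C1(1,2)])
      show "(\<lambda>n. C1 (e1 n + k)) \<longlonglongrightarrow> 0" for k using C1(4) by blast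
      show "C1 g < 1" using C1(5) True by blast
      show "finite {s\<in>S'. C1 s < 1 - \<epsilon>}" if "\<epsilon> > 0" for \<epsilon>
        by (rule finite_subset[of _ "{s\<in>S1. C1 s < 1 - \<epsilon>}"]) (use sub C1(3) that in auto)
    qed
  next
    case False
    \<comment> \<open>Otherwise \<open>\<xi> (h + g) = \<xi> h \<noteq> 1\<close>, and \<open>S' + g = S2 + (h + g)\<close> is covered by the second
      system.\<close>
    then have "\<xi> g = 1" using \<xi>(1) by blast
    then have "\<xi> (h + g) \<noteq> 1" using \<xi> characterD(5)[OF richD(1)[OF rich \<xi>(1)], of h g] by simp
    then have "C2 (h + g) < 1" using C2(5) \<xi>(1) by blast
    then have "\<not> set_of_strong_recurrence_weak_mixing (translate S2 (h + g))"
      using C2(3,4) by (intro rigid_translate_not_strongly_recurrent[OF assms(1) C2(1,2)]) auto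
    then show ?thesis by (simp add: S'_def translate_translate)
  qed
  show ?thesis
  proof (intro exI[of _ S'] conjI allI)
    show "S' \<subseteq> S" using sub S1(1) by blast
    show "measure_expanding S'" unfolding S'_def by (rule measure_expanding_translate[OF S2(2)])
    show "\<not> set_of_strong_recurrence_weak_mixing (translate S' g)" for g by (rule main)
    show "\<not> set_of_strong_recurrence (translate S' g)" for g
      using main strong_recurrence_imp_weak_mixing by blast
  qed
qed

end
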